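(* Let $M$ be a smooth 4-manifold with a perfect triple $\Sigma^1,\Sigma^2,\Sigma^3$ of closed 2-forms. Let $d_2:S\to E\otimes\Lambda^1$ be the second operator of the Plebański complex, and let $d_2^*:E\otimes\Lambda^1\to S$ be its formal adjoint with respect to the (indefinite, nondegenerate) inner product $$\langle a,a\rangle=\int_M\epsilon^{ijk}\,\Sigma^i\wedge a^j\wedge a^k$$ on $E\otimes\Lambda^1$ and any choice of inner product on $S$. Then the linearisation at $\Sigma^i$ of the Einstein equations (in Plebański form) is the equation $d_2^*d_2\sigma=0$. That is, for a section $\sigma$ of $S$, there exist $a\in E\otimes\Lambda^1$ and a field $\psi^{ij}$ of symmetric tracefree $3\times3$ matrices such that $$d\sigma^i+\epsilon^{ijk}a^j\wedge\Sigma^k=0,\qquad da^i=\psi^{ij}\Sigma^j,$$ if and only if $d_2^*d_2\sigma=0$.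
   Context: Conventions. $E=\mathbb{R}^3$ (trivial bundle), with indices $i,j,k\in\{1,2,3\}$, Kronecker $\delta^{ij}$ and Levi-Civita symbol $\epsilon^{ijk}$; repeated indices are summed. $\Lambda^p$ is the bundle of $p$-forms. Spaces of sections are denoted by the same letters as the bundles. Formal adjoints are defined by integration by parts against compactly supported sections. Perfect triple. A triple of 2-forms $\Sigma^i$ with $\Sigma^i\wedge\Sigma^j = 2\delta^{ij}v_\Sigma$, where $v_\Sigma=\tfrac16\Sigma^k\wedge\Sigma^k$ is nowhere vanishing. $M$ is oriented by $v_\Sigma$. The triple determines a Riemannian metric $g$ with volume form $v_\Sigma$, for which the $\Sigma^i$ are self-dual and, raising indices with $g$, satisfy $$\Sigma^i_\mu{}^\alpha\Sigma^j_\alpha{}^\nu=-\delta^{ij}\delta_\mu{}^\nu+\epsilon^{ijk}\Sigma^k_\mu{}^\nu$$ (the order and overall sign of the triple are taken so that this holds with $g$ positive definite). Index raising, $\nabla$ and the volume tensor $\epsilon_{\mu\nu\rho\sigma}$ refer to $g$. Einstein equations in Plebański form. For a perfect triple $\Sigma^i$, the equation $d\Sigma^i+\epsilon^{ijk}A^j\wedge\Sigma^k=0$ determines a triple of 1-forms $A^i$, and $\mathrm{Ric}=0$ for the metric of $\Sigma^i$ is the condition that $F^i(A)=dA^i+\tfrac12\epsilon^{ijk}A^j\wedge A^k$ equals $\Psi^{ij}\Sigma^j$ for some symmetric tracefree $\Psi^{ij}$. At a background with $d\Sigma^i=0$ one has $A^i=0$ and $\Psi^{ij}=0$. Perturbing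 $\Sigma^i$ by $\sigma^i$, $A^i$ by $a^i$ and $\Psi^{ij}$ by $\psi^{ij}$ gives the linearised system displayed in the claim. The bundle $S$. $S\subset E\otimes\Lambda^2$ is the rank 13 bundle tangent to the space of perfect triples at $\Sigma$: $S=\{h_{[\mu}{}^\alpha\Sigma^i_{|\alpha|\nu]}\}$, $h_{\mu\nu}$ an arbitrary $4\times4$ tensor. It is parametrised as $\sigma^i_{\mu\nu}=2\epsilon^{ijk}\Sigma^j_{\mu\nu}h^k+2h_{[\mu}{}^\alpha\Sigma^i_{|\alpha|\nu]}$ with $h^i\in E$ and $h_{\mu\nu}=\tilde h_{\mu\nu}+\tfrac14g_{\mu\nu}h$ symmetric, $\tilde h_{\mu\nu}$ tracefree. An inner product on $S$ means one of the form $\langle\sigma,\sigma\rangle=\int_M\big(\beta_1h^2+\beta_2(h^i)^2+\beta_3(\tilde h_{\mu\nu})^2\big)v_\Sigma$ with constants $\beta_1,\beta_2,\beta_3>0$. The operator $d_2$. $J_1(a)^i_\mu=\epsilon^{ijk}\Sigma^j_\mu{}^\alpha a^k_\alpha$ is an invertible endomorphism of $E\otimes\Lambda^1$, and $d_2\sigma=\tfrac12J_1^{-1}(\star d\sigma)$ with the convention $(\star d\sigma)^i_\mu=\epsilon_\mu{}^{\alpha\beta\gamma}\nabla_\alpha\sigma^i_{\beta\gamma}$. Equivalently, $a=d_2\sigma$ is the unique solution of $d\sigma^i+\epsilon^{ijk}a^j\wedge\Sigma^k=0$. *)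

theory Defs
  imports "HOL-Analysis.Analysis"
begin

section \<open>Smooth manifolds of dimension four\<close>

text \<open>
  A chart is a pair (domain, coordinate map).  A smooth structure on the whole type \<open>'m\<close>
  (a second countable Hausdorff space) is given by a smooth atlas.
\<close>

primrec Ck_on :: "nat \<Rightarrow> ('a::real_normed_vector \<Rightarrow> 'b::real_normed_vector) \<Rightarrow> 'a set \<Rightarrow> bool" where
  "Ck_on 0 f U \<longleftrightarrow> continuous_on U f"
| "Ck_on (Suc n) f U \<longleftrightarrow>
     (\<forall>x\<in>U. f differentiable (at x)) \<and> (\<forall>v. Ck_on n (\<lambda>x. frechet_derivative f (at x) v) U)"

definition smooth_on :: "('a::real_normed_vector \<Rightarrow> 'b::real_normed_vector) \<Rightarrow> 'a set \<Rightarrow> bool" where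
  "smooth_on f U \<longleftrightarrow> (\<forall>n. Ck_on n f U)"

type_synonym 'm chart = "'m set \<times> ('m \<Rightarrow> real^4)"

abbreviation chart_dom :: "'m chart \<Rightarrow> 'm set" where
  "chart_dom c \<equiv> fst c"

abbreviation chart_map :: "'m chart \<Rightarrow> 'm \<Rightarrow> real^4" where
  "chart_map c \<equiv> snd c"

definition chart_inv :: "'m chart \<Rightarrow> real^4 \<Rightarrow> 'm" where
  "chart_inv c = inv_into (chart_dom c) (chart_map c)"

definition smooth_atlas :: "'m::{t2_space, second_countable_topology} chart set \<Rightarrow> bool" where
  "smooth_atlas \<A> \<longleftrightarrow>
     (\<Union>c\<in>\<A>. chart_dom c) = UNIV \<and>
     (\<forall>c\<in>\<A>. open (chart_dom c) \<and> open (chart_map c ` chart_dom c) \<and>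
        homeomorphism (chart_dom c) (chart_map c ` chart_dom c) (chart_map c) (chart_inv c)) \<and>
     (\<forall>c\<in>\<A>. \<forall>c'\<in>\<A>. smooth_on (chart_map c' \<circ> chart_inv c)
        (chart_map c ` (chart_dom c \<inter> chart_dom c')))"

definition chart_at :: "'m chart set \<Rightarrow> 'm \<Rightarrow> 'm chart" where
  "chart_at \<A> p = (SOME c. c \<in> \<A> \<and> p \<in> chart_dom c)"

definition smooth_in_chart :: "'m chart \<Rightarrow> ('m \<Rightarrow> real) \<Rightarrow> bool" where
  "smooth_in_chart c f \<longleftrightarrow> smooth_on (f \<circ> chart_inv c) (chart_map c ` chart_dom c)"

definition smooth_function :: "'m chart set \<Rightarrow> ('m \<Rightarrow> real) \<Rightarrow> bool" where
  "smooth_function \<A> f \<longleftrightarrow> (\<forall>c\<in>\<A>. smooth_in_chart c f)"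

text \<open>The coordinate partial derivative of a function in direction \<open>\<mu>\<close>, at a point of the manifold.\<close>

definition pd :: "'m chart \<Rightarrow> 4 \<Rightarrow> ('m \<Rightarrow> real) \<Rightarrow> 'm \<Rightarrow> real" where
  "pd c \<mu> f p = frechet_derivative (f \<circ> chart_inv c) (at (chart_map c p)) (axis \<mu> 1)"

text \<open>\<open>jac c c' p \<mu> \<nu>\<close> is the derivative of the \<open>\<mu>\<close>-th \<open>c'\<close>-coordinate by the \<open>\<nu>\<close>-th \<open>c\<close>-coordinate.\<close>

definition jac :: "'m chart \<Rightarrow> 'm chart \<Rightarrow> 'm \<Rightarrow> 4 \<Rightarrow> 4 \<Rightarrow> real" where
  "jac c c' p \<mu> \<nu> = pd c \<nu> (\<lambda>q. chart_map c' q $ \<mu>) p"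


section \<open>Tensor fields\<close>

text \<open>
  A tensor field is the family of its component arrays in the charts of the atlas, smooth in each
  chart and related by the tensor transformation law on overlaps.  Only the values at
  points \<open>p \<in> chart_dom c\<close> with \<open>c \<in> \<A>\<close> are meaningful; all conditions on
  fields are imposed at such pairs only.  Since the atlas covers the manifold, charts range over
  all of \<open>\<A>\<close>.  Components of forms are
  normalised as \<open>\<sigma> = 1/2 \<sigma>\<^sub>\<mu>\<^sub>\<nu> dx\<^sup>\<mu> \<and> dx\<^sup>\<nu>\<close>, and so on.
\<close>

type_synonym 'm field1 = "'m chart \<Rightarrow> 'm \<Rightarrow> 4 \<Rightarrow> real"
type_synonym 'm field2 = "'m chart \<Rightarrow> 'm \<Rightarrow> 4 \<Rightarrow> 4 \<Rightarrow> real"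
type_synonym 'm field3 = "'m chart \<Rightarrow> 'm \<Rightarrow> 4 \<Rightarrow> 4 \<Rightarrow> 4 \<Rightarrow> real"
type_synonym 'm field4 = "'m chart \<Rightarrow> 'm \<Rightarrow> 4 \<Rightarrow> 4 \<Rightarrow> 4 \<Rightarrow> 4 \<Rightarrow> real"

definition one_form :: "'m chart set \<Rightarrow> 'm field1 \<Rightarrow> bool" where
  "one_form \<A> \<omega> \<longleftrightarrow>
     (\<forall>c\<in>\<A>. \<forall>\<mu>. smooth_in_chart c (\<lambda>p. \<omega> c p \<mu>)) \<and>
     (\<forall>c\<in>\<A>. \<forall>c'\<in>\<A>. \<forall>p\<in>chart_dom c \<inter> chart_dom c'. \<forall>\<mu>.
        \<omega> c p \<mu> = (\<Sum>\<alpha>\<in>UNIV. \<omega> c' p \<alpha> * jac c c' p \<alpha> \<mu>))"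

definition tensor2 :: "'m chart set \<Rightarrow> 'm field2 \<Rightarrow> bool" where
  "tensor2 \<A> T \<longleftrightarrow>
     (\<forall>c\<in>\<A>. \<forall>\<mu> \<nu>. smooth_in_chart c (\<lambda>p. T c p \<mu> \<nu>)) \<and>
     (\<forall>c\<in>\<A>. \<forall>c'\<in>\<A>. \<forall>p\<in>chart_dom c \<inter> chart_dom c'. \<forall>\<mu> \<nu>.
        T c p \<mu> \<nu> = (\<Sum>\<alpha>\<in>UNIV. \<Sum>\<beta>\<in>UNIV. T c' p \<alpha> \<beta> * jac c c' p \<alpha> \<mu> * jac c c' p \<beta> \<nu>))"

definition two_form :: "'m chart set \<Rightarrow> 'm field2 \<Rightarrow> bool" where
  "two_form \<A> \<sigma> \<longleftrightarrow> tensor2 \<A> \<sigma> \<and>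
     (\<forall>c\<in>\<A>. \<forall>p\<in>chart_dom c. \<forall>\<mu> \<nu>. \<sigma> c p \<mu> \<nu> = - \<sigma> c p \<nu> \<mu>)"

definition riemannian_metric :: "'m chart set \<Rightarrow> 'm field2 \<Rightarrow> bool" where
  "riemannian_metric \<A> g \<longleftrightarrow> tensor2 \<A> g \<and>
     (\<forall>c\<in>\<A>. \<forall>p\<in>chart_dom c.
        (\<forall>\<mu> \<nu>. g c p \<mu> \<nu> = g c p \<nu> \<mu>) \<and>
        (\<forall>x::real^4. x \<noteq> 0 \<longrightarrow> (\<Sum>\<mu>\<in>UNIV. \<Sum>\<nu>\<in>UNIV. g c p \<mu> \<nu> * x $ \<mu> * x $ \<nu>) > 0))"

definition ext_d1 :: "'m field1 \<Rightarrow> 'm field2" where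
  "ext_d1 \<omega> c p \<mu> \<nu> = pd c \<mu> (\<lambda>q. \<omega> c q \<nu>) p - pd c \<nu> (\<lambda>q. \<omega> c q \<mu>) p"

definition ext_d2 :: "'m field2 \<Rightarrow> 'm field3" where
  "ext_d2 \<sigma> c p \<mu> \<nu> \<rho> =
     pd c \<mu> (\<lambda>q. \<sigma> c q \<nu> \<rho>) p + pd c \<nu> (\<lambda>q. \<sigma> c q \<rho> \<mu>) p + pd c \<rho> (\<lambda>q. \<sigma> c q \<mu> \<nu>) p"


section \<open>Pointwise algebra\<close>

text \<open>In this section all arguments are arrays of components at one point in one chart.\<close>

definition kdelta :: "'a \<Rightarrow> 'a \<Rightarrow> real" where
  "kdelta i j = (if i = j then 1 else 0)"

definition eps3 :: "3 \<Rightarrow> 3 \<Rightarrow> 3 \<Rightarrow> real" where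
  "eps3 i j k =
     (if (i, j, k) \<in> {(1, 2, 3), (2, 3, 1), (3, 1, 2)} then 1
      else if (i, j, k) \<in> {(2, 1, 3), (1, 3, 2), (3, 2, 1)} then - 1
      else 0)"

definition wedge11 :: "(4 \<Rightarrow> real) \<Rightarrow> (4 \<Rightarrow> real) \<Rightarrow> 4 \<Rightarrow> 4 \<Rightarrow> real" where
  "wedge11 a b \<mu> \<nu> = a \<mu> * b \<nu> - a \<nu> * b \<mu>"

definition wedge12 :: "(4 \<Rightarrow> real) \<Rightarrow> (4 \<Rightarrow> 4 \<Rightarrow> real) \<Rightarrow> 4 \<Rightarrow> 4 \<Rightarrow> 4 \<Rightarrow> real" where
  "wedge12 a s \<mu> \<nu> \<rho> = a \<mu> * s \<nu> \<rho> + a \<nu> * s \<rho> \<mu> + a \<rho> * s \<mu> \<nu>"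

definition wedge22 :: "(4 \<Rightarrow> 4 \<Rightarrow> real) \<Rightarrow> (4 \<Rightarrow> 4 \<Rightarrow> real) \<Rightarrow> 4 \<Rightarrow> 4 \<Rightarrow> 4 \<Rightarrow> 4 \<Rightarrow> real" where
  "wedge22 s t \<mu> \<nu> \<rho> \<tau> =
     s \<mu> \<nu> * t \<rho> \<tau> - s \<mu> \<rho> * t \<nu> \<tau> + s \<mu> \<tau> * t \<nu> \<rho>
     + s \<nu> \<rho> * t \<mu> \<tau> - s \<nu> \<tau> * t \<mu> \<rho> + s \<rho> \<tau> * t \<mu> \<nu>"

definition inv_metric :: "(4 \<Rightarrow> 4 \<Rightarrow> real) \<Rightarrow> 4 \<Rightarrow> 4 \<Rightarrow> real" where
  "inv_metric G \<mu> \<nu> = matrix_inv (\<chi> \<alpha> \<beta>. G \<alpha> \<beta>) $ \<mu> $ \<nu>"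

text \<open>\<open>raise2 G T \<mu> \<alpha>\<close> stands for \<open>T\<^sub>\<mu>\<^sup>\<alpha>\<close>: the second index of \<open>T\<close> is raised.\<close>

definition raise2 :: "(4 \<Rightarrow> 4 \<Rightarrow> real) \<Rightarrow> (4 \<Rightarrow> 4 \<Rightarrow> real) \<Rightarrow> 4 \<Rightarrow> 4 \<Rightarrow> real" where
  "raise2 G T \<mu> \<alpha> = (\<Sum>\<beta>\<in>UNIV. T \<mu> \<beta> * inv_metric G \<beta> \<alpha>)"

text \<open>\<open>h_action G \<Sigma> h i \<mu> \<nu>\<close> stands for
  \<open>h\<^sub>[\<^sub>\<mu>\<^sup>\<alpha> \<Sigma>\<^sup>i\<^sub>|\<^sub>\<alpha>\<^sub>|\<^sub>\<nu>\<^sub>]\<close>, antisymmetrised with weight one half.\<close>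

definition h_action ::
  "(4 \<Rightarrow> 4 \<Rightarrow> real) \<Rightarrow> (3 \<Rightarrow> 4 \<Rightarrow> 4 \<Rightarrow> real) \<Rightarrow> (4 \<Rightarrow> 4 \<Rightarrow> real) \<Rightarrow> 3 \<Rightarrow> 4 \<Rightarrow> 4 \<Rightarrow> real" where
  "h_action G \<Sigma> h i \<mu> \<nu> =
     1/2 * ((\<Sum>\<alpha>\<in>UNIV. raise2 G h \<mu> \<alpha> * \<Sigma> i \<alpha> \<nu>) - (\<Sum>\<alpha>\<in>UNIV. raise2 G h \<nu> \<alpha> * \<Sigma> i \<alpha> \<mu>))"

definition S_fibre ::
  "(4 \<Rightarrow> 4 \<Rightarrow> real) \<Rightarrow> (3 \<Rightarrow> 4 \<Rightarrow> 4 \<Rightarrow> real) \<Rightarrow> (3 \<Rightarrow> 4 \<Rightarrow> 4 \<Rightarrow> real) set" where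
  "S_fibre G \<Sigma> = range (h_action G \<Sigma>)"

definition S_param ::
  "(4 \<Rightarrow> 4 \<Rightarrow> real) \<Rightarrow> (3 \<Rightarrow> 4 \<Rightarrow> 4 \<Rightarrow> real) \<Rightarrow> (3 \<Rightarrow> real) \<Rightarrow> (4 \<Rightarrow> 4 \<Rightarrow> real)
     \<Rightarrow> 3 \<Rightarrow> 4 \<Rightarrow> 4 \<Rightarrow> real" where
  "S_param G \<Sigma> u h i \<mu> \<nu> =
     2 * (\<Sum>j\<in>UNIV. \<Sum>k\<in>UNIV. eps3 i j k * \<Sigma> j \<mu> \<nu> * u k) + 2 * h_action G \<Sigma> h i \<mu> \<nu>"

text \<open>The parameters \<open>(h\<^sup>i, h\<^sub>\<mu>\<^sub>\<nu>)\<close> of an element of the fibre of \<open>S\<close>.\<close>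

definition S_coords ::
  "(4 \<Rightarrow> 4 \<Rightarrow> real) \<Rightarrow> (3 \<Rightarrow> 4 \<Rightarrow> 4 \<Rightarrow> real) \<Rightarrow> (3 \<Rightarrow> 4 \<Rightarrow> 4 \<Rightarrow> real)
     \<Rightarrow> (3 \<Rightarrow> real) \<times> (4 \<Rightarrow> 4 \<Rightarrow> real)" where
  "S_coords G \<Sigma> s = (THE uh. (\<forall>\<mu> \<nu>. snd uh \<mu> \<nu> = snd uh \<nu> \<mu>) \<and> s = S_param G \<Sigma> (fst uh) (snd uh))"

definition metric_trace :: "(4 \<Rightarrow> 4 \<Rightarrow> real) \<Rightarrow> (4 \<Rightarrow> 4 \<Rightarrow> real) \<Rightarrow> real" where
  "metric_trace G h = (\<Sum>\<mu>\<in>UNIV. \<Sum>\<nu>\<in>UNIV. inv_metric G \<mu> \<nu> * h \<mu> \<nu>)"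

definition tracefree_part :: "(4 \<Rightarrow> 4 \<Rightarrow> real) \<Rightarrow> (4 \<Rightarrow> 4 \<Rightarrow> real) \<Rightarrow> 4 \<Rightarrow> 4 \<Rightarrow> real" where
  "tracefree_part G h \<mu> \<nu> = h \<mu> \<nu> - 1/4 * G \<mu> \<nu> * metric_trace G h"

definition metric_inner2 ::
  "(4 \<Rightarrow> 4 \<Rightarrow> real) \<Rightarrow> (4 \<Rightarrow> 4 \<Rightarrow> real) \<Rightarrow> (4 \<Rightarrow> 4 \<Rightarrow> real) \<Rightarrow> real" where
  "metric_inner2 G h k =
     (\<Sum>\<mu>\<in>UNIV. \<Sum>\<nu>\<in>UNIV. \<Sum>\<alpha>\<in>UNIV. \<Sum>\<beta>\<in>UNIV.
        inv_metric G \<mu> \<alpha> * inv_metric G \<nu> \<beta> * h \<mu> \<nu> * k \<alpha> \<beta>)"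

text \<open>Polarisation of \<open>\<beta>\<^sub>1 h\<^sup>2 + \<beta>\<^sub>2 (h\<^sup>i)\<^sup>2 + \<beta>\<^sub>3 (h~\<^sub>\<mu>\<^sub>\<nu>)\<^sup>2\<close>.\<close>

definition S_inner_pt ::
  "real \<Rightarrow> real \<Rightarrow> real \<Rightarrow> (4 \<Rightarrow> 4 \<Rightarrow> real) \<Rightarrow> (3 \<Rightarrow> 4 \<Rightarrow> 4 \<Rightarrow> real)
     \<Rightarrow> (3 \<Rightarrow> 4 \<Rightarrow> 4 \<Rightarrow> real) \<Rightarrow> (3 \<Rightarrow> 4 \<Rightarrow> 4 \<Rightarrow> real) \<Rightarrow> real" where
  "S_inner_pt \<beta>\<^sub>1 \<beta>\<^sub>2 \<beta>\<^sub>3 G \<Sigma> s t =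
     (let (u, h) = S_coords G \<Sigma> s; (v, k) = S_coords G \<Sigma> t in
        \<beta>\<^sub>1 * metric_trace G h * metric_trace G k
      + \<beta>\<^sub>2 * (\<Sum>i\<in>UNIV. u i * v i)
      + \<beta>\<^sub>3 * metric_inner2 G (tracefree_part G h) (tracefree_part G k))"

definition J1 ::
  "(4 \<Rightarrow> 4 \<Rightarrow> real) \<Rightarrow> (3 \<Rightarrow> 4 \<Rightarrow> 4 \<Rightarrow> real) \<Rightarrow> (3 \<Rightarrow> 4 \<Rightarrow> real) \<Rightarrow> 3 \<Rightarrow> 4 \<Rightarrow> real" where
  "J1 G \<Sigma> a i \<mu> =
     (\<Sum>j\<in>UNIV. \<Sum>k\<in>UNIV. \<Sum>\<alpha>\<in>UNIV. eps3 i j k * raise2 G (\<Sigma> j) \<mu> \<alpha> * a k \<alpha>)"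


section \<open>Perfect triples\<close>

type_synonym 'm triple1 = "3 \<Rightarrow> 'm field1"
type_synonym 'm triple2 = "3 \<Rightarrow> 'm field2"

text \<open>The 4-form \<open>v\<^sub>\<Sigma> = 1/6 \<Sigma>\<^sup>k \<and> \<Sigma>\<^sup>k\<close>.\<close>

definition v_form :: "'m triple2 \<Rightarrow> 'm field4" where
  "v_form \<Sigma> c p \<mu> \<nu> \<rho> \<tau> = 1/6 * (\<Sum>k\<in>UNIV. wedge22 (\<Sigma> k c p) (\<Sigma> k c p) \<mu> \<nu> \<rho> \<tau>)"

definition perfect_triple :: "'m chart set \<Rightarrow> 'm triple2 \<Rightarrow> bool" where
  "perfect_triple \<A> \<Sigma> \<longleftrightarrow>
     (\<forall>i. two_form \<A> (\<Sigma> i)) \<and>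
     (\<forall>c\<in>\<A>. \<forall>p\<in>chart_dom c.
        (\<forall>i j \<mu> \<nu> \<rho> \<tau>. wedge22 (\<Sigma> i c p) (\<Sigma> j c p) \<mu> \<nu> \<rho> \<tau> = 2 * kdelta i j * v_form \<Sigma> c p \<mu> \<nu> \<rho> \<tau>) \<and>
        v_form \<Sigma> c p 1 2 3 4 \<noteq> 0)"

text \<open>
  \<open>g\<close> is the metric determined by the perfect triple: its volume form is \<open>v\<^sub>\<Sigma>\<close> (which also
  fixes the orientation, so that the volume tensor of \<open>g\<close> is \<open>v_form \<Sigma>\<close>),
  the \<open>\<Sigma>\<^sup>i\<close> are self-dual, and they satisfy the quaternion relations.  The last condition
  alone determines \<open>g\<close> uniquely.
\<close>

definition metric_of_triple :: "'m chart set \<Rightarrow> 'm triple2 \<Rightarrow> 'm field2 \<Rightarrow> bool" where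
  "metric_of_triple \<A> \<Sigma> g \<longleftrightarrow>
     riemannian_metric \<A> g \<and>
     (\<forall>c\<in>\<A>. \<forall>p\<in>chart_dom c.
        \<bar>v_form \<Sigma> c p 1 2 3 4\<bar> = sqrt (det (\<chi> \<mu> \<nu>. g c p \<mu> \<nu>)) \<and>
        (\<forall>i \<mu> \<nu>. 1/2 * (\<Sum>\<rho>\<in>UNIV. \<Sum>\<tau>\<in>UNIV. \<Sum>\<alpha>\<in>UNIV. \<Sum>\<beta>\<in>UNIV.
            v_form \<Sigma> c p \<mu> \<nu> \<rho> \<tau> * inv_metric (g c p) \<rho> \<alpha> * inv_metric (g c p) \<tau> \<beta> * \<Sigma> i c p \<alpha> \<beta>)
          = \<Sigma> i c p \<mu> \<nu>) \<and>
        (\<forall>i j \<mu> \<nu>.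
          (\<Sum>\<alpha>\<in>UNIV. raise2 (g c p) (\<Sigma> i c p) \<mu> \<alpha> * raise2 (g c p) (\<Sigma> j c p) \<alpha> \<nu>)
          = - kdelta i j * kdelta \<mu> \<nu> + (\<Sum>k\<in>UNIV. eps3 i j k * raise2 (g c p) (\<Sigma> k c p) \<mu> \<nu>)))"


section \<open>Integration against the orientation of the triple\<close>

text \<open>
  The Borel measure on the manifold whose density in each chart is \<open>\<bar>v\<bar>\<close>, for a nowhere
  vanishing 4-form \<open>v\<close>.  It exists and is unique because the densities agree on overlaps and
  countably many chart domains cover the manifold.
\<close>

definition volume_measure ::
  "'m::{t2_space, second_countable_topology} chart set \<Rightarrow> 'm field4 \<Rightarrow> 'm measure" where
  "volume_measure \<A> v = (SOME M. sets M = sets borel \<and>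
     (\<forall>c\<in>\<A>. \<forall>B\<in>sets borel. B \<subseteq> chart_dom c \<longrightarrow>
        emeasure M B = (\<integral>\<^sup>+x\<in>chart_map c ` B. ennreal \<bar>v c (chart_inv c x) 1 2 3 4\<bar> \<partial>lborel)))"

text \<open>
  The integral of a 4-form \<open>\<omega> = f v\<close> over the manifold oriented by \<open>v\<close> is the integral
  of the function \<open>f\<close> against the volume measure.
\<close>

definition form_integral ::
  "'m::{t2_space, second_countable_topology} chart set \<Rightarrow> 'm field4 \<Rightarrow> 'm field4 \<Rightarrow> real" where
  "form_integral \<A> v \<omega> =
     (LINT p|volume_measure \<A> v. (let c = chart_at \<A> p in \<omega> c p 1 2 3 4 / v c p 1 2 3 4))"


section \<open>The operator \<open>d\<^sub>2\<close> and its formal adjoint\<close>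

definition E1_section :: "'m chart set \<Rightarrow> 'm triple1 \<Rightarrow> bool" where
  "E1_section \<A> a \<longleftrightarrow> (\<forall>i. one_form \<A> (a i))"

definition S_section :: "'m chart set \<Rightarrow> 'm field2 \<Rightarrow> 'm triple2 \<Rightarrow> 'm triple2 \<Rightarrow> bool" where
  "S_section \<A> g \<Sigma> \<sigma> \<longleftrightarrow>
     (\<forall>i. two_form \<A> (\<sigma> i)) \<and>
     (\<forall>c\<in>\<A>. \<forall>p\<in>chart_dom c. (\<lambda>i. \<sigma> i c p) \<in> S_fibre (g c p) (\<lambda>i. \<Sigma> i c p))"

definition compactly_supported :: "'m::topological_space chart set \<Rightarrow> 'm triple2 \<Rightarrow> bool" where
  "compactly_supported \<A> \<sigma> \<longleftrightarrow>
     (\<exists>K. compact K \<and> (\<forall>c\<in>\<A>. \<forall>p\<in>chart_dom c - K. \<forall>i \<mu> \<nu>. \<sigma> i c p \<mu> \<nu> = 0))"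

definition christoffel :: "'m field2 \<Rightarrow> 'm chart \<Rightarrow> 'm \<Rightarrow> 4 \<Rightarrow> 4 \<Rightarrow> 4 \<Rightarrow> real" where
  "christoffel g c p \<kappa> \<alpha> \<beta> =
     1/2 * (\<Sum>\<tau>\<in>UNIV. inv_metric (g c p) \<kappa> \<tau> *
       (pd c \<alpha> (\<lambda>q. g c q \<tau> \<beta>) p + pd c \<beta> (\<lambda>q. g c q \<tau> \<alpha>) p - pd c \<tau> (\<lambda>q. g c q \<alpha> \<beta>) p))"

definition nabla2 :: "'m field2 \<Rightarrow> 'm field2 \<Rightarrow> 'm field3" where
  "nabla2 g T c p \<alpha> \<beta> \<gamma> =
     pd c \<alpha> (\<lambda>q. T c q \<beta> \<gamma>) p
     - (\<Sum>\<kappa>\<in>UNIV. christoffel g c p \<kappa> \<alpha> \<beta> * T c p \<kappa> \<gamma>)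
     - (\<Sum>\<kappa>\<in>UNIV. christoffel g c p \<kappa> \<alpha> \<gamma> * T c p \<beta> \<kappa>)"

text \<open>
  \<open>(\<star>d\<sigma>)\<^sub>\<mu> = \<epsilon>\<^sub>\<mu>\<^sup>\<alpha>\<^sup>\<beta>\<^sup>\<gamma> \<nabla>\<^sub>\<alpha> \<sigma>\<^sub>\<beta>\<^sub>\<gamma>\<close>;
  since \<open>\<nabla>\<close> is torsion free, this is \<open>1/3 \<epsilon>\<^sub>\<mu>\<^sup>\<alpha>\<^sup>\<beta>\<^sup>\<gamma> (d\<sigma>)\<^sub>\<alpha>\<^sub>\<beta>\<^sub>\<gamma>\<close>, not the
  customary factor \<open>1/6\<close>.  The volume tensor is
  \<open>v_form \<Sigma>\<close>.
\<close>

definition star_d :: "'m field2 \<Rightarrow> 'm triple2 \<Rightarrow> 'm triple2 \<Rightarrow> 'm triple1" where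
  "star_d g \<Sigma> \<sigma> i c p \<mu> =
     (\<Sum>\<alpha>\<in>UNIV. \<Sum>\<beta>\<in>UNIV. \<Sum>\<gamma>\<in>UNIV. \<Sum>\<alpha>'\<in>UNIV. \<Sum>\<beta>'\<in>UNIV. \<Sum>\<gamma>'\<in>UNIV.
        v_form \<Sigma> c p \<mu> \<alpha>' \<beta>' \<gamma>' * inv_metric (g c p) \<alpha>' \<alpha> * inv_metric (g c p) \<beta>' \<beta>
        * inv_metric (g c p) \<gamma>' \<gamma> * nabla2 g (\<sigma> i) c p \<alpha> \<beta> \<gamma>)"

definition d2 :: "'m field2 \<Rightarrow> 'm triple2 \<Rightarrow> 'm triple2 \<Rightarrow> 'm triple1" where
  "d2 g \<Sigma> \<sigma> i c p \<mu> =
     1/2 * inv (J1 (g c p) (\<lambda>j. \<Sigma> j c p)) (\<lambda>j. star_d g \<Sigma> \<sigma> j c p) i \<mu>"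

text \<open>Polarisation of \<open>\<langle>a, a\<rangle> = \<integral> \<epsilon>\<^sup>i\<^sup>j\<^sup>k \<Sigma>\<^sup>i \<and> a\<^sup>j \<and> a\<^sup>k\<close>; this expression is symmetric in
  \<open>a\<close> and \<open>b\<close>.\<close>

definition E1_inner ::
  "'m::{t2_space, second_countable_topology} chart set \<Rightarrow> 'm triple2
     \<Rightarrow> 'm triple1 \<Rightarrow> 'm triple1 \<Rightarrow> real" where
  "E1_inner \<A> \<Sigma> a b = form_integral \<A> (v_form \<Sigma>) (\<lambda>c p \<mu> \<nu> \<rho> \<tau>.
     \<Sum>i\<in>UNIV. \<Sum>j\<in>UNIV. \<Sum>k\<in>UNIV.
       eps3 i j k * wedge22 (\<Sigma> i c p) (wedge11 (a j c p) (b k c p)) \<mu> \<nu> \<rho> \<tau>)"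

definition S_inner ::
  "real \<Rightarrow> real \<Rightarrow> real \<Rightarrow> 'm::{t2_space, second_countable_topology} chart set \<Rightarrow> 'm field2
     \<Rightarrow> 'm triple2 \<Rightarrow> 'm triple2 \<Rightarrow> 'm triple2 \<Rightarrow> real" where
  "S_inner \<beta>\<^sub>1 \<beta>\<^sub>2 \<beta>\<^sub>3 \<A> g \<Sigma> \<sigma> \<tau> = form_integral \<A> (v_form \<Sigma>) (\<lambda>c p \<mu> \<nu> \<rho> \<kappa>.
     S_inner_pt \<beta>\<^sub>1 \<beta>\<^sub>2 \<beta>\<^sub>3 (g c p) (\<lambda>i. \<Sigma> i c p) (\<lambda>i. \<sigma> i c p) (\<lambda>i. \<tau> i c p)
       * v_form \<Sigma> c p \<mu> \<nu> \<rho> \<kappa>)"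

definition formal_adjoint_d2 ::
  "real \<Rightarrow> real \<Rightarrow> real \<Rightarrow> 'm::{t2_space, second_countable_topology} chart set \<Rightarrow> 'm field2
     \<Rightarrow> 'm triple2 \<Rightarrow> ('m triple1 \<Rightarrow> 'm triple2) \<Rightarrow> bool" where
  "formal_adjoint_d2 \<beta>\<^sub>1 \<beta>\<^sub>2 \<beta>\<^sub>3 \<A> g \<Sigma> D \<longleftrightarrow>
     (\<forall>a. E1_section \<A> a \<longrightarrow>
        S_section \<A> g \<Sigma> (D a) \<and>
        (\<forall>\<sigma>. S_section \<A> g \<Sigma> \<sigma> \<and> compactly_supported \<A> \<sigma> \<longrightarrow>
           E1_inner \<A> \<Sigma> (d2 g \<Sigma> \<sigma>) a = S_inner \<beta>\<^sub>1 \<beta>\<^sub>2 \<beta>\<^sub>3 \<A> g \<Sigma> \<sigma> (D a)))"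

end

theory Submission
  imports Defs
begin


text \<open>
  The equation \<open>d\<sigma>\<^sup>i + \<epsilon>\<^sup>i\<^sup>j\<^sup>k a\<^sup>j \<and> \<Sigma>\<^sup>k = 0\<close> has the unique solution \<open>a = d\<^sub>2 \<sigma>\<close> (\<open>d2_iff\<close>), so the
  theorem says: for \<open>a = d\<^sub>2 \<sigma>\<close>, the 2-forms \<open>da\<^sup>i\<close> are of the form \<open>\<psi>\<^sup>i\<^sup>j \<Sigma>\<^sup>j\<close> with \<open>\<psi>\<close> symmetric and
  tracefree if and only if \<open>d\<^sub>2\<^sup>* a = 0\<close>.  This equivalence holds for every section \<open>a\<close> of \<open>E \<otimes> \<Lambda>\<^sup>1\<close>.

  The reason is that the inner product on \<open>E \<otimes> \<Lambda>\<^sup>1\<close> cancels the algebra in \<open>d\<^sub>2\<close>: for \<open>s\<close> in \<open>S\<close> with compact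
  support, \<open>\<epsilon>\<^sup>i\<^sup>j\<^sup>k \<Sigma>\<^sup>i \<and> (d\<^sub>2 s)\<^sup>j \<and> a\<^sup>k = ds\<^sup>k \<and> a\<^sup>k\<close> (\<open>pairing_eps_wedge\<close>), so integration by parts gives
  \<open>\<langle>s, d\<^sub>2\<^sup>* a\<rangle> = \<langle>d\<^sub>2 s, a\<rangle> = - \<integral> s\<^sup>k \<and> da\<^sup>k\<close> (\<open>E1_pairing_by_parts\<close>).  Therefore \<open>d\<^sub>2\<^sup>* a\<close> vanishes if and only if
  \<open>da\<close> is annihilated by \<open>S\<close> under the wedge pairing.  Under \<open>\<Lambda>\<^sup>2 = \<Lambda>\<^sup>+ \<oplus> \<Lambda>\<^sup>-\<close>, with \<open>\<Lambda>\<^sup>+\<close> spanned by the triple, the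
  bundle \<open>E \<otimes> \<Lambda>\<^sup>2\<close> is the sum of \<open>E \<otimes> \<Lambda>\<^sup>-\<close> and the \<open>3 \<times> 3\<close> matrices, and \<open>S\<close> consists of \<open>E \<otimes> \<Lambda>\<^sup>-\<close>, the
  antisymmetric matrices and the multiples of the identity.  Its annihilator is what remains: the
  symmetric tracefree matrices (\<open>S_fibre_annihilates\<close>, \<open>test_pairing_zero\<close>).

  Both directions are tested with sections that the data themselves provide, multiplied by a bump
  function supported in one chart.  If \<open>da = \<psi> \<Sigma>\<close>, the test section is \<open>d\<^sub>2\<^sup>* a\<close>, and the inner product on
  \<open>S\<close> is enters through its positivity.  If
  \<open>d\<^sub>2\<^sup>* a = 0\<close>, the test section is a reflection of the unwanted part of \<open>da\<close>, whose pairing with \<open>da\<close> is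
  a sum of squares.

  The algebra in one fibre is reduced to polynomial identities by a frame \<open>e, I\<^sub>1 e, I\<^sub>2 e, I\<^sub>3 e\<close>, in which the
  metric and the triple have constant components (\<open>quaternionic_frame_exists\<close>).  Independence of the
  chart is reduced to quotients of 4-forms (\<open>alt4_ratio_pull4\<close>), and the volume measure is glued from its
  expressions in charts (\<open>volume_measure_exists\<close>).
\<close>

section \<open>Smooth functions on open sets\<close>

lemma Ck_on_Suc_imp_Ck_on: "Ck_on (Suc n) f U \<Longrightarrow> Ck_on n f U"
proof (induction n arbitrary: f)
  case 0
  then show ?case
    by (auto intro!: continuous_at_imp_continuous_on differentiable_imp_continuous_within)
next
  case (Suc n)
  then show ?case by (metis Ck_on.simps(2))
qed

lemma Ck_on_subset: "Ck_on n f U \<Longrightarrow> V \<subseteq> U \<Longrightarrow> Ck_on n f V"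
  by (induction n arbitrary: f) (auto intro: continuous_on_subset)

text \<open>
  Iterated Frechet derivatives only see germs, so on an open set a function may be replaced by one with
  the same values there; the functions in question are usually junk outside that set.
\<close>

lemma Ck_on_cong:
  assumes "open U" "\<And>x. x \<in> U \<Longrightarrow> f x = g x"
  shows "Ck_on n f U \<Longrightarrow> Ck_on n g U"
  using assms(2)
proof (induction n arbitrary: f g)
  case 0
  then show ?case by (simp cong: continuous_on_cong)
next
  case (Suc n)
  have d: "(g has_derivative frechet_derivative f (at x)) (at x)" if "x \<in> U" for x
  proof -
    have "(f has_derivative frechet_derivative f (at x)) (at x)"
      using Suc.prems that frechet_derivative_works by (metis Ck_on.simps(2))
    then show ?thesis
      by (rule has_derivative_transform_within_open[OF _ assms(1) that]) (use Suc.prems in auto)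
  qed
  have e: "frechet_derivative g (at x) = frechet_derivative f (at x)" if "x \<in> U" for x
    using frechet_derivative_at[OF d[OF that]] by simp
  have "Ck_on n (\<lambda>x. frechet_derivative g (at x) v) U" for v
    by (rule Suc.IH[of "\<lambda>x. frechet_derivative f (at x) v"]) (use Suc.prems e in auto)
  then show ?case using d by (auto simp: differentiable_def)
qed

lemma Ck_on_Un:
  "open A \<Longrightarrow> open B \<Longrightarrow> Ck_on n f A \<Longrightarrow> Ck_on n f B \<Longrightarrow> Ck_on n f (A \<union> B)"
  by (induction n arbitrary: f) (auto intro: continuous_on_open_Un)

lemma Ck_on_const: "Ck_on n (\<lambda>x. c) U"
  by (induction n arbitrary: c) auto

text \<open>
  The induction steps below exhibit a derivative and never mention the choice operator behind
  \<^const>\<open>frechet_derivative\<close>.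
\<close>

lemma Ck_on_SucI:
  assumes "open U" "\<And>x. x \<in> U \<Longrightarrow> (f has_derivative f' x) (at x)"
    and "\<And>v. Ck_on n (\<lambda>x. f' x v) U"
  shows "Ck_on (Suc n) f U"
proof -
  have e: "frechet_derivative f (at x) = f' x" if "x \<in> U" for x
    using frechet_derivative_at[OF assms(2)[OF that]] by simp
  have "Ck_on n (\<lambda>x. frechet_derivative f (at x) v) U" for v
    by (rule Ck_on_cong[OF assms(1) _ assms(3)[of v]]) (simp add: e)
  then show ?thesis using assms(2) by (auto simp: differentiable_def)
qed

lemma Ck_on_has_derivative:
  "Ck_on (Suc n) f U \<Longrightarrow> x \<in> U \<Longrightarrow> (f has_derivative frechet_derivative f (at x)) (at x)"
  using frechet_derivative_works by (metis Ck_on.simps(2))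

lemma Ck_on_frechet: "Ck_on (Suc n) f U \<Longrightarrow> Ck_on n (\<lambda>x. frechet_derivative f (at x) v) U"
  by simp

lemma Ck_on_bounded_linear:
  assumes "bounded_linear L" "open U"
  shows "Ck_on n f U \<Longrightarrow> Ck_on n (\<lambda>x. L (f x)) U"
proof (induction n arbitrary: f)
  case 0
  then show ?case using bounded_linear.continuous_on[OF assms(1)] by simp
next
  case (Suc n)
  show ?case
  proof (rule Ck_on_SucI[OF assms(2)])
    show "((\<lambda>x. L (f x)) has_derivative (\<lambda>v. L (frechet_derivative f (at x) v))) (at x)" if "x \<in> U" for x
      using bounded_linear.has_derivative[OF assms(1) Ck_on_has_derivative[OF Suc.prems that]] .
    show "Ck_on n (\<lambda>x. L (frechet_derivative f (at x) v)) U" for v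
      using Suc by auto
  qed
qed

lemma Ck_on_add:
  assumes "open U"
  shows "Ck_on n f U \<Longrightarrow> Ck_on n g U \<Longrightarrow> Ck_on n (\<lambda>x. f x + g x) U"
proof (induction n arbitrary: f g)
  case 0
  then show ?case by (auto intro: continuous_intros)
next
  case (Suc n)
  show ?case
  proof (rule Ck_on_SucI[OF assms])
    show "((\<lambda>x. f x + g x) has_derivative
       (\<lambda>v. frechet_derivative f (at x) v + frechet_derivative g (at x) v)) (at x)" if "x \<in> U" for x
      using that by (intro has_derivative_add Ck_on_has_derivative[OF Suc.prems(1)]
        Ck_on_has_derivative[OF Suc.prems(2)])
    show "Ck_on n (\<lambda>x. frechet_derivative f (at x) v + frechet_derivative g (at x) v) U" for v
      using Suc by auto
  qed
qed

lemma Ck_on_mult: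
  fixes f g :: "'a::real_normed_vector \<Rightarrow> real"
  assumes "open U"
  shows "Ck_on n f U \<Longrightarrow> Ck_on n g U \<Longrightarrow> Ck_on n (\<lambda>x. f x * g x) U"
proof (induction n arbitrary: f g)
  case 0
  then show ?case by (auto intro: continuous_intros)
next
  case (Suc n)
  show ?case
  proof (rule Ck_on_SucI[OF assms])
    show "((\<lambda>x. f x * g x) has_derivative
       (\<lambda>v. f x * frechet_derivative g (at x) v + frechet_derivative f (at x) v * g x)) (at x)"
      if "x \<in> U" for x
      using that by (intro has_derivative_mult Ck_on_has_derivative[OF Suc.prems(1)]
        Ck_on_has_derivative[OF Suc.prems(2)])
    show "Ck_on n (\<lambda>x. f x * frechet_derivative g (at x) v + frechet_derivative f (at x) v * g x) U" for v
      by (intro Ck_on_add assms Suc.IH Ck_on_frechet Ck_on_Suc_imp_Ck_on[OF Suc.prems(1)]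
        Ck_on_Suc_imp_Ck_on[OF Suc.prems(2)] Suc.prems)
  qed
qed

lemma Ck_on_inverse:
  fixes f :: "'a::real_normed_vector \<Rightarrow> real"
  assumes "open U" "\<And>x. x \<in> U \<Longrightarrow> f x \<noteq> 0"
  shows "Ck_on n f U \<Longrightarrow> Ck_on n (\<lambda>x. inverse (f x)) U"
proof (induction n)
  case 0
  then show ?case using assms by (auto intro!: continuous_intros)
next
  case (Suc n)
  show ?case
  proof (rule Ck_on_SucI[OF assms(1)])
    show "((\<lambda>x. inverse (f x)) has_derivative
       (\<lambda>v. - (inverse (f x) * frechet_derivative f (at x) v * inverse (f x)))) (at x)"
      if "x \<in> U" for x
      using that assms(2) by (intro Deriv.has_derivative_inverse Ck_on_has_derivative[OF Suc.prems(1)])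
    have "Ck_on n (\<lambda>x. (- 1) * (inverse (f x) * frechet_derivative f (at x) v * inverse (f x))) U" for v
      by (intro Ck_on_mult Ck_on_const assms(1) Suc.IH Ck_on_frechet
        Ck_on_Suc_imp_Ck_on[OF Suc.prems] Suc.prems)
    then show "Ck_on n (\<lambda>x. - (inverse (f x) * frechet_derivative f (at x) v * inverse (f x))) U" for v
      by simp
  qed
qed

lemma Ck_on_sum:
  fixes f :: "'i \<Rightarrow> 'a::real_normed_vector \<Rightarrow> real"
  assumes "open U" "\<And>i. i \<in> I \<Longrightarrow> Ck_on n (f i) U"
  shows "Ck_on n (\<lambda>x. \<Sum>i\<in>I. f i x) U"
  using assms(2) by (induction I rule: infinite_finite_induct) (auto intro: Ck_on_const Ck_on_add[OF assms(1)])

lemma Ck_on_prod: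
  fixes f :: "'i \<Rightarrow> 'a::real_normed_vector \<Rightarrow> real"
  assumes "open U" "\<And>i. i \<in> I \<Longrightarrow> Ck_on n (f i) U"
  shows "Ck_on n (\<lambda>x. \<Prod>i\<in>I. f i x) U"
  using assms(2) by (induction I rule: infinite_finite_induct) (auto intro: Ck_on_const Ck_on_mult[OF assms(1)])

lemma linear_sum_Basis:
  fixes L :: "'b::euclidean_space \<Rightarrow> real"
  assumes "linear L"
  shows "L v = (\<Sum>b\<in>Basis. (v \<bullet> b) * L b)"
proof -
  have "L v = L (\<Sum>b\<in>Basis. (v \<bullet> b) *\<^sub>R b)"
    by (simp add: euclidean_representation)
  then show ?thesis using assms by (simp add: linear_sum linear_cmul)
qed

text \<open>
  The induction needs the outer function to be scalar: in
  \<open>f'(T x)(T'(x) v) = \<Sum>\<^sub>b (T'(x) v \<bullet> b) f'(T x) b\<close> the induction hypothesis then applies to each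
  \<open>x \<mapsto> f'(T x) b\<close>, with the same \<open>T\<close>.
\<close>

lemma Ck_on_compose:
  fixes f :: "'b::euclidean_space \<Rightarrow> real" and T :: "'a::real_normed_vector \<Rightarrow> 'b"
  assumes "open U" "open V" "T ` U \<subseteq> V"
  shows "Ck_on n f V \<Longrightarrow> Ck_on n T U \<Longrightarrow> Ck_on n (\<lambda>x. f (T x)) U"
proof (induction n arbitrary: f)
  case 0
  then show ?case using assms continuous_on_compose2 by fastforce
next
  case (Suc n)
  let ?f' = "\<lambda>x. frechet_derivative f (at x)" and ?T' = "\<lambda>x. frechet_derivative T (at x)"
  show ?case
  proof (rule Ck_on_SucI[OF assms(1)])
    fix x assume x: "x \<in> U"
    have f: "(f has_derivative ?f' (T x)) (at (T x))"
      using Suc.prems(1) x assms(3) by (intro Ck_on_has_derivative) auto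
    have T: "(T has_derivative ?T' x) (at x)"
      using Suc.prems(2) x by (intro Ck_on_has_derivative)
    have "linear (?f' (T x))" using f has_derivative_linear by blast
    then have *: "?f' (T x) (?T' x v) = (\<Sum>b\<in>Basis. (?T' x v \<bullet> b) * ?f' (T x) b)" for v
      by (rule linear_sum_Basis)
    show "((\<lambda>x. f (T x)) has_derivative (\<lambda>v. \<Sum>b\<in>Basis. (?T' x v \<bullet> b) * ?f' (T x) b)) (at x)"
      using has_derivative_compose[OF T f] unfolding * .
  next
    fix v
    show "Ck_on n (\<lambda>x. \<Sum>b\<in>Basis. (?T' x v \<bullet> b) * ?f' (T x) b) U"
    proof (intro Ck_on_sum Ck_on_mult assms(1))
      show "Ck_on n (\<lambda>x. ?T' x v \<bullet> b) U" for b
        using Suc.prems(2) by (intro Ck_on_bounded_linear[OF bounded_linear_inner_left assms(1)]) simp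
      show "Ck_on n (\<lambda>x. ?f' (T x) b) U" for b
        by (rule Suc.IH[of "\<lambda>y. ?f' y b", OF Ck_on_frechet[OF Suc.prems(1)]
              Ck_on_Suc_imp_Ck_on[OF Suc.prems(2)]])
    qed
  qed
qed

lemma smooth_on_frechet: "smooth_on f U \<Longrightarrow> smooth_on (\<lambda>x. frechet_derivative f (at x) v) U"
  unfolding smooth_on_def by (metis Ck_on.simps(2))

lemma smooth_on_differentiable: "smooth_on f U \<Longrightarrow> x \<in> U \<Longrightarrow> f differentiable (at x)"
  unfolding smooth_on_def by (metis Ck_on.simps(2))

lemma smooth_on_has_derivative:
  "smooth_on f U \<Longrightarrow> x \<in> U \<Longrightarrow> (f has_derivative frechet_derivative f (at x)) (at x)"
  using smooth_on_differentiable frechet_derivative_works by blast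

lemma smooth_on_continuous_on: "smooth_on f U \<Longrightarrow> continuous_on U f"
  unfolding smooth_on_def by (metis Ck_on.simps(1))

lemma smooth_on_cong:
  "open U \<Longrightarrow> (\<And>x. x \<in> U \<Longrightarrow> f x = g x) \<Longrightarrow> smooth_on f U \<Longrightarrow> smooth_on g U"
  unfolding smooth_on_def using Ck_on_cong by metis

lemma smooth_on_Un: "open A \<Longrightarrow> open B \<Longrightarrow> smooth_on f A \<Longrightarrow> smooth_on f B \<Longrightarrow> smooth_on f (A \<union> B)"
  unfolding smooth_on_def by (blast intro: Ck_on_Un)

lemma smooth_on_compose:
  fixes f :: "'b::euclidean_space \<Rightarrow> real" and T :: "'a::real_normed_vector \<Rightarrow> 'b"
  shows "open U \<Longrightarrow> open V \<Longrightarrow> T ` U \<subseteq> V \<Longrightarrow> smooth_on f V \<Longrightarrow> smooth_on T U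
    \<Longrightarrow> smooth_on (\<lambda>x. f (T x)) U"
  unfolding smooth_on_def using Ck_on_compose by metis

lemma smooth_on_vec_nth:
  fixes T :: "'a::real_normed_vector \<Rightarrow> real^'n"
  shows "open U \<Longrightarrow> smooth_on T U \<Longrightarrow> smooth_on (\<lambda>x. T x $ i) U"
  unfolding smooth_on_def using Ck_on_bounded_linear[OF bounded_linear_vec_nth] by metis

lemma
  fixes f g :: "'a::real_normed_vector \<Rightarrow> real"
  assumes U: "open U"
  shows smooth_on_const: "smooth_on (\<lambda>x. c::real) U"
    and smooth_on_add: "smooth_on f U \<Longrightarrow> smooth_on g U \<Longrightarrow> smooth_on (\<lambda>x. f x + g x) U"
    and smooth_on_mult: "smooth_on f U \<Longrightarrow> smooth_on g U \<Longrightarrow> smooth_on (\<lambda>x. f x * g x) U"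
    and smooth_on_minus: "smooth_on f U \<Longrightarrow> smooth_on (\<lambda>x. - f x) U"
    and smooth_on_diff: "smooth_on f U \<Longrightarrow> smooth_on g U \<Longrightarrow> smooth_on (\<lambda>x. f x - g x) U"
    and smooth_on_divide: "smooth_on f U \<Longrightarrow> smooth_on g U \<Longrightarrow> (\<And>x. x \<in> U \<Longrightarrow> g x \<noteq> 0)
      \<Longrightarrow> smooth_on (\<lambda>x. f x / g x) U"
proof -
  show c: "smooth_on (\<lambda>x. c::real) U" for c
    unfolding smooth_on_def by (simp add: Ck_on_const)
  show a: "smooth_on f U \<Longrightarrow> smooth_on g U \<Longrightarrow> smooth_on (\<lambda>x. f x + g x) U" for f g :: "'a \<Rightarrow> real"
    unfolding smooth_on_def using Ck_on_add[OF U] by blast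
  show m: "smooth_on f U \<Longrightarrow> smooth_on g U \<Longrightarrow> smooth_on (\<lambda>x. f x * g x) U" for f g :: "'a \<Rightarrow> real"
    unfolding smooth_on_def using Ck_on_mult[OF U] by blast
  show n: "smooth_on f U \<Longrightarrow> smooth_on (\<lambda>x. - f x) U" for f :: "'a \<Rightarrow> real"
    using m[OF c[of "-1"], of f] by simp
  show "smooth_on f U \<Longrightarrow> smooth_on g U \<Longrightarrow> smooth_on (\<lambda>x. f x - g x) U"
    using a[OF _ n, of f g] by simp
  show "smooth_on f U \<Longrightarrow> smooth_on g U \<Longrightarrow> (\<And>x. x \<in> U \<Longrightarrow> g x \<noteq> 0) \<Longrightarrow> smooth_on (\<lambda>x. f x / g x) U"
    using m[of f "\<lambda>x. inverse (g x)"] Ck_on_inverse[OF U, of g] unfolding smooth_on_def divide_inverse by blast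
qed

lemma smooth_on_sum:
  fixes f :: "'i \<Rightarrow> 'a::real_normed_vector \<Rightarrow> real"
  shows "open U \<Longrightarrow> (\<And>i. i \<in> I \<Longrightarrow> smooth_on (f i) U) \<Longrightarrow> smooth_on (\<lambda>x. \<Sum>i\<in>I. f i x) U"
  unfolding smooth_on_def by (simp add: Ck_on_sum)

lemma smooth_on_prod:
  fixes f :: "'i \<Rightarrow> 'a::real_normed_vector \<Rightarrow> real"
  shows "open U \<Longrightarrow> (\<And>i. i \<in> I \<Longrightarrow> smooth_on (f i) U) \<Longrightarrow> smooth_on (\<lambda>x. \<Prod>i\<in>I. f i x) U"
  unfolding smooth_on_def by (simp add: Ck_on_prod)


section \<open>Mixed partial derivatives commute\<close>

lemma Ck_on_line_derivative:
  assumes "Ck_on (Suc n) f U" "p + s *\<^sub>R v \<in> U"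
  shows "((\<lambda>s. f (p + s *\<^sub>R v)) has_real_derivative frechet_derivative f (at (p + s *\<^sub>R v)) v) (at s)"
proof -
  have f: "(f has_derivative frechet_derivative f (at (p + s *\<^sub>R v))) (at (p + s *\<^sub>R v))"
    by (rule Ck_on_has_derivative[OF assms])
  have "((\<lambda>s. p + s *\<^sub>R v) has_derivative (\<lambda>t. t *\<^sub>R v)) (at s)"
    by (auto intro!: derivative_eq_intros)
  from has_derivative_compose[OF this f]
  have "((\<lambda>s. f (p + s *\<^sub>R v)) has_derivative (\<lambda>t. frechet_derivative f (at (p + s *\<^sub>R v)) (t *\<^sub>R v))) (at s)" .
  moreover have "linear (frechet_derivative f (at (p + s *\<^sub>R v)))"
    using f has_derivative_linear by blast
  ultimately show ?thesis
    unfolding has_field_derivative_def by (simp add: linear_cmul mult.commute[of _ "frechet_derivative f _ v"])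
qed

text \<open>
  The mean value theorem applied first along \<open>v\<close> and then along \<open>w\<close>.  The left-hand side is symmetric
  in \<open>v\<close> and \<open>w\<close>, which is how the order of differentiation becomes irrelevant in the limit.
\<close>

lemma second_difference_mean_value:
  assumes f: "Ck_on 2 f (ball x \<delta>)" and h: "0 < h" "h * (norm v + norm w) < \<delta>"
  shows "\<exists>y. dist x y \<le> h * (norm v + norm w) \<and>
    f (x + h *\<^sub>R v + h *\<^sub>R w) - f (x + h *\<^sub>R v) - f (x + h *\<^sub>R w) + f x
      = h^2 * frechet_derivative (\<lambda>y. frechet_derivative f (at y) v) (at y) w"
proof -
  have inb: "x + s *\<^sub>R v + t *\<^sub>R w \<in> ball x \<delta> \<and> dist x (x + s *\<^sub>R v + t *\<^sub>R w) \<le> h * (norm v + norm w)"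
    if "0 \<le> s" "s \<le> h" "0 \<le> t" "t \<le> h" for s t
  proof -
    have "x - (x + s *\<^sub>R v + t *\<^sub>R w) = - (s *\<^sub>R v + t *\<^sub>R w)" by simp
    then have "dist x (x + s *\<^sub>R v + t *\<^sub>R w) = norm (s *\<^sub>R v + t *\<^sub>R w)"
      by (simp only: dist_norm norm_minus_cancel)
    also have "\<dots> \<le> norm (s *\<^sub>R v) + norm (t *\<^sub>R w)" by (rule norm_triangle_ineq)
    also have "\<dots> \<le> h * norm v + h * norm w"
      using that by (auto intro!: add_mono mult_right_mono)
    finally show ?thesis using h by (simp add: distrib_left)
  qed
  have f1: "Ck_on (Suc 1) f (ball x \<delta>)" using f by (simp add: numeral_2_eq_2)
  let ?d = "\<lambda>y. frechet_derivative f (at y) v"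
  have d1: "Ck_on (Suc 0) ?d (ball x \<delta>)" using Ck_on_frechet[OF f1] by simp
  let ?u = "\<lambda>s. f ((x + h *\<^sub>R w) + s *\<^sub>R v) - f (x + s *\<^sub>R v)"
  have "\<exists>z>0. z < h \<and> ?u h - ?u 0 = (h - 0) * (?d ((x + h *\<^sub>R w) + z *\<^sub>R v) - ?d (x + z *\<^sub>R v))"
  proof (rule MVT2)
    fix s assume s: "0 \<le> s" "s \<le> h"
    show "(?u has_real_derivative (?d ((x + h *\<^sub>R w) + s *\<^sub>R v) - ?d (x + s *\<^sub>R v))) (at s)"
      using inb[OF s, of h] inb[OF s, of 0] h
      by (intro DERIV_diff Ck_on_line_derivative[OF f1]) (auto simp: algebra_simps)
  qed fact
  then obtain z where z: "0 < z" "z < h"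
    and 1: "?u h - ?u 0 = h * (?d ((x + h *\<^sub>R w) + z *\<^sub>R v) - ?d (x + z *\<^sub>R v))" by auto
  let ?g = "\<lambda>t. ?d ((x + z *\<^sub>R v) + t *\<^sub>R w)"
  have "\<exists>t>0. t < h \<and> ?g h - ?g 0 = (h - 0) * frechet_derivative ?d (at ((x + z *\<^sub>R v) + t *\<^sub>R w)) w"
    using inb[of z] z h by (intro MVT2 Ck_on_line_derivative[OF d1]) auto
  then obtain t where t: "0 < t" "t < h"
    and 2: "?g h - ?g 0 = h * frechet_derivative ?d (at ((x + z *\<^sub>R v) + t *\<^sub>R w)) w" by auto
  have "?u h - ?u 0 = h^2 * frechet_derivative ?d (at ((x + z *\<^sub>R v) + t *\<^sub>R w)) w"
    using 1 2 by (simp add: algebra_simps power2_eq_square)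
  then show ?thesis
    using inb[of z t] z t by (intro exI[of _ "(x + z *\<^sub>R v) + t *\<^sub>R w"]) (auto simp: algebra_simps)
qed

theorem frechet_derivative_commute:
  fixes f :: "'a::real_normed_vector \<Rightarrow> real"
  assumes f: "Ck_on 2 f U" and U: "open U" "x \<in> U"
  shows "frechet_derivative (\<lambda>y. frechet_derivative f (at y) v) (at x) w
       = frechet_derivative (\<lambda>y. frechet_derivative f (at y) w) (at x) v"
proof -
  let ?A = "\<lambda>v w y. frechet_derivative (\<lambda>y. frechet_derivative f (at y) v) (at y) w"
  obtain \<delta> where d: "\<delta> > 0" "ball x \<delta> \<subseteq> U" using U open_contains_ball by blast
  have fb: "Ck_on 2 f (ball x \<delta>)" using Ck_on_subset[OF f d(2)] .
  have "continuous_on U (?A v w)" for v w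
    using f by (simp add: numeral_2_eq_2)
  then have cont: "isCont (?A v w) x" for v w
    using U continuous_on_eq_continuous_at by blast
  have "\<bar>?A v w x - ?A w v x\<bar> \<le> \<epsilon>" if "\<epsilon> > 0" for \<epsilon>
  proof -
    obtain d1 where d1: "d1 > 0" "\<And>y. dist y x < d1 \<Longrightarrow> \<bar>?A v w y - ?A v w x\<bar> < \<epsilon>/2"
      using cont[of v w] \<open>\<epsilon> > 0\<close> unfolding continuous_at_eps_delta dist_real_def by (meson half_gt_zero)
    obtain d2 where d2: "d2 > 0" "\<And>y. dist y x < d2 \<Longrightarrow> \<bar>?A w v y - ?A w v x\<bar> < \<epsilon>/2"
      using cont[of w v] \<open>\<epsilon> > 0\<close> unfolding continuous_at_eps_delta dist_real_def by (meson half_gt_zero)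
    define m where "m = min \<delta> (min d1 d2)"
    have m: "m > 0" "m \<le> \<delta>" "m \<le> d1" "m \<le> d2" using d d1 d2 by (auto simp: m_def)
    define h where "h = m / (norm v + norm w + 1)"
    have nn: "norm v + norm w + 1 > 0" using norm_ge_zero[of v] norm_ge_zero[of w] by linarith
    have "h > 0" using m nn by (auto simp: h_def)
    moreover have "h * (norm v + norm w) < m"
      using m nn by (simp add: h_def field_simps)
    ultimately have h: "h > 0" "h * (norm v + norm w) < m" "h * (norm w + norm v) < m"
      by (auto simp: add.commute)
    obtain y where y: "dist x y \<le> h * (norm v + norm w)"
      "f (x + h *\<^sub>R v + h *\<^sub>R w) - f (x + h *\<^sub>R v) - f (x + h *\<^sub>R w) + f x = h^2 * ?A v w y"
      using second_difference_mean_value[OF fb h(1), of v w] h m by fastforce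
    obtain z where z: "dist x z \<le> h * (norm w + norm v)"
      "f (x + h *\<^sub>R w + h *\<^sub>R v) - f (x + h *\<^sub>R w) - f (x + h *\<^sub>R v) + f x = h^2 * ?A w v z"
      using second_difference_mean_value[OF fb h(1), of w v] h m by fastforce
    have "h^2 * ?A v w y = h^2 * ?A w v z" using y z by (simp add: algebra_simps)
    then have "?A v w y = ?A w v z" using h by simp
    moreover have "\<bar>?A v w y - ?A v w x\<bar> < \<epsilon>/2" using y h m by (intro d1) (simp add: dist_commute)
    moreover have "\<bar>?A w v z - ?A w v x\<bar> < \<epsilon>/2" using z h m by (intro d2) (simp add: dist_commute)
    ultimately show ?thesis by linarith
  qed
  then have "\<bar>?A v w x - ?A w v x\<bar> \<le> 0" by (meson field_le_epsilon dense_ge)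
  then show ?thesis by simp
qed

section \<open>A smooth bump function\<close>

text \<open>
  The functions \<open>t\<^sup>-\<^sup>k exp (-1/t)\<close>, extended by zero to \<open>t \<le> 0\<close>.  Their span is closed under
  differentiation, so all derivatives of \<open>exp (-1/t)\<close> are treated at once.
\<close>

definition flat :: "nat \<Rightarrow> real \<Rightarrow> real" where
  "flat k t = (if t > 0 then (1/t)^k * exp (-(1/t)) else 0)"

lemma flat_tendsto_0: "(flat k \<longlongrightarrow> 0) (at 0)"
proof -
  have "((\<lambda>t. t^k / exp t) \<longlongrightarrow> (0::real)) at_top" by (rule tendsto_power_div_exp_0)
  then have "((\<lambda>t. (inverse t)^k / exp (inverse t)) \<longlongrightarrow> (0::real)) (at_right 0)"
    by (rule filterlim_compose[OF _ filterlim_inverse_at_top_right])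
  then have r: "(flat k \<longlongrightarrow> 0) (at_right 0)"
    by (rule Lim_transform_eventually)
       (auto simp: flat_def eventually_at_filter exp_minus field_simps)
  have "((\<lambda>t. 0) \<longlongrightarrow> (0::real)) (at_left 0)" by simp
  then have l: "(flat k \<longlongrightarrow> 0) (at_left 0)"
    by (rule Lim_transform_eventually) (auto simp: flat_def eventually_at_filter)
  show ?thesis using l r filterlim_split_at by blast
qed

lemma flat_has_derivative:
  "(flat k has_real_derivative (flat (k + 2) t - k * flat (k + 1) t)) (at t)"
proof -
  consider "t > 0" | "t < 0" | "t = 0" by linarith
  then show ?thesis
  proof cases
    case 1
    have d: "((\<lambda>t. 1/t) has_real_derivative - ((1/t)^2)) (at t)"
      using 1 by (auto intro!: derivative_eq_intros simp: power2_eq_square)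
    have "((\<lambda>t. (1/t)^k * exp (-(1/t))) has_real_derivative
        (real k * (- ((1/t)^2) * (1/t)^(k - Suc 0))) * exp (-(1/t)) + exp (-(1/t)) * - (- ((1/t)^2)) * (1/t)^k) (at t)"
      by (rule DERIV_mult[OF DERIV_power[OF d] DERIV_chain2[OF DERIV_exp DERIV_minus[OF d]]])
    also have "(real k * (- ((1/t)^2) * (1/t)^(k - Suc 0))) * exp (-(1/t)) + exp (-(1/t)) * - (- ((1/t)^2)) * (1/t)^k
        = flat (k + 2) t - k * flat (k + 1) t"
      using 1 by (cases k) (simp_all add: flat_def power2_eq_square algebra_simps)
    finally have "((\<lambda>t. (1/t)^k * exp (-(1/t))) has_real_derivative (flat (k + 2) t - k * flat (k + 1) t)) (at t)" .
    then show ?thesis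
      by (rule has_field_derivative_transform_within_open[where S = "{0<..}"]) (use 1 in \<open>auto simp: flat_def\<close>)
  next
    case 2
    have "((\<lambda>t. 0) has_real_derivative 0) (at t)" by simp
    then have "(flat k has_real_derivative 0) (at t)"
      by (rule has_field_derivative_transform_within_open[where S = "{..<0}"]) (use 2 in \<open>auto simp: flat_def\<close>)
    then show ?thesis using 2 by (simp add: flat_def)
  next
    case 3
    \<comment> \<open>The difference quotient of the \<open>k\<close>-th function at 0 is the next function of the family.\<close>
    have "((\<lambda>h. (flat k (0 + h) - flat k 0) / h) \<longlongrightarrow> 0) (at 0)"
      by (rule Lim_transform_eventually[OF flat_tendsto_0[of "Suc k"]])
         (auto simp: flat_def eventually_at_filter field_simps)
    then show ?thesis using 3 by (simp add: DERIV_def flat_def)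
  qed
qed

lemma Ck_on_flat: "Ck_on n (flat k) UNIV"
proof (induction n arbitrary: k)
  case 0
  have "isCont (flat k) t" for t
    using flat_has_derivative DERIV_isCont by blast
  then show ?case by (simp add: continuous_at_imp_continuous_on)
next
  case (Suc n)
  show ?case
  proof (rule Ck_on_SucI)
    show "(flat k has_derivative (\<lambda>v. (flat (k + 2) t + (- real k) * flat (k + 1) t) * v)) (at t)" for t
      using flat_has_derivative[of k t] unfolding has_field_derivative_def by simp
    show "Ck_on n (\<lambda>t. (flat (k + 2) t + (- real k) * flat (k + 1) t) * v) UNIV" for v
      by (intro Ck_on_mult Ck_on_add Ck_on_const Suc open_UNIV)
  qed simp
qed

lemma smooth_bump_exists:
  fixes x0 :: "'a::euclidean_space"
  assumes "r > 0"
  shows "\<exists>b. smooth_on b UNIV \<and> (\<forall>x. b x \<ge> 0) \<and> (\<forall>x. b x \<noteq> (0::real) \<longleftrightarrow> x \<in> ball x0 r)"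
proof -
  let ?q = "\<lambda>x. r^2 + (- 1) * (\<Sum>i\<in>Basis. ((x - x0) \<bullet> i) * ((x - x0) \<bullet> i))"
  let ?b = "\<lambda>x. flat 0 (?q x)"
  have id: "Ck_on n (\<lambda>x. x) UNIV" for n :: nat
  proof (cases n)
    case (Suc m)
    show ?thesis unfolding Suc
      by (rule Ck_on_SucI[where f' = "\<lambda>x v. v"]) (auto intro: Ck_on_const)
  qed auto
  have l: "Ck_on n (\<lambda>x. (x - x0) \<bullet> i) UNIV" for n i
    using Ck_on_add[OF open_UNIV Ck_on_bounded_linear[OF bounded_linear_inner_left open_UNIV id]
        Ck_on_const, of n i "- (x0 \<bullet> i)"]
    by (simp add: inner_diff_left)
  have q: "Ck_on n ?q UNIV" for n
    by (intro Ck_on_mult Ck_on_add Ck_on_sum Ck_on_const l open_UNIV)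
  have "smooth_on ?b UNIV"
    unfolding smooth_on_def using Ck_on_compose[OF open_UNIV open_UNIV _ Ck_on_flat q] by auto
  moreover have "?b x \<ge> 0" for x by (simp add: flat_def)
  moreover have "?b x \<noteq> 0 \<longleftrightarrow> x \<in> ball x0 r" for x
  proof -
    have "(\<Sum>i\<in>Basis. ((x - x0) \<bullet> i) * ((x - x0) \<bullet> i)) = (dist x0 x)^2"
      unfolding dist_norm norm_minus_commute[of x0 x] power2_norm_eq_inner euclidean_inner[of "x - x0" "x - x0"] ..
    then have "?q x > 0 \<longleftrightarrow> dist x0 x < r"
      using \<open>r > 0\<close> power_strict_mono[of "dist x0 x" r 2] power2_less_imp_less[of "dist x0 x" r] by auto
    then show ?thesis by (simp add: flat_def)
  qed
  ultimately show ?thesis by blast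
qed

section \<open>Integrals of compactly supported functions\<close>

lemma integrable_compact_support:
  fixes f :: "'a::euclidean_space \<Rightarrow> real"
  assumes "continuous_on UNIV f" "compact K" "\<And>x. x \<notin> K \<Longrightarrow> f x = 0"
  shows "integrable lborel f"
proof -
  have "integrable lborel (\<lambda>x. indicator K x *\<^sub>R f x)"
    using assms by (intro borel_integrable_compact) (auto intro: continuous_on_subset)
  also have "(\<lambda>x. indicator K x *\<^sub>R f x) = f" using assms(3) by (fastforce simp: indicator_def)
  finally show ?thesis .
qed

text \<open>
  The difference quotients in direction \<open>e\<close> integrate to 0 because Lebesgue measure is translation
  invariant, and they converge to the derivative, dominated by its supremum on a fixed ball.
\<close>

lemma integral_derivative_compact_support:
  fixes f :: "'a::euclidean_space \<Rightarrow> real"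
  assumes f: "Ck_on 1 f UNIV" and K: "compact K" "\<And>x. x \<notin> K \<Longrightarrow> f x = 0"
  shows "integrable lborel (\<lambda>x. frechet_derivative f (at x) e)"
    and "(LINT x|lborel. frechet_derivative f (at x) e) = 0"
proof -
  let ?d = "\<lambda>x. frechet_derivative f (at x) e"
  have f1: "Ck_on (Suc 0) f UNIV" using f by (simp only: One_nat_def)
  have cd: "continuous_on UNIV ?d" using f by simp
  have cf: "continuous_on UNIV f" using Ck_on_Suc_imp_Ck_on[of 0 f UNIV] f by simp
  have d0: "?d x = 0" if "x \<notin> K" for x
  proof -
    have "((\<lambda>x. 0) has_derivative (\<lambda>v. 0)) (at x)" by simp
    then have "(f has_derivative (\<lambda>v. 0)) (at x)"
      by (rule has_derivative_transform_within_open[where s = "- K"]) (use K that in \<open>auto simp: compact_imp_closed open_Compl\<close>)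
    from frechet_derivative_at[OF this, symmetric] show ?thesis by simp
  qed
  show id: "integrable lborel ?d" by (rule integrable_compact_support[OF cd K(1) d0])
  have "bounded (?d ` K)"
    using cd K(1) by (intro compact_imp_bounded compact_continuous_image) (auto intro: continuous_on_subset)
  then obtain B0 where "\<forall>x\<in>K. \<bar>?d x\<bar> \<le> B0" by (auto simp: bounded_iff)
  then have B: "\<bar>?d x\<bar> \<le> max B0 0" for x
    using d0[of x] by (cases "x \<in> K") (auto simp: le_max_iff_disj)
  let ?B = "max B0 0"
  obtain R where R: "\<And>x. x \<in> K \<Longrightarrow> norm x \<le> R" using compact_imp_bounded[OF K(1)] by (auto simp: bounded_iff)
  \<comment> \<open>All difference quotients with step at most 1 vanish outside this ball.\<close>
  let ?L = "cball (0::'a) (R + norm e)"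
  define t where "t n = inverse (real (Suc n))" for n
  have t: "t n > 0" "t n \<le> 1" for n by (auto simp: t_def field_simps)
  define q where "q n x = (f (x + t n *\<^sub>R e) - f x) / t n" for n x
  have qz: "\<exists>z. 0 < z \<and> z < t n \<and> q n x = ?d (x + z *\<^sub>R e)" for n x
  proof -
    have "\<exists>z>0. z < t n \<and> f (x + t n *\<^sub>R e) - f (x + 0 *\<^sub>R e) = (t n - 0) * ?d (x + z *\<^sub>R e)"
      by (rule MVT2[OF t(1)]) (rule Ck_on_line_derivative[OF f1 UNIV_I])
    then show ?thesis using t(1)[of n] by (auto simp: q_def)
  qed
  have qb: "norm (q n x) \<le> indicator ?L x *\<^sub>R ?B" for n x
  proof -
    obtain z where z: "0 < z" "z < t n" "q n x = ?d (x + z *\<^sub>R e)" using qz by blast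
    show ?thesis
    proof (cases "x \<in> ?L")
      case True then show ?thesis using B z by simp
    next
      case False
      have "norm x \<le> norm (x + z *\<^sub>R e) + norm (z *\<^sub>R e)" using norm_triangle_ineq4[of "x + z *\<^sub>R e" "z *\<^sub>R e"] by simp
      moreover have "norm (z *\<^sub>R e) \<le> norm e"
        using z t(2)[of n] by (auto intro!: mult_left_le_one_le)
      ultimately have "x + z *\<^sub>R e \<notin> K" using R[of "x + z *\<^sub>R e"] False by auto
      then show ?thesis using d0 z False by simp
    qed
  qed
  have qlim: "(\<lambda>n. q n x) \<longlonglongrightarrow> ?d x" for x
  proof -
    have "((\<lambda>s. f (x + s *\<^sub>R e)) has_real_derivative ?d x) (at 0)"
      using Ck_on_line_derivative[where p = x and s = 0 and v = e, OF f1 UNIV_I] by simp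
    then have "((\<lambda>h. (f (x + h *\<^sub>R e) - f x) / h) \<longlongrightarrow> ?d x) (at 0)" by (simp add: DERIV_def)
    moreover have "filterlim t (at 0) sequentially"
      unfolding filterlim_at using t(1) LIMSEQ_inverse_real_of_nat[folded t_def]
      by (auto simp: less_imp_neq[symmetric])
    ultimately show ?thesis unfolding q_def by (rule filterlim_compose)
  qed
  have mf: "f \<in> borel_measurable borel" using cf borel_measurable_continuous_onI by blast
  have intf: "integrable lborel f" by (rule integrable_compact_support[OF cf K])
  have shift: "integrable lborel (\<lambda>x. f (x + c))" "(LINT x|lborel. f (x + c)) = (LINT x|lborel. f x)" for c
  proof -
    have "integrable (distr lborel borel ((+) c)) f" using intf by (simp add: lborel_distr_plus)
    then show "integrable lborel (\<lambda>x. f (x + c))"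
      using mf by (subst (asm) integrable_distr_eq) (auto simp: add.commute)
    have "(LINT x|distr lborel borel ((+) c). f x) = (LINT x|lborel. f (c + x))"
      using mf by (subst integral_distr) auto
    then show "(LINT x|lborel. f (x + c)) = (LINT x|lborel. f x)" by (simp add: lborel_distr_plus add.commute)
  qed
  have int0: "(LINT x|lborel. q n x) = 0" for n
    unfolding q_def using shift intf by simp
  have "(\<lambda>n. LINT x|lborel. q n x) \<longlonglongrightarrow> (LINT x|lborel. ?d x)"
  proof (rule integral_dominated_convergence)
    show "?d \<in> borel_measurable lborel" using id by auto
    show "q n \<in> borel_measurable lborel" for n
      unfolding q_def using mf shift(1) by (intro borel_measurable_divide borel_measurable_diff) auto
    show "integrable lborel (\<lambda>x. indicator ?L x *\<^sub>R ?B)"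
      by (intro borel_integrable_compact) auto
  qed (use qb qlim in auto)
  then have "(\<lambda>n. 0) \<longlonglongrightarrow> (LINT x|lborel. ?d x)" unfolding int0 .
  then show "(LINT x|lborel. ?d x) = 0" by (simp add: LIMSEQ_const_iff)
qed

lemma
  fixes f :: "'a::euclidean_space \<Rightarrow> real"
  assumes U: "open U" and f: "smooth_on f U" and K: "compact K" "K \<subseteq> U" "\<And>x. x \<in> U - K \<Longrightarrow> f x = 0"
  shows integrable_derivative_supported_in_open: "integrable lborel (\<lambda>x. indicator U x * frechet_derivative f (at x) e)"
    and integral_derivative_supported_in_open: "(LINT x|lborel. indicator U x * frechet_derivative f (at x) e) = 0"
proof -
  let ?f = "\<lambda>x. if x \<in> U then f x else 0"
  have K': "open (- K)" using K(1) by (simp add: compact_imp_closed open_Compl)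
  have "Ck_on 1 ?f (U \<union> - K)"
  proof (rule Ck_on_Un[OF U K'])
    show "Ck_on 1 ?f U"
      by (rule Ck_on_cong[OF U _ f[unfolded smooth_on_def, rule_format]]) simp
    show "Ck_on 1 ?f (- K)"
      by (rule Ck_on_cong[OF K' _ Ck_on_const[of 1 0]]) (use K(3) in auto)
  qed
  moreover have "U \<union> - K = UNIV" using K by auto
  ultimately have c: "Ck_on 1 ?f UNIV" by simp
  have e: "(\<lambda>x. frechet_derivative ?f (at x) e) = (\<lambda>x. indicator U x * frechet_derivative f (at x) e)"
  proof
    fix x
    show "frechet_derivative ?f (at x) e = indicator U x * frechet_derivative f (at x) e"
    proof (cases "x \<in> U")
      case True
      then have "(f has_derivative frechet_derivative f (at x)) (at x)"
        using f smooth_on_has_derivative by blast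
      then have "(?f has_derivative frechet_derivative f (at x)) (at x)"
        by (rule has_derivative_transform_within_open[OF _ U True]) simp
      from fun_cong[OF frechet_derivative_at[OF this], of e]
      have "frechet_derivative ?f (at x) e = frechet_derivative f (at x) e" by (rule sym)
      with True show ?thesis by simp
    next
      case False
      have "((\<lambda>x. 0) has_derivative (\<lambda>v. 0)) (at x)" by simp
      then have "(?f has_derivative (\<lambda>v. 0)) (at x)"
        by (rule has_derivative_transform_within_open[OF _ K']) (use False K in auto)
      from fun_cong[OF frechet_derivative_at[OF this], of e]
      have "frechet_derivative ?f (at x) e = 0" by (rule sym)
      with False show ?thesis by simp
    qed
  qed
  have z: "?f x = 0" if "x \<notin> K" for x using that K by auto
  show "integrable lborel (\<lambda>x. indicator U x * frechet_derivative f (at x) e)"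
    using integral_derivative_compact_support(1)[OF c K(1) z, of e] unfolding e .
  show "(LINT x|lborel. indicator U x * frechet_derivative f (at x) e) = 0"
    using integral_derivative_compact_support(2)[OF c K(1) z, of e] unfolding e .
qed

lemma continuous_extension_by_zero:
  fixes h :: "'a::euclidean_space \<Rightarrow> real"
  assumes U: "open U" and h: "continuous_on U h" and K: "compact K" "K \<subseteq> U" "\<And>x. x \<in> U - K \<Longrightarrow> h x = 0"
  shows "continuous_on UNIV (\<lambda>x. indicator U x * h x)" "integrable lborel (\<lambda>x. indicator U x * h x)"
proof -
  have K': "open (- K)" using K(1) by (simp add: compact_imp_closed open_Compl)
  have "continuous_on (U \<union> - K) (\<lambda>x. indicator U x * h x)"
  proof (rule continuous_on_open_Un[OF U K'])
    show "continuous_on U (\<lambda>x. indicator U x * h x)" using h by (rule continuous_on_eq) simp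
    show "continuous_on (- K) (\<lambda>x. indicator U x * h x)"
      by (rule continuous_on_eq[of _ "\<lambda>x. 0"]) (use K in \<open>auto simp: indicator_def\<close>)
  qed
  moreover have "U \<union> - K = UNIV" using K by auto
  ultimately show c: "continuous_on UNIV (\<lambda>x. indicator U x * h x)" by simp
  show "integrable lborel (\<lambda>x. indicator U x * h x)"
    by (rule integrable_compact_support[OF c K(1)]) (use K in \<open>auto simp: indicator_def\<close>)
qed

text \<open>
  The set where a continuous function does not vanish is open, and a nonempty open set is not negligible.
\<close>

lemma nonneg_integral_zero_imp_zero:
  fixes h :: "'a::euclidean_space \<Rightarrow> real"
  assumes U: "open U" and h: "continuous_on U h" and K: "compact K" "K \<subseteq> U" "\<And>x. x \<in> U - K \<Longrightarrow> h x = 0"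
    and nonneg: "\<And>x. x \<in> U \<Longrightarrow> h x \<ge> 0"
    and int0: "(LINT x|lborel. indicator U x * h x) = 0"
    and x: "x \<in> U"
  shows "h x = 0"
proof -
  let ?h = "\<lambda>x. indicator U x * h x"
  note c = continuous_extension_by_zero[OF U h K]
  have "AE x in lborel. ?h x = 0"
    using integral_nonneg_eq_0_iff_AE[OF c(2)] nonneg int0 by (auto simp: indicator_def)
  then have "AE x in lebesgue. ?h x = 0" by (rule AE_completion)
  then have "negligible {x. ?h x \<noteq> 0}"
    by (simp add: negligible_iff_null_sets AE_iff_null_sets completion.AE_iff_null_sets)
  moreover have "open {x. ?h x \<noteq> 0}"
    using c(1) by (intro open_Collect_neq continuous_on_const)
  ultimately have "{x. ?h x \<noteq> 0} = {}" using open_not_negligible by blast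
  then have "?h x = 0" by blast
  then show ?thesis using x by simp
qed


section \<open>Alternating arrays\<close>

definition alt3 :: "(4 \<Rightarrow> 4 \<Rightarrow> 4 \<Rightarrow> real) \<Rightarrow> bool" where
  "alt3 T \<longleftrightarrow> (\<forall>\<mu> \<nu> \<rho>. T \<nu> \<mu> \<rho> = - T \<mu> \<nu> \<rho> \<and> T \<mu> \<rho> \<nu> = - T \<mu> \<nu> \<rho>)"

definition alt4 :: "(4 \<Rightarrow> 4 \<Rightarrow> 4 \<Rightarrow> 4 \<Rightarrow> real) \<Rightarrow> bool" where
  "alt4 T \<longleftrightarrow> (\<forall>\<mu> \<nu> \<rho> \<tau>. T \<nu> \<mu> \<rho> \<tau> = - T \<mu> \<nu> \<rho> \<tau> \<and> T \<mu> \<rho> \<nu> \<tau> = - T \<mu> \<nu> \<rho> \<tau>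
     \<and> T \<mu> \<nu> \<tau> \<rho> = - T \<mu> \<nu> \<rho> \<tau>)"

text \<open>
  Bubble sort: transposing neighbouring indices sorts them up to sign, and a repeated index gives zero.
\<close>

lemma alt3_zero:
  assumes "alt3 T" "T 2 3 4 = 0" "T 1 3 4 = 0" "T 1 2 4 = 0" "T 1 2 3 = 0"
  shows "T \<mu> \<nu> \<rho> = 0"
proof -
  have s1: "T 2 1 r = - T 1 2 r" "T 3 1 r = - T 1 3 r" "T 4 1 r = - T 1 4 r"
    "T 3 2 r = - T 2 3 r" "T 4 2 r = - T 2 4 r" "T 4 3 r = - T 3 4 r"
    and s2: "T r 2 1 = - T r 1 2" "T r 3 1 = - T r 1 3" "T r 4 1 = - T r 1 4"
    "T r 3 2 = - T r 2 3" "T r 4 2 = - T r 2 4" "T r 4 3 = - T r 3 4" for r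
    using assms(1) unfolding alt3_def by blast+
  have z: "T i i r = 0" "T r i i = 0" for i r
    using assms(1) unfolding alt3_def by (metis equal_neg_zero)+
  have "\<forall>\<mu> \<nu> \<rho>. T \<mu> \<nu> \<rho> = 0"
    unfolding forall_4 by (simp add: s1 s2 z assms)
  then show ?thesis by blast
qed

lemma alt4_zero:
  assumes "alt4 T" "T 1 2 3 4 = 0"
  shows "T \<mu> \<nu> \<rho> \<tau> = 0"
proof -
  have s1: "T 2 1 r s = - T 1 2 r s" "T 3 1 r s = - T 1 3 r s" "T 4 1 r s = - T 1 4 r s"
    "T 3 2 r s = - T 2 3 r s" "T 4 2 r s = - T 2 4 r s" "T 4 3 r s = - T 3 4 r s"
    and s2: "T r 2 1 s = - T r 1 2 s" "T r 3 1 s = - T r 1 3 s" "T r 4 1 s = - T r 1 4 s"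
    "T r 3 2 s = - T r 2 3 s" "T r 4 2 s = - T r 2 4 s" "T r 4 3 s = - T r 3 4 s"
    and s3: "T r s 2 1 = - T r s 1 2" "T r s 3 1 = - T r s 1 3" "T r s 4 1 = - T r s 1 4"
    "T r s 3 2 = - T r s 2 3" "T r s 4 2 = - T r s 2 4" "T r s 4 3 = - T r s 3 4" for r s
    using assms(1) unfolding alt4_def by blast+
  have z: "T i i r s = 0" "T r i i s = 0" "T r s i i = 0" for i r s
    using assms(1) unfolding alt4_def by (metis equal_neg_zero)+
  have "\<forall>\<mu> \<nu> \<rho> \<tau>. T \<mu> \<nu> \<rho> \<tau> = 0"
    unfolding forall_4 by (simp add: s1 s2 s3 z assms)
  then show ?thesis by blast
qed

lemma alt4_wedge22:
  assumes "\<And>\<mu> \<nu>. s \<mu> \<nu> = - s \<nu> \<mu>" "\<And>\<mu> \<nu>. t \<mu> \<nu> = - t \<nu> \<mu>"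
  shows "alt4 (wedge22 s t)"
  unfolding alt4_def wedge22_def
proof (intro allI conjI)
  fix \<mu> \<nu> \<rho> \<tau>
  show "s \<nu> \<mu> * t \<rho> \<tau> - s \<nu> \<rho> * t \<mu> \<tau> + s \<nu> \<tau> * t \<mu> \<rho> + s \<mu> \<rho> * t \<nu> \<tau> - s \<mu> \<tau> * t \<nu> \<rho> + s \<rho> \<tau> * t \<nu> \<mu> =
     - (s \<mu> \<nu> * t \<rho> \<tau> - s \<mu> \<rho> * t \<nu> \<tau> + s \<mu> \<tau> * t \<nu> \<rho> + s \<nu> \<rho> * t \<mu> \<tau> - s \<nu> \<tau> * t \<mu> \<rho> + s \<rho> \<tau> * t \<mu> \<nu>)"
    using assms(1)[of \<mu> \<nu>] assms(2)[of \<mu> \<nu>] by simp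
  show "s \<mu> \<rho> * t \<nu> \<tau> - s \<mu> \<nu> * t \<rho> \<tau> + s \<mu> \<tau> * t \<rho> \<nu> + s \<rho> \<nu> * t \<mu> \<tau> - s \<rho> \<tau> * t \<mu> \<nu> + s \<nu> \<tau> * t \<mu> \<rho> =
     - (s \<mu> \<nu> * t \<rho> \<tau> - s \<mu> \<rho> * t \<nu> \<tau> + s \<mu> \<tau> * t \<nu> \<rho> + s \<nu> \<rho> * t \<mu> \<tau> - s \<nu> \<tau> * t \<mu> \<rho> + s \<rho> \<tau> * t \<mu> \<nu>)"
    using assms(1)[of \<nu> \<rho>] assms(2)[of \<nu> \<rho>] by simp
  show "s \<mu> \<nu> * t \<tau> \<rho> - s \<mu> \<tau> * t \<nu> \<rho> + s \<mu> \<rho> * t \<nu> \<tau> + s \<nu> \<tau> * t \<mu> \<rho> - s \<nu> \<rho> * t \<mu> \<tau> + s \<tau> \<rho> * t \<mu> \<nu> =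
     - (s \<mu> \<nu> * t \<rho> \<tau> - s \<mu> \<rho> * t \<nu> \<tau> + s \<mu> \<tau> * t \<nu> \<rho> + s \<nu> \<rho> * t \<mu> \<tau> - s \<nu> \<tau> * t \<mu> \<rho> + s \<rho> \<tau> * t \<mu> \<nu>)"
    using assms(1)[of \<rho> \<tau>] assms(2)[of \<rho> \<tau>] by simp
qed

lemma alt3_wedge12:
  assumes "\<And>\<mu> \<nu>. s \<mu> \<nu> = - s \<nu> \<mu>"
  shows "alt3 (wedge12 a s)"
  unfolding alt3_def wedge12_def
proof (intro allI conjI)
  fix \<mu> \<nu> \<rho>
  show "a \<nu> * s \<mu> \<rho> + a \<mu> * s \<rho> \<nu> + a \<rho> * s \<nu> \<mu> = - (a \<mu> * s \<nu> \<rho> + a \<nu> * s \<rho> \<mu> + a \<rho> * s \<mu> \<nu>)"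
    using assms(1)[of \<mu> \<nu>] assms[of \<rho> \<nu>] assms[of \<mu> \<rho>] by simp
  show "a \<mu> * s \<rho> \<nu> + a \<rho> * s \<nu> \<mu> + a \<nu> * s \<mu> \<rho> = - (a \<mu> * s \<nu> \<rho> + a \<nu> * s \<rho> \<mu> + a \<rho> * s \<mu> \<nu>)"
    using assms(1)[of \<mu> \<nu>] assms[of \<rho> \<nu>] assms[of \<mu> \<rho>] by simp
qed

lemma sum_swap22:
  fixes f :: "'a::finite \<Rightarrow> 'b::finite \<Rightarrow> 'c::finite \<Rightarrow> 'd::finite \<Rightarrow> real"
  shows "(\<Sum>a\<in>UNIV. \<Sum>b\<in>UNIV. \<Sum>c\<in>UNIV. \<Sum>d\<in>UNIV. f a b c d)
       = (\<Sum>c\<in>UNIV. \<Sum>d\<in>UNIV. \<Sum>a\<in>UNIV. \<Sum>b\<in>UNIV. f a b c d)"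
proof -
  have "(\<Sum>a\<in>UNIV. \<Sum>b\<in>UNIV. \<Sum>c\<in>UNIV. \<Sum>d\<in>UNIV. f a b c d)
      = (\<Sum>x\<in>UNIV. \<Sum>y\<in>UNIV. f (fst x) (snd x) (fst y) (snd y))"
    unfolding UNIV_Times_UNIV[symmetric] sum.cartesian_product' by simp
  also have "\<dots> = (\<Sum>y\<in>UNIV. \<Sum>x\<in>UNIV. f (fst x) (snd x) (fst y) (snd y))"
    by (rule sum.swap)
  also have "\<dots> = (\<Sum>c\<in>UNIV. \<Sum>d\<in>UNIV. \<Sum>a\<in>UNIV. \<Sum>b\<in>UNIV. f a b c d)"
    unfolding UNIV_Times_UNIV[symmetric] sum.cartesian_product' by simp
  finally show ?thesis .
qed

section \<open>Pull-back of arrays under a linear map\<close>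

text \<open>
  The component form of the pull-back under a linear map with matrix \<open>J\<close>.  Two instances occur:
  Jacobians of coordinate changes, for which the pull-back is the tensor transformation law, and
  changes of frame in a single fibre.
\<close>

definition pull1 :: "(4 \<Rightarrow> 4 \<Rightarrow> real) \<Rightarrow> (4 \<Rightarrow> real) \<Rightarrow> 4 \<Rightarrow> real" where
  "pull1 J a \<mu> = (\<Sum>\<alpha>\<in>UNIV. a \<alpha> * J \<alpha> \<mu>)"

definition pull2 :: "(4 \<Rightarrow> 4 \<Rightarrow> real) \<Rightarrow> (4 \<Rightarrow> 4 \<Rightarrow> real) \<Rightarrow> 4 \<Rightarrow> 4 \<Rightarrow> real" where
  "pull2 J s \<mu> \<nu> = (\<Sum>\<alpha>\<in>UNIV. \<Sum>\<beta>\<in>UNIV. s \<alpha> \<beta> * J \<alpha> \<mu> * J \<beta> \<nu>)"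

definition pull4 :: "(4 \<Rightarrow> 4 \<Rightarrow> real) \<Rightarrow> (4 \<Rightarrow> 4 \<Rightarrow> 4 \<Rightarrow> 4 \<Rightarrow> real) \<Rightarrow> 4 \<Rightarrow> 4 \<Rightarrow> 4 \<Rightarrow> 4 \<Rightarrow> real" where
  "pull4 J T \<mu> \<nu> \<rho> \<tau> = (\<Sum>\<alpha>\<in>UNIV. \<Sum>\<beta>\<in>UNIV. \<Sum>\<gamma>\<in>UNIV. \<Sum>\<delta>\<in>UNIV.
     T \<alpha> \<beta> \<gamma> \<delta> * (J \<alpha> \<mu> * J \<beta> \<nu> * J \<gamma> \<rho> * J \<delta> \<tau>))"

lemma pull2_product:
  shows "pull2 J s \<mu> \<nu> * pull2 J t \<rho> \<tau> = (\<Sum>\<alpha>\<in>UNIV. \<Sum>\<beta>\<in>UNIV. \<Sum>\<gamma>\<in>UNIV. \<Sum>\<delta>\<in>UNIV.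
     s \<alpha> \<beta> * t \<gamma> \<delta> * (J \<alpha> \<mu> * J \<beta> \<nu> * J \<gamma> \<rho> * J \<delta> \<tau>))"
  unfolding pull2_def
  by (simp only: sum_distrib_right, simp only: sum_distrib_left) (simp only: mult_ac)

lemma wedge22_pull2: "wedge22 (pull2 J s) (pull2 J t) = pull4 J (wedge22 s t)"
proof (intro ext)
  fix \<mu> \<nu> \<rho> \<tau>
  let ?J = "\<lambda>\<alpha> \<beta> \<gamma> \<delta>. J \<alpha> \<mu> * J \<beta> \<nu> * J \<gamma> \<rho> * J \<delta> \<tau>"
  let ?S = "\<lambda>f. (\<Sum>\<alpha>\<in>UNIV. \<Sum>\<beta>\<in>UNIV. \<Sum>\<gamma>\<in>UNIV. \<Sum>\<delta>\<in>UNIV. f \<alpha> \<beta> \<gamma> \<delta>) :: real"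
  have sw23: "?S f = ?S (\<lambda>\<alpha> \<beta> \<gamma> \<delta>. f \<alpha> \<gamma> \<beta> \<delta>)" for f by (intro sum.cong refl sum.swap)
  have sw34: "?S f = ?S (\<lambda>\<alpha> \<beta> \<gamma> \<delta>. f \<alpha> \<beta> \<delta> \<gamma>)" for f by (intro sum.cong refl sum.swap)
  have sw12: "?S f = ?S (\<lambda>\<alpha> \<beta> \<gamma> \<delta>. f \<beta> \<alpha> \<gamma> \<delta>)" for f by (rule sum.swap)
  have swb: "?S f = ?S (\<lambda>\<alpha> \<beta> \<gamma> \<delta>. f \<gamma> \<delta> \<alpha> \<beta>)" for f
    using sw23[of f] sw12[of "\<lambda>\<alpha> \<beta> \<gamma> \<delta>. f \<alpha> \<gamma> \<beta> \<delta>"] sw34[of "\<lambda>\<alpha> \<beta> \<gamma> \<delta>. f \<beta> \<gamma> \<alpha> \<delta>"]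
      sw23[of "\<lambda>\<alpha> \<beta> \<gamma> \<delta>. f \<beta> \<delta> \<alpha> \<gamma>"] by (simp only:)
  have 1: "pull2 J s \<mu> \<nu> * pull2 J t \<rho> \<tau> = ?S (\<lambda>\<alpha> \<beta> \<gamma> \<delta>. s \<alpha> \<beta> * t \<gamma> \<delta> * ?J \<alpha> \<beta> \<gamma> \<delta>)"
    by (rule pull2_product)
  have 2: "pull2 J s \<mu> \<rho> * pull2 J t \<nu> \<tau> = ?S (\<lambda>\<alpha> \<beta> \<gamma> \<delta>. s \<alpha> \<gamma> * t \<beta> \<delta> * ?J \<alpha> \<beta> \<gamma> \<delta>)"
    unfolding pull2_product by (subst sw23) (simp only: mult_ac)
  have 3: "pull2 J s \<mu> \<tau> * pull2 J t \<nu> \<rho> = ?S (\<lambda>\<alpha> \<beta> \<gamma> \<delta>. s \<alpha> \<delta> * t \<beta> \<gamma> * ?J \<alpha> \<beta> \<gamma> \<delta>)"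
    unfolding pull2_product by (subst sw23, subst sw34) (simp only: mult_ac)
  have 4: "pull2 J s \<nu> \<rho> * pull2 J t \<mu> \<tau> = ?S (\<lambda>\<alpha> \<beta> \<gamma> \<delta>. s \<beta> \<gamma> * t \<alpha> \<delta> * ?J \<alpha> \<beta> \<gamma> \<delta>)"
    unfolding pull2_product by (subst sw23, subst sw12) (simp only: mult_ac)
  have 5: "pull2 J s \<nu> \<tau> * pull2 J t \<mu> \<rho> = ?S (\<lambda>\<alpha> \<beta> \<gamma> \<delta>. s \<beta> \<delta> * t \<alpha> \<gamma> * ?J \<alpha> \<beta> \<gamma> \<delta>)"
    unfolding pull2_product by (subst sw12, subst sw34, subst sw23, subst sw12, subst sw12) (simp only: mult_ac)
  have 6: "pull2 J s \<rho> \<tau> * pull2 J t \<mu> \<nu> = ?S (\<lambda>\<alpha> \<beta> \<gamma> \<delta>. s \<gamma> \<delta> * t \<alpha> \<beta> * ?J \<alpha> \<beta> \<gamma> \<delta>)"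
    unfolding pull2_product by (rule trans[OF swb]) (simp only: mult_ac)
  show "wedge22 (pull2 J s) (pull2 J t) \<mu> \<nu> \<rho> \<tau> = pull4 J (wedge22 s t) \<mu> \<nu> \<rho> \<tau>"
    unfolding wedge22_def pull4_def 1 2 3 4 5 6
    by (simp only: sum.distrib[symmetric] sum_subtractf[symmetric]) (simp only: algebra_simps)
qed

lemma wedge11_pull1: "wedge11 (pull1 J a) (pull1 J b) = pull2 J (wedge11 a b)"
proof (intro ext)
  fix \<mu> \<nu>
  have 1: "pull1 J a \<mu> * pull1 J b \<nu> = (\<Sum>\<alpha>\<in>UNIV. \<Sum>\<beta>\<in>UNIV. a \<alpha> * b \<beta> * J \<alpha> \<mu> * J \<beta> \<nu>)"
    unfolding pull1_def sum_product by (simp add: algebra_simps)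
  have 2: "pull1 J a \<nu> * pull1 J b \<mu> = (\<Sum>\<alpha>\<in>UNIV. \<Sum>\<beta>\<in>UNIV. a \<beta> * b \<alpha> * J \<alpha> \<mu> * J \<beta> \<nu>)"
    unfolding pull1_def sum_product by (subst sum.swap) (simp add: algebra_simps)
  show "wedge11 (pull1 J a) (pull1 J b) \<mu> \<nu> = pull2 J (wedge11 a b) \<mu> \<nu>"
    unfolding wedge11_def 1 2 pull2_def by (simp add: sum_subtractf[symmetric] algebra_simps)
qed

text \<open>
  Alternating arrays of rank four form a line, so the pull-back acts on them as a scalar, and the
  quotient of two of them is invariant.
\<close>

lemma alt4_ratio_pull4:
  assumes T: "alt4 T" and V: "alt4 V" "V 1 2 3 4 \<noteq> 0" and "pull4 J V 1 2 3 4 \<noteq> 0"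
  shows "pull4 J T 1 2 3 4 / pull4 J V 1 2 3 4 = T 1 2 3 4 / V 1 2 3 4"
proof -
  let ?c = "T 1 2 3 4 / V 1 2 3 4"
  have "alt4 (\<lambda>\<mu> \<nu> \<rho> \<tau>. T \<mu> \<nu> \<rho> \<tau> - ?c * V \<mu> \<nu> \<rho> \<tau>)"
    unfolding alt4_def
  proof (intro allI conjI)
    fix \<mu> \<nu> \<rho> \<tau>
    note T' = T[unfolded alt4_def, THEN spec, THEN spec, THEN spec, THEN spec, of \<nu> \<mu> \<rho> \<tau>]
    note V' = V(1)[unfolded alt4_def, THEN spec, THEN spec, THEN spec, THEN spec, of \<nu> \<mu> \<rho> \<tau>]
    show "T \<nu> \<mu> \<rho> \<tau> - ?c * V \<nu> \<mu> \<rho> \<tau> = - (T \<mu> \<nu> \<rho> \<tau> - ?c * V \<mu> \<nu> \<rho> \<tau>)"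
      unfolding conjunct1[OF T'] conjunct1[OF V'] by simp
    show "T \<mu> \<rho> \<nu> \<tau> - ?c * V \<mu> \<rho> \<nu> \<tau> = - (T \<mu> \<nu> \<rho> \<tau> - ?c * V \<mu> \<nu> \<rho> \<tau>)"
      unfolding conjunct1[OF conjunct2[OF T']] conjunct1[OF conjunct2[OF V']] by simp
    show "T \<mu> \<nu> \<tau> \<rho> - ?c * V \<mu> \<nu> \<tau> \<rho> = - (T \<mu> \<nu> \<rho> \<tau> - ?c * V \<mu> \<nu> \<rho> \<tau>)"
      unfolding conjunct2[OF conjunct2[OF T']] conjunct2[OF conjunct2[OF V']] by simp
  qed
  then have z: "T \<mu> \<nu> \<rho> \<tau> - ?c * V \<mu> \<nu> \<rho> \<tau> = 0" for \<mu> \<nu> \<rho> \<tau>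
    by (rule alt4_zero) (use V(2) in simp)
  have eq: "T = (\<lambda>\<mu> \<nu> \<rho> \<tau>. ?c * V \<mu> \<nu> \<rho> \<tau>)"
    by (intro ext, rule iffD2[OF eq_iff_diff_eq_0], rule z)
  have "pull4 J (\<lambda>\<mu> \<nu> \<rho> \<tau>. c * V \<mu> \<nu> \<rho> \<tau>) 1 2 3 4 = c * pull4 J V 1 2 3 4" for c
    unfolding pull4_def sum_distrib_left by (simp only: mult.assoc)
  from this[of ?c] have "pull4 J T 1 2 3 4 = ?c * pull4 J V 1 2 3 4"
    unfolding eq[symmetric] .
  then show ?thesis using assms(4) by simp
qed

section \<open>Contractions with alternating arrays\<close>

lemma sum_cyclic3:
  fixes f :: "'a::finite \<Rightarrow> 'a \<Rightarrow> 'a \<Rightarrow> real"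
  shows "(\<Sum>\<alpha>\<in>UNIV. \<Sum>\<beta>\<in>UNIV. \<Sum>\<gamma>\<in>UNIV. f \<alpha> \<beta> \<gamma>) = (\<Sum>\<alpha>\<in>UNIV. \<Sum>\<beta>\<in>UNIV. \<Sum>\<gamma>\<in>UNIV. f \<gamma> \<alpha> \<beta>)"
proof -
  have "(\<Sum>\<alpha>\<in>UNIV. \<Sum>\<beta>\<in>UNIV. \<Sum>\<gamma>\<in>UNIV. f \<gamma> \<alpha> \<beta>) = (\<Sum>\<alpha>\<in>UNIV. \<Sum>\<gamma>\<in>UNIV. \<Sum>\<beta>\<in>UNIV. f \<gamma> \<alpha> \<beta>)"
    by (intro sum.cong refl sum.swap)
  also have "\<dots> = (\<Sum>\<gamma>\<in>UNIV. \<Sum>\<alpha>\<in>UNIV. \<Sum>\<beta>\<in>UNIV. f \<gamma> \<alpha> \<beta>)" by (rule sum.swap)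
  finally show ?thesis by simp
qed

definition contract3 :: "(4 \<Rightarrow> 4 \<Rightarrow> 4 \<Rightarrow> real) \<Rightarrow> (4 \<Rightarrow> 4 \<Rightarrow> 4 \<Rightarrow> real) \<Rightarrow> real" where
  "contract3 V N = (\<Sum>\<alpha>\<in>UNIV. \<Sum>\<beta>\<in>UNIV. \<Sum>\<gamma>\<in>UNIV. V \<alpha> \<beta> \<gamma> * N \<alpha> \<beta> \<gamma>)"

lemma contract3_cyclic:
  assumes "alt3 V"
  shows "contract3 V (\<lambda>\<alpha> \<beta> \<gamma>. N \<beta> \<gamma> \<alpha>) = contract3 V N"
    and "contract3 V (\<lambda>\<alpha> \<beta> \<gamma>. N \<gamma> \<alpha> \<beta>) = contract3 V N"
proof -
  have V: "V \<gamma> \<alpha> \<beta> = V \<alpha> \<beta> \<gamma>" for \<alpha> \<beta> \<gamma>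
    using assms unfolding alt3_def by (metis minus_minus)
  show 1: "contract3 V (\<lambda>\<alpha> \<beta> \<gamma>. N \<beta> \<gamma> \<alpha>) = contract3 V N" for N
    unfolding contract3_def by (subst sum_cyclic3) (simp add: V)
  show "contract3 V (\<lambda>\<alpha> \<beta> \<gamma>. N \<gamma> \<alpha> \<beta>) = contract3 V N"
    using 1[of "\<lambda>\<alpha> \<beta> \<gamma>. N \<beta> \<gamma> \<alpha>"] 1[of N] by simp
qed

lemma contract3_add: "contract3 V (\<lambda>\<alpha> \<beta> \<gamma>. N \<alpha> \<beta> \<gamma> + N' \<alpha> \<beta> \<gamma>) = contract3 V N + contract3 V N'"
  unfolding contract3_def by (simp add: algebra_simps sum.distrib)

lemma contract3_diff: "contract3 V (\<lambda>\<alpha> \<beta> \<gamma>. N \<alpha> \<beta> \<gamma> - N' \<alpha> \<beta> \<gamma>) = contract3 V N - contract3 V N'"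
  unfolding contract3_def by (simp add: algebra_simps sum_subtractf)

text \<open>
  This is what removes the Christoffel symbols from \<open>\<star>d\<close>.
\<close>

lemma contract3_symmetric12:
  assumes "alt3 V" "\<And>\<alpha> \<beta> \<gamma>. N \<alpha> \<beta> \<gamma> = N \<beta> \<alpha> \<gamma>"
  shows "contract3 V N = 0"
proof -
  have "contract3 V N = (\<Sum>\<beta>\<in>UNIV. \<Sum>\<alpha>\<in>UNIV. \<Sum>\<gamma>\<in>UNIV. V \<alpha> \<beta> \<gamma> * N \<alpha> \<beta> \<gamma>)"
    unfolding contract3_def by (rule sum.swap)
  also have "\<dots> = (\<Sum>\<beta>\<in>UNIV. \<Sum>\<alpha>\<in>UNIV. \<Sum>\<gamma>\<in>UNIV. - (V \<beta> \<alpha> \<gamma> * N \<beta> \<alpha> \<gamma>))"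
    using assms unfolding alt3_def by (intro sum.cong refl) (metis mult_minus_left)
  also have "\<dots> = - contract3 V N" by (simp add: contract3_def sum_negf)
  finally show ?thesis by simp
qed

lemma contract3_symmetric13:
  assumes "alt3 V" "\<And>\<alpha> \<beta> \<gamma>. N \<alpha> \<beta> \<gamma> = N \<gamma> \<beta> \<alpha>"
  shows "contract3 V N = 0"
proof -
  have "contract3 V (\<lambda>\<alpha> \<beta> \<gamma>. N \<beta> \<gamma> \<alpha>) = 0"
    by (rule contract3_symmetric12[OF assms(1)]) (use assms(2) in metis)
  then show ?thesis using contract3_cyclic(1)[OF assms(1), of N] by simp
qed

lemma contract3_wedge12:
  assumes "alt3 V"
  shows "contract3 V (wedge12 a s) = 3 * (\<Sum>\<alpha>\<in>UNIV. a \<alpha> * (\<Sum>\<beta>\<in>UNIV. \<Sum>\<gamma>\<in>UNIV. V \<alpha> \<beta> \<gamma> * s \<beta> \<gamma>))"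
proof -
  have "contract3 V (wedge12 a s) = 3 * contract3 V (\<lambda>\<alpha> \<beta> \<gamma>. a \<alpha> * s \<beta> \<gamma>)"
    unfolding wedge12_def contract3_add
    using contract3_cyclic[OF assms, of "\<lambda>\<alpha> \<beta> \<gamma>. a \<alpha> * s \<beta> \<gamma>"] by simp
  also have "contract3 V (\<lambda>\<alpha> \<beta> \<gamma>. a \<alpha> * s \<beta> \<gamma>) = (\<Sum>\<alpha>\<in>UNIV. a \<alpha> * (\<Sum>\<beta>\<in>UNIV. \<Sum>\<gamma>\<in>UNIV. V \<alpha> \<beta> \<gamma> * s \<beta> \<gamma>))"
    unfolding contract3_def by (simp add: sum_distrib_left algebra_simps)
  finally show ?thesis .
qed


section \<open>The algebra of one fibre\<close>

lemma eps3_simps [simp]: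
  "eps3 1 2 3 = 1" "eps3 2 3 1 = 1" "eps3 3 1 2 = 1"
  "eps3 2 1 3 = -1" "eps3 1 3 2 = -1" "eps3 3 2 1 = -1"
  "eps3 i i j = 0" "eps3 i j j = 0" "eps3 i j i = 0"
  unfolding eps3_def by auto

lemma kdelta_simps [simp]: "kdelta i i = 1" "i \<noteq> j \<Longrightarrow> kdelta i j = 0"
  by (auto simp: kdelta_def)

lemma kdelta_commute: "kdelta i j = kdelta j i"
  by (auto simp: kdelta_def)

text \<open>
  The values at one point, in one chart, of the metric, the triple and the volume form.
\<close>

locale perfect_fibre =
  fixes G :: "4 \<Rightarrow> 4 \<Rightarrow> real" and S :: "3 \<Rightarrow> 4 \<Rightarrow> 4 \<Rightarrow> real" and v :: "4 \<Rightarrow> 4 \<Rightarrow> 4 \<Rightarrow> 4 \<Rightarrow> real"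
  assumes S_antisym: "S i \<mu> \<nu> = - S i \<nu> \<mu>"
    and G_sym: "G \<mu> \<nu> = G \<nu> \<mu>"
    and G_pos: "x \<noteq> 0 \<Longrightarrow> (\<Sum>\<mu>\<in>UNIV. \<Sum>\<nu>\<in>UNIV. G \<mu> \<nu> * x $ \<mu> * (x::real^4) $ \<nu>) > 0"
    and S_wedge: "wedge22 (S i) (S j) \<mu> \<nu> \<rho> \<tau> = 2 * kdelta i j * v \<mu> \<nu> \<rho> \<tau>"
    and v_nonzero: "v 1 2 3 4 \<noteq> 0"
    and self_dual: "1/2 * (\<Sum>\<rho>\<in>UNIV. \<Sum>\<tau>\<in>UNIV. \<Sum>\<alpha>\<in>UNIV. \<Sum>\<beta>\<in>UNIV.
            v \<mu> \<nu> \<rho> \<tau> * inv_metric G \<rho> \<alpha> * inv_metric G \<tau> \<beta> * S i \<alpha> \<beta>) = S i \<mu> \<nu>"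
    and quaternion: "(\<Sum>\<alpha>\<in>UNIV. raise2 G (S i) \<mu> \<alpha> * raise2 G (S j) \<alpha> \<nu>)
          = - kdelta i j * kdelta \<mu> \<nu> + (\<Sum>k\<in>UNIV. eps3 i j k * raise2 G (S k) \<mu> \<nu>)"
begin

subsection \<open>The endomorphism \<open>J\<^sub>1\<close>\<close>

text \<open>
  The endomorphisms \<open>\<Sigma>\<^sup>j\<^sub>\<mu>\<^sup>\<alpha>\<close> of covectors, which multiply like unit quaternions.
\<close>

definition R :: "3 \<Rightarrow> (4 \<Rightarrow> real) \<Rightarrow> 4 \<Rightarrow> real" where
  "R j x \<mu> = (\<Sum>\<alpha>\<in>UNIV. raise2 G (S j) \<mu> \<alpha> * x \<alpha>)"

lemma R_R: "R i (R j x) \<mu> = - kdelta i j * x \<mu> + (\<Sum>k\<in>UNIV. eps3 i j k * R k x \<mu>)"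
proof -
  have "R i (R j x) \<mu> = (\<Sum>\<alpha>\<in>UNIV. \<Sum>\<beta>\<in>UNIV. raise2 G (S i) \<mu> \<alpha> * raise2 G (S j) \<alpha> \<beta> * x \<beta>)"
    unfolding R_def by (simp only: sum_distrib_left mult.assoc)
  also have "\<dots> = (\<Sum>\<beta>\<in>UNIV. (\<Sum>\<alpha>\<in>UNIV. raise2 G (S i) \<mu> \<alpha> * raise2 G (S j) \<alpha> \<beta>) * x \<beta>)"
    by (subst sum.swap) (simp only: sum_distrib_right)
  also have "\<dots> = (\<Sum>\<beta>\<in>UNIV. (- kdelta i j * kdelta \<mu> \<beta>) * x \<beta>)
      + (\<Sum>\<beta>\<in>UNIV. (\<Sum>k\<in>UNIV. eps3 i j k * raise2 G (S k) \<mu> \<beta>) * x \<beta>)"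
    unfolding quaternion by (simp only: distrib_right sum.distrib)
  also have "(\<Sum>\<beta>\<in>UNIV. (- kdelta i j * kdelta \<mu> \<beta>) * x \<beta>) = - kdelta i j * x \<mu>"
  proof -
    have "(\<Sum>\<beta>\<in>UNIV. (- kdelta i j * kdelta \<mu> \<beta>) * x \<beta>) = (\<Sum>\<beta>\<in>UNIV. if \<beta> = \<mu> then - kdelta i j * x \<mu> else 0)"
      by (intro sum.cong refl) (auto simp: kdelta_def)
    then show ?thesis by simp
  qed
  also have "(\<Sum>\<beta>\<in>UNIV. (\<Sum>k\<in>UNIV. eps3 i j k * raise2 G (S k) \<mu> \<beta>) * x \<beta>) = (\<Sum>k\<in>UNIV. eps3 i j k * R k x \<mu>)"
    unfolding R_def sum_distrib_left sum_distrib_right by (subst sum.swap) (simp only: mult.assoc)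
  finally show ?thesis .
qed

lemma R_diff: "R i (\<lambda>\<mu>. x \<mu> - y \<mu>) = (\<lambda>\<mu>. R i x \<mu> - R i y \<mu>)"
  unfolding R_def by (intro ext) (simp only: right_diff_distrib sum_subtractf)

lemma J1_R: "J1 G S a i = (\<lambda>\<mu>. \<Sum>j\<in>UNIV. \<Sum>k\<in>UNIV. eps3 i j k * R j (a k) \<mu>)"
  unfolding J1_def R_def by (intro ext) (simp only: sum_distrib_left mult.assoc)

lemma J1_components:
  "J1 G S a 1 = (\<lambda>\<mu>. R 2 (a 3) \<mu> - R 3 (a 2) \<mu>)"
  "J1 G S a 2 = (\<lambda>\<mu>. R 3 (a 1) \<mu> - R 1 (a 3) \<mu>)"
  "J1 G S a 3 = (\<lambda>\<mu>. R 1 (a 2) \<mu> - R 2 (a 1) \<mu>)"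
  unfolding J1_R by (simp_all add: sum_3)

text \<open>
  \<open>J\<^sub>1\<close> satisfies \<open>J\<^sub>1\<^sup>2 = 2 + J\<^sub>1\<close>, by the quaternion relations: contracting two Levi-Civita symbols
  leaves \<open>R\<^sup>j R\<^sup>i a\<^sup>j - R\<^sup>j R\<^sup>j a\<^sup>i\<close>.  Hence its inverse is \<open>(J\<^sub>1 - 1)/2\<close>, an expression without division,
  which also makes the smoothness of \<open>d\<^sub>2 \<sigma>\<close> evident.
\<close>

lemma J1_J1: "J1 G S (J1 G S a) = (\<lambda>i \<mu>. 2 * a i \<mu> + J1 G S a i \<mu>)"
proof -
  have "\<forall>i. J1 G S (J1 G S a) i = (\<lambda>\<mu>. 2 * a i \<mu> + J1 G S a i \<mu>)"
    unfolding forall_3 J1_components R_diff R_R by (simp add: sum_3)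
  then show ?thesis by blast
qed

lemma inv_J1: "inv (J1 G S) X = (\<lambda>i \<mu>. (J1 G S X i \<mu> - X i \<mu>) / 2)"
proof (rule inv_f_eq)
  show "inj (J1 G S)"
  proof (rule injI)
    fix a b assume e: "J1 G S a = J1 G S b"
    have "2 * a i \<mu> = 2 * b i \<mu>" for i \<mu>
      using fun_cong[OF fun_cong[OF J1_J1[of a]], of i \<mu>] fun_cong[OF fun_cong[OF J1_J1[of b]], of i \<mu>] e by simp
    then show "a = b" by (intro ext) simp
  qed
  have d: "J1 G S (\<lambda>i \<mu>. (Y i \<mu> - X i \<mu>) / 2) i \<mu> = (J1 G S Y i \<mu> - J1 G S X i \<mu>) / 2" for Y i \<mu>
    unfolding J1_def by (simp add: right_diff_distrib sum_subtractf sum_divide_distrib diff_divide_distrib)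
  show "J1 G S (\<lambda>i \<mu>. (J1 G S X i \<mu> - X i \<mu>) / 2) = X"
    by (intro ext) (simp add: d J1_J1)
qed

lemma J1_scale: "J1 G S (\<lambda>i \<mu>. c * a i \<mu>) = (\<lambda>i \<mu>. c * J1 G S a i \<mu>)"
  unfolding J1_def by (intro ext) (simp add: sum_distrib_left mult_ac)

subsection \<open>Solving \<open>\<omega> + \<epsilon> a \<and> \<Sigma> = 0\<close> for \<open>a\<close>\<close>

lemma alt4_v: "alt4 v"
proof -
  have "wedge22 (S 1) (S 1) = (\<lambda>\<mu> \<nu> \<rho> \<tau>. 2 * v \<mu> \<nu> \<rho> \<tau>)"
    by (intro ext) (simp add: S_wedge)
  moreover have "alt4 (wedge22 (S 1) (S 1))"
    by (rule alt4_wedge22) (rule S_antisym)+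
  ultimately have *: "alt4 (\<lambda>\<mu> \<nu> \<rho> \<tau>. 2 * v \<mu> \<nu> \<rho> \<tau>)" by (simp only:)
  show ?thesis
    unfolding alt4_def
  proof (intro allI)
    fix \<mu> \<nu> \<rho> \<tau>
    from *[unfolded alt4_def, THEN spec, THEN spec, THEN spec, THEN spec, of \<nu> \<mu> \<rho> \<tau>]
    show "v \<nu> \<mu> \<rho> \<tau> = - v \<mu> \<nu> \<rho> \<tau> \<and> v \<mu> \<rho> \<nu> \<tau> = - v \<mu> \<nu> \<rho> \<tau> \<and> v \<mu> \<nu> \<tau> \<rho> = - v \<mu> \<nu> \<rho> \<tau>"
      by linarith
  qed
qed

text \<open>
  The volume tensor \<open>\<epsilon>\<^sub>\<mu>\<^sup>\<alpha>\<^sup>\<beta>\<^sup>\<gamma>\<close>.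
\<close>

definition vol_up :: "4 \<Rightarrow> 4 \<Rightarrow> 4 \<Rightarrow> 4 \<Rightarrow> real" where
  "vol_up \<mu> \<alpha> \<beta> \<gamma> = (\<Sum>\<alpha>'\<in>UNIV. \<Sum>\<beta>'\<in>UNIV. \<Sum>\<gamma>'\<in>UNIV.
     v \<mu> \<alpha>' \<beta>' \<gamma>' * inv_metric G \<alpha>' \<alpha> * inv_metric G \<beta>' \<beta> * inv_metric G \<gamma>' \<gamma>)"

lemma alt3_vol_up: "alt3 (vol_up \<mu>)"
  unfolding alt3_def
proof (intro allI conjI)
  fix \<alpha> \<beta> \<gamma>
  have v: "v \<mu> \<beta> \<alpha> \<gamma> = - v \<mu> \<alpha> \<beta> \<gamma>" "v \<mu> \<alpha> \<gamma> \<beta> = - v \<mu> \<alpha> \<beta> \<gamma>" for \<alpha> \<beta> \<gamma>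
    using alt4_v unfolding alt4_def by blast+
  show "vol_up \<mu> \<beta> \<alpha> \<gamma> = - vol_up \<mu> \<alpha> \<beta> \<gamma>"
    unfolding vol_up_def sum_negf[symmetric]
    by (subst sum.swap, intro sum.cong refl, subst v(1)) simp
  show "vol_up \<mu> \<alpha> \<gamma> \<beta> = - vol_up \<mu> \<alpha> \<beta> \<gamma>"
    unfolding vol_up_def sum_negf[symmetric]
    by (rule sum.cong[OF refl], subst sum.swap, intro sum.cong refl, subst v(2)) simp
qed

text \<open>
  Self-duality of the triple, with one more index raised.
\<close>

lemma vol_up_S: "(\<Sum>\<beta>\<in>UNIV. \<Sum>\<gamma>\<in>UNIV. vol_up \<mu> \<alpha> \<beta> \<gamma> * S k \<beta> \<gamma>) = 2 * raise2 G (S k) \<mu> \<alpha>"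
proof -
  let ?I = "inv_metric G"
  have "(\<Sum>\<beta>\<in>UNIV. \<Sum>\<gamma>\<in>UNIV. vol_up \<mu> \<alpha> \<beta> \<gamma> * S k \<beta> \<gamma>)
      = (\<Sum>\<beta>\<in>UNIV. \<Sum>\<gamma>\<in>UNIV. \<Sum>\<alpha>'\<in>UNIV. \<Sum>\<beta>'\<in>UNIV. \<Sum>\<gamma>'\<in>UNIV.
         ?I \<alpha>' \<alpha> * (v \<mu> \<alpha>' \<beta>' \<gamma>' * ?I \<beta>' \<beta> * ?I \<gamma>' \<gamma> * S k \<beta> \<gamma>))"
    unfolding vol_up_def sum_distrib_right by (simp only: mult_ac)
  also have "\<dots> = (\<Sum>\<beta>\<in>UNIV. \<Sum>\<alpha>'\<in>UNIV. \<Sum>\<gamma>\<in>UNIV. \<Sum>\<beta>'\<in>UNIV. \<Sum>\<gamma>'\<in>UNIV.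
         ?I \<alpha>' \<alpha> * (v \<mu> \<alpha>' \<beta>' \<gamma>' * ?I \<beta>' \<beta> * ?I \<gamma>' \<gamma> * S k \<beta> \<gamma>))"
    by (rule sum.cong[OF refl], rule sum.swap)
  also have "\<dots> = (\<Sum>\<alpha>'\<in>UNIV. \<Sum>\<beta>\<in>UNIV. \<Sum>\<gamma>\<in>UNIV. \<Sum>\<beta>'\<in>UNIV. \<Sum>\<gamma>'\<in>UNIV.
         ?I \<alpha>' \<alpha> * (v \<mu> \<alpha>' \<beta>' \<gamma>' * ?I \<beta>' \<beta> * ?I \<gamma>' \<gamma> * S k \<beta> \<gamma>))"
    by (rule sum.swap)
  also have "\<dots> = (\<Sum>\<alpha>'\<in>UNIV. ?I \<alpha>' \<alpha> * (\<Sum>\<beta>\<in>UNIV. \<Sum>\<gamma>\<in>UNIV. \<Sum>\<beta>'\<in>UNIV. \<Sum>\<gamma>'\<in>UNIV.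
         v \<mu> \<alpha>' \<beta>' \<gamma>' * ?I \<beta>' \<beta> * ?I \<gamma>' \<gamma> * S k \<beta> \<gamma>))"
    by (simp only: sum_distrib_left)
  also have "\<dots> = (\<Sum>\<alpha>'\<in>UNIV. ?I \<alpha>' \<alpha> * (2 * S k \<mu> \<alpha>'))"
  proof (rule sum.cong[OF refl])
    fix \<alpha>'
    let ?f = "\<lambda>\<beta> \<gamma> \<beta>' \<gamma>'. v \<mu> \<alpha>' \<beta>' \<gamma>' * ?I \<beta>' \<beta> * ?I \<gamma>' \<gamma> * S k \<beta> \<gamma>"
    have "(\<Sum>\<beta>\<in>UNIV. \<Sum>\<gamma>\<in>UNIV. \<Sum>\<beta>'\<in>UNIV. \<Sum>\<gamma>'\<in>UNIV. ?f \<beta> \<gamma> \<beta>' \<gamma>')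
        = (\<Sum>\<beta>'\<in>UNIV. \<Sum>\<gamma>'\<in>UNIV. \<Sum>\<beta>\<in>UNIV. \<Sum>\<gamma>\<in>UNIV. ?f \<beta> \<gamma> \<beta>' \<gamma>')"
      by (rule sum_swap22)
    also have "\<dots> = 2 * S k \<mu> \<alpha>'" using self_dual[of \<mu> \<alpha>' k] by simp
    finally show "?I \<alpha>' \<alpha> * (\<Sum>\<beta>\<in>UNIV. \<Sum>\<gamma>\<in>UNIV. \<Sum>\<beta>'\<in>UNIV. \<Sum>\<gamma>'\<in>UNIV. ?f \<beta> \<gamma> \<beta>' \<gamma>')
      = ?I \<alpha>' \<alpha> * (2 * S k \<mu> \<alpha>')" by (rule arg_cong)
  qed
  also have "\<dots> = 2 * raise2 G (S k) \<mu> \<alpha>"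
    unfolding raise2_def sum_distrib_left by (simp only: mult_ac)
  finally show ?thesis .
qed

definition eps_wedge :: "(3 \<Rightarrow> 4 \<Rightarrow> real) \<Rightarrow> 3 \<Rightarrow> 4 \<Rightarrow> 4 \<Rightarrow> 4 \<Rightarrow> real" where
  "eps_wedge a i \<mu> \<nu> \<rho> = (\<Sum>j\<in>UNIV. \<Sum>k\<in>UNIV. eps3 i j k * wedge12 (a j) (S k) \<mu> \<nu> \<rho>)"

lemma eps_wedge_components:
  "eps_wedge a 1 \<mu> \<nu> \<rho> = wedge12 (a 2) (S 3) \<mu> \<nu> \<rho> - wedge12 (a 3) (S 2) \<mu> \<nu> \<rho>"
  "eps_wedge a 2 \<mu> \<nu> \<rho> = wedge12 (a 3) (S 1) \<mu> \<nu> \<rho> - wedge12 (a 1) (S 3) \<mu> \<nu> \<rho>"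
  "eps_wedge a 3 \<mu> \<nu> \<rho> = wedge12 (a 1) (S 2) \<mu> \<nu> \<rho> - wedge12 (a 2) (S 1) \<mu> \<nu> \<rho>"
  unfolding eps_wedge_def by (simp_all add: sum_3)

lemma contract3_wedge12_S:
  "contract3 (vol_up \<mu>) (wedge12 a (S k)) = 6 * R k a \<mu>"
  unfolding contract3_wedge12[OF alt3_vol_up] vol_up_S R_def
  by (simp add: sum_distrib_left mult_ac)

text \<open>
  The Hodge star turns \<open>a \<mapsto> \<epsilon>\<^sup>i\<^sup>j\<^sup>k a\<^sup>j \<and> \<Sigma>\<^sup>k\<close> into a multiple of \<open>J\<^sub>1\<close>; in particular this map is
  injective.
\<close>

lemma star_eps_wedge: "contract3 (vol_up \<mu>) (eps_wedge a i) = - 6 * J1 G S a i \<mu>"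
proof -
  have "\<forall>i. contract3 (vol_up \<mu>) (\<lambda>\<alpha> \<beta> \<gamma>. eps_wedge a i \<alpha> \<beta> \<gamma>) = - 6 * J1 G S a i \<mu>"
    unfolding forall_3 eps_wedge_components contract3_diff contract3_wedge12_S J1_components by simp
  then show ?thesis by simp
qed

lemma alt3_eps_wedge: "alt3 (eps_wedge a i)"
proof -
  have w: "wedge12 (a j) (S k) \<nu> \<mu> \<rho> = - wedge12 (a j) (S k) \<mu> \<nu> \<rho>"
    "wedge12 (a j) (S k) \<mu> \<rho> \<nu> = - wedge12 (a j) (S k) \<mu> \<nu> \<rho>" for j k \<mu> \<nu> \<rho>
    using alt3_wedge12[of "S k" "a j", OF S_antisym] unfolding alt3_def by blast+
  show ?thesis
    unfolding alt3_def eps_wedge_def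
    by (intro allI conjI; subst w; simp only: mult_minus_right sum_negf)
qed

lemma eps_wedge_inj: "eps_wedge a = (\<lambda>i \<mu> \<nu> \<rho>. 0) \<Longrightarrow> a = (\<lambda>i \<mu>. 0)"
proof -
  assume z: "eps_wedge a = (\<lambda>i \<mu> \<nu> \<rho>. 0)"
  have J: "J1 G S a i \<mu> = 0" for i \<mu>
    using star_eps_wedge[of \<mu> a i] by (simp add: z contract3_def)
  then have J0: "J1 G S a = (\<lambda>i \<mu>. 0)" by (intro ext)
  have "J1 G S (J1 G S a) = (\<lambda>i \<mu>. 0)" unfolding J0 J1_def by simp
  then have "2 * a i \<mu> = 0" for i \<mu>
    using fun_cong[OF fun_cong[OF J1_J1[of a]], of i \<mu>] J by simp
  then show ?thesis by (intro ext) simp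
qed

text \<open>
  Both sides have twelve components, so injectivity of \<open>a \<mapsto> \<epsilon>\<^sup>i\<^sup>j\<^sup>k a\<^sup>j \<and> \<Sigma>\<^sup>k\<close> implies surjectivity.
\<close>

lemma eps_wedge_surj:
  assumes "\<And>i. alt3 (\<omega> i)"
  obtains a where "eps_wedge a = (\<lambda>i \<mu> \<nu> \<rho>. - \<omega> i \<mu> \<nu> \<rho>)"
proof -
  define c :: "(4 \<Rightarrow> 4 \<Rightarrow> 4 \<Rightarrow> real) \<Rightarrow> real^4" where
    "c T = (\<chi> m. if m = 1 then T 2 3 4 else if m = 2 then T 1 3 4 else if m = 3 then T 1 2 4 else T 1 2 3)"
    for T
  have c: "c T $ 1 = T 2 3 4" "c T $ 2 = T 1 3 4" "c T $ 3 = T 1 2 4" "c T $ 4 = T 1 2 3" for T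
    unfolding c_def by simp_all
  \<comment> \<open>A three-form is recorded by its components with increasing indices.\<close>
  define L :: "real^4^3 \<Rightarrow> real^4^3" where "L x = (\<chi> i. c (eps_wedge (\<lambda>i \<mu>. x $ i $ \<mu>) i))" for x
  have "linear L"
  proof (rule linearI)
    have "eps_wedge (\<lambda>i. ($) (x $ i + y $ i)) i \<mu> \<nu> \<rho>
        = eps_wedge (\<lambda>i. ($) (x $ i)) i \<mu> \<nu> \<rho> + eps_wedge (\<lambda>i. ($) (y $ i)) i \<mu> \<nu> \<rho>"
      for x y :: "real^4^3" and i \<mu> \<nu> \<rho>
      unfolding eps_wedge_def wedge12_def by (simp add: algebra_simps sum.distrib)
    then show "L (x + y) = L x + L y" for x y
      unfolding L_def vec_eq_iff forall_4 by (simp add: c)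
    have "eps_wedge (\<lambda>i. ($) (r *\<^sub>R x $ i)) i \<mu> \<nu> \<rho> = r * eps_wedge (\<lambda>i. ($) (x $ i)) i \<mu> \<nu> \<rho>"
      for r and x :: "real^4^3" and i \<mu> \<nu> \<rho>
      unfolding eps_wedge_def wedge12_def by (simp add: algebra_simps sum_distrib_left)
    then show "L (r *\<^sub>R x) = r *\<^sub>R L x" for r x
      unfolding L_def vec_eq_iff forall_4 by (simp add: c)
  qed
  moreover have "inj L"
    unfolding linear_injective_0[OF \<open>linear L\<close>]
  proof (intro allI impI)
    fix x assume x: "L x = 0"
    have comp: "L x $ i $ m = 0" for i m unfolding x by simp
    have "eps_wedge (\<lambda>i \<mu>. x $ i $ \<mu>) i \<mu> \<nu> \<rho> = 0" for i \<mu> \<nu> \<rho>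
      by (rule alt3_zero[OF alt3_eps_wedge])
        (use comp[of i 1] comp[of i 2] comp[of i 3] comp[of i 4] in \<open>simp_all add: c L_def\<close>)
    then have "eps_wedge (\<lambda>i \<mu>. x $ i $ \<mu>) = (\<lambda>i \<mu> \<nu> \<rho>. 0)" by (intro ext)
    from fun_cong[OF fun_cong[OF eps_wedge_inj[OF this]]] have "x $ i $ \<mu> = 0" for i \<mu> .
    then show "x = 0" by (simp add: vec_eq_iff)
  qed
  ultimately have "surj L" by (intro linear_injective_imp_surjective) auto
  then obtain x where x: "L x = (\<chi> i. - c (\<omega> i))" by (rule surjE[of L "\<chi> i. - c (\<omega> i)"]) (rule that, rule sym)
  have comp: "L x $ i $ m = - c (\<omega> i) $ m" for i m unfolding x by simp
  let ?a = "\<lambda>i \<mu>. x $ i $ \<mu>"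
  have "eps_wedge ?a i \<mu> \<nu> \<rho> + \<omega> i \<mu> \<nu> \<rho> = 0" for i \<mu> \<nu> \<rho>
  proof -
    have "alt3 (\<lambda>\<mu> \<nu> \<rho>. eps_wedge ?a i \<mu> \<nu> \<rho> + \<omega> i \<mu> \<nu> \<rho>)"
      unfolding alt3_def
    proof (intro allI)
      fix \<mu> \<nu> \<rho>
      from alt3_eps_wedge[of ?a i, unfolded alt3_def, THEN spec, THEN spec, THEN spec, of \<nu> \<mu> \<rho>]
        assms[of i, unfolded alt3_def, THEN spec, THEN spec, THEN spec, of \<nu> \<mu> \<rho>]
      show "eps_wedge ?a i \<nu> \<mu> \<rho> + \<omega> i \<nu> \<mu> \<rho> = - (eps_wedge ?a i \<mu> \<nu> \<rho> + \<omega> i \<mu> \<nu> \<rho>) \<and>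
        eps_wedge ?a i \<mu> \<rho> \<nu> + \<omega> i \<mu> \<rho> \<nu> = - (eps_wedge ?a i \<mu> \<nu> \<rho> + \<omega> i \<mu> \<nu> \<rho>)"
        by linarith
    qed
    then show ?thesis
      by (rule alt3_zero)
        (use comp[of i 1] comp[of i 2] comp[of i 3] comp[of i 4] in \<open>simp_all add: c L_def\<close>)
  qed
  then have "eps_wedge ?a = (\<lambda>i \<mu> \<nu> \<rho>. - \<omega> i \<mu> \<nu> \<rho>)"
    by (intro ext) (simp add: eq_neg_iff_add_eq_0)
  then show ?thesis by (rule that)
qed

text \<open>
  The two descriptions of \<open>d\<^sub>2\<close>, with \<open>\<omega>\<close> in the role of \<open>d\<sigma>\<close>: the unique solution of
  \<open>\<omega>\<^sup>i + \<epsilon>\<^sup>i\<^sup>j\<^sup>k a\<^sup>j \<and> \<Sigma>\<^sup>k = 0\<close>, and \<open>1/2 J\<^sub>1\<^sup>-\<^sup>1 (\<star>\<omega>)\<close>.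
\<close>

lemma half_inv_J1_star:
  assumes "\<And>i. alt3 (\<omega> i)"
  shows "eps_wedge b = (\<lambda>i \<mu> \<nu> \<rho>. - \<omega> i \<mu> \<nu> \<rho>) \<longleftrightarrow>
    b = (\<lambda>i \<mu>. 1/2 * inv (J1 G S) (\<lambda>j \<mu>. 1/3 * contract3 (vol_up \<mu>) (\<omega> j)) i \<mu>)"
    (is "?E b \<longleftrightarrow> b = ?b")
proof -
  have 1: "b = ?b" if b: "eps_wedge b = (\<lambda>i \<mu> \<nu> \<rho>. - \<omega> i \<mu> \<nu> \<rho>)" for b
  proof -
    have "contract3 (vol_up \<mu>) (\<omega> j) = - contract3 (vol_up \<mu>) (eps_wedge b j)" for j \<mu>
      unfolding b contract3_def by (simp add: sum_negf)
    then have c: "1/3 * contract3 (vol_up \<mu>) (\<omega> j) = 2 * J1 G S b j \<mu>" for j \<mu>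
      by (simp add: star_eps_wedge)
    show ?thesis unfolding c inv_J1 J1_scale J1_J1 by simp
  qed
  obtain a where a: "eps_wedge a = (\<lambda>i \<mu> \<nu> \<rho>. - \<omega> i \<mu> \<nu> \<rho>)" using eps_wedge_surj[OF assms] .
  show ?thesis using 1 a by metis
qed

end


section \<open>Quaternionic frames\<close>

lemma pull2_pull2: "pull2 Q (pull2 P T) = pull2 (\<lambda>\<alpha> \<nu>. \<Sum>\<mu>\<in>UNIV. P \<alpha> \<mu> * Q \<mu> \<nu>) T"
proof (intro ext)
  fix \<mu> \<nu>
  have "pull2 Q (pull2 P T) \<mu> \<nu> = (\<Sum>x\<in>UNIV. \<Sum>y\<in>UNIV. \<Sum>\<alpha>\<in>UNIV. \<Sum>\<beta>\<in>UNIV.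
      T \<alpha> \<beta> * (P \<alpha> x * Q x \<mu>) * (P \<beta> y * Q y \<nu>))"
    unfolding pull2_def sum_distrib_right by (simp only: mult_ac)
  also have "\<dots> = (\<Sum>x\<in>UNIV. \<Sum>\<alpha>\<in>UNIV. \<Sum>y\<in>UNIV. \<Sum>\<beta>\<in>UNIV. T \<alpha> \<beta> * (P \<alpha> x * Q x \<mu>) * (P \<beta> y * Q y \<nu>))"
    by (rule sum.cong[OF refl], rule sum.swap)
  also have "\<dots> = (\<Sum>\<alpha>\<in>UNIV. \<Sum>x\<in>UNIV. \<Sum>y\<in>UNIV. \<Sum>\<beta>\<in>UNIV. T \<alpha> \<beta> * (P \<alpha> x * Q x \<mu>) * (P \<beta> y * Q y \<nu>))"
    by (rule sum.swap)
  also have "\<dots> = (\<Sum>\<alpha>\<in>UNIV. \<Sum>x\<in>UNIV. \<Sum>\<beta>\<in>UNIV. \<Sum>y\<in>UNIV. T \<alpha> \<beta> * (P \<alpha> x * Q x \<mu>) * (P \<beta> y * Q y \<nu>))"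
    by (rule sum.cong[OF refl], rule sum.cong[OF refl], rule sum.swap)
  also have "\<dots> = (\<Sum>\<alpha>\<in>UNIV. \<Sum>\<beta>\<in>UNIV. \<Sum>x\<in>UNIV. \<Sum>y\<in>UNIV. T \<alpha> \<beta> * (P \<alpha> x * Q x \<mu>) * (P \<beta> y * Q y \<nu>))"
    by (rule sum.cong[OF refl], rule sum.swap)
  also have "\<dots> = pull2 (\<lambda>\<alpha> \<nu>. \<Sum>\<mu>\<in>UNIV. P \<alpha> \<mu> * Q \<mu> \<nu>) T \<mu> \<nu>"
    unfolding pull2_def
    by (simp only: sum_distrib_left sum_distrib_right)
       (rule sum.cong[OF refl], rule sum.cong[OF refl], rule sum.swap)
  finally show "pull2 Q (pull2 P T) \<mu> \<nu> = pull2 (\<lambda>\<alpha> \<nu>. \<Sum>\<mu>\<in>UNIV. P \<alpha> \<mu> * Q \<mu> \<nu>) T \<mu> \<nu>" .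
qed

lemma sum_kdelta [simp]:
  fixes f :: "'a::finite \<Rightarrow> real"
  shows "(\<Sum>\<alpha>\<in>UNIV. f \<alpha> * kdelta \<alpha> \<mu>) = f \<mu>" "(\<Sum>\<alpha>\<in>UNIV. f \<alpha> * kdelta \<mu> \<alpha>) = f \<mu>"
    "(\<Sum>\<alpha>\<in>UNIV. kdelta \<alpha> \<mu> * f \<alpha>) = f \<mu>" "(\<Sum>\<alpha>\<in>UNIV. kdelta \<mu> \<alpha> * f \<alpha>) = f \<mu>"
  by (simp_all add: kdelta_def if_distrib[where f = "\<lambda>x. _ * x"] if_distrib[where f = "\<lambda>x. x * _"] cong: if_cong)

lemma pull2_kdelta: "pull2 kdelta T = T"
  by (intro ext) (simp add: pull2_def)

lemma matrix_eq_kdelta: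
  "(\<Sum>k\<in>UNIV. A i k * B k j) = kdelta i j" if "\<And>i j. (\<Sum>k\<in>UNIV. B i k * A k j) = kdelta i j"
  for A B :: "4 \<Rightarrow> 4 \<Rightarrow> real"
proof -
  let ?A = "\<chi> i j. A i j" and ?B = "\<chi> i j. B i j"
  have "?B ** ?A = mat 1"
    using that unfolding matrix_matrix_mult_def mat_def vec_eq_iff by (simp add: kdelta_def)
  then have "?A ** ?B = mat 1" by (simp add: matrix_left_right_inverse)
  then have "(?A ** ?B) $ i $ j = mat 1 $ i $ j" by (rule arg_cong)
  then show ?thesis unfolding matrix_matrix_mult_def mat_def by (simp add: kdelta_def)
qed

text \<open>
  The triple in a quaternionic frame: \<open>e\<^sup>1\<^sup>2 - e\<^sup>3\<^sup>4\<close>, \<open>e\<^sup>1\<^sup>3 + e\<^sup>2\<^sup>4\<close> and \<open>e\<^sup>1\<^sup>4 - e\<^sup>2\<^sup>3\<close>.  The quaternion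
  relations as they are normalised here give such a frame the orientation opposite to \<open>v\<^sub>\<Sigma>\<close>, so that
  \<open>v\<^sub>\<Sigma> = - e\<^sup>1\<^sup>2\<^sup>3\<^sup>4\<close>.
\<close>

definition std :: "3 \<Rightarrow> 4 \<Rightarrow> 4 \<Rightarrow> real" where
  "std i \<mu> \<nu> =
     (if (i, \<mu>, \<nu>) \<in> {(1, 1, 2), (1, 4, 3), (2, 1, 3), (2, 2, 4), (3, 1, 4), (3, 3, 2)} then 1
      else if (i, \<nu>, \<mu>) \<in> {(1, 1, 2), (1, 4, 3), (2, 1, 3), (2, 2, 4), (3, 1, 4), (3, 3, 2)} then - 1
      else 0)"

lemma std_table [simp]:
  "std 1 1 1 = 0" "std 1 1 2 = 1" "std 1 1 3 = 0" "std 1 1 4 = 0"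
  "std 1 2 1 = -1" "std 1 2 2 = 0" "std 1 2 3 = 0" "std 1 2 4 = 0"
  "std 1 3 1 = 0" "std 1 3 2 = 0" "std 1 3 3 = 0" "std 1 3 4 = -1"
  "std 1 4 1 = 0" "std 1 4 2 = 0" "std 1 4 3 = 1" "std 1 4 4 = 0"
  "std 2 1 1 = 0" "std 2 1 2 = 0" "std 2 1 3 = 1" "std 2 1 4 = 0"
  "std 2 2 1 = 0" "std 2 2 2 = 0" "std 2 2 3 = 0" "std 2 2 4 = 1"
  "std 2 3 1 = -1" "std 2 3 2 = 0" "std 2 3 3 = 0" "std 2 3 4 = 0"
  "std 2 4 1 = 0" "std 2 4 2 = -1" "std 2 4 3 = 0" "std 2 4 4 = 0"
  "std 3 1 1 = 0" "std 3 1 2 = 0" "std 3 1 3 = 0" "std 3 1 4 = 1"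
  "std 3 2 1 = 0" "std 3 2 2 = 0" "std 3 2 3 = -1" "std 3 2 4 = 0"
  "std 3 3 1 = 0" "std 3 3 2 = 1" "std 3 3 3 = 0" "std 3 3 4 = 0"
  "std 3 4 1 = -1" "std 3 4 2 = 0" "std 3 4 3 = 0" "std 3 4 4 = 0"
  by (simp_all add: std_def)

context perfect_fibre begin

lemma G_inverse:
  "(\<Sum>k\<in>UNIV. inv_metric G i k * G k j) = kdelta i j"
  "(\<Sum>k\<in>UNIV. G i k * inv_metric G k j) = kdelta i j"
proof -
  let ?G = "\<chi> \<alpha> \<beta>. G \<alpha> \<beta>"
  have "x = 0" if "?G *v x = 0" for x
  proof (rule ccontr)
    assume "x \<noteq> 0"
    have "(\<Sum>\<mu>\<in>UNIV. \<Sum>\<nu>\<in>UNIV. G \<mu> \<nu> * x $ \<mu> * x $ \<nu>) = x \<bullet> (?G *v x)"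
      unfolding inner_vec_def matrix_vector_mult_def by (simp add: sum_distrib_left mult_ac)
    then show False using G_pos[OF \<open>x \<noteq> 0\<close>] that by simp
  qed
  then have inv: "invertible ?G"
    by (metis invertible_left_inverse matrix_left_invertible_ker)
  have "matrix_inv ?G ** ?G = mat 1" "?G ** matrix_inv ?G = mat 1"
    using someI_ex[OF inv[unfolded invertible_def]] unfolding matrix_inv_def by blast+
  then have "(matrix_inv ?G ** ?G) $ i $ j = mat 1 $ i $ j" "(?G ** matrix_inv ?G) $ i $ j = mat 1 $ i $ j"
    by simp_all
  then show "(\<Sum>k\<in>UNIV. inv_metric G i k * G k j) = kdelta i j"
    "(\<Sum>k\<in>UNIV. G i k * inv_metric G k j) = kdelta i j"
    unfolding matrix_matrix_mult_def mat_def inv_metric_def by (simp_all add: kdelta_def)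
qed

definition G_form :: "(4 \<Rightarrow> real) \<Rightarrow> (4 \<Rightarrow> real) \<Rightarrow> real" where
  "G_form x y = (\<Sum>\<alpha>\<in>UNIV. \<Sum>\<beta>\<in>UNIV. G \<alpha> \<beta> * x \<alpha> * y \<beta>)"

definition S_form :: "3 \<Rightarrow> (4 \<Rightarrow> real) \<Rightarrow> (4 \<Rightarrow> real) \<Rightarrow> real" where
  "S_form i x y = (\<Sum>\<alpha>\<in>UNIV. \<Sum>\<beta>\<in>UNIV. S i \<alpha> \<beta> * x \<alpha> * y \<beta>)"

text \<open>
  The transposes of the endomorphisms \<open>R\<close>, acting on vectors.
\<close>

definition rot :: "3 \<Rightarrow> (4 \<Rightarrow> real) \<Rightarrow> 4 \<Rightarrow> real" where
  "rot i x \<nu> = (\<Sum>\<mu>\<in>UNIV. x \<mu> * raise2 G (S i) \<mu> \<nu>)"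

lemma G_form_sym: "G_form x y = G_form y x"
  unfolding G_form_def by (subst sum.swap) (simp add: mult_ac G_sym)

lemma S_form_antisym: "S_form i x y = - S_form i y x"
proof -
  have "S_form i y x = (\<Sum>\<alpha>\<in>UNIV. \<Sum>\<beta>\<in>UNIV. S i \<beta> \<alpha> * y \<beta> * x \<alpha>)"
    unfolding S_form_def by (rule sum.swap)
  also have "\<dots> = (\<Sum>\<alpha>\<in>UNIV. \<Sum>\<beta>\<in>UNIV. - (S i \<alpha> \<beta> * x \<alpha> * y \<beta>))"
    by (rule sum.cong[OF refl], rule sum.cong[OF refl], subst S_antisym) (simp only: mult_ac mult_minus_left mult_minus_right)
  finally show ?thesis by (simp only: sum_negf S_form_def minus_minus)
qed

lemma raise2_lower: "(\<Sum>\<nu>\<in>UNIV. raise2 G (S i) \<mu> \<nu> * G \<nu> \<beta>) = S i \<mu> \<beta>"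
proof -
  have "(\<Sum>\<nu>\<in>UNIV. raise2 G (S i) \<mu> \<nu> * G \<nu> \<beta>)
      = (\<Sum>\<nu>\<in>UNIV. \<Sum>\<kappa>\<in>UNIV. S i \<mu> \<kappa> * (inv_metric G \<kappa> \<nu> * G \<nu> \<beta>))"
    unfolding raise2_def sum_distrib_right by (simp only: mult.assoc)
  also have "\<dots> = (\<Sum>\<kappa>\<in>UNIV. S i \<mu> \<kappa> * kdelta \<kappa> \<beta>)"
    by (subst sum.swap) (simp only: sum_distrib_left[symmetric] G_inverse)
  finally show ?thesis by simp
qed

lemma G_form_rot: "G_form (rot i x) y = S_form i x y"
proof -
  have "G_form (rot i x) y = (\<Sum>\<nu>\<in>UNIV. \<Sum>\<beta>\<in>UNIV. \<Sum>\<mu>\<in>UNIV. (x \<mu> * y \<beta>) * (raise2 G (S i) \<mu> \<nu> * G \<nu> \<beta>))"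
    unfolding G_form_def rot_def sum_distrib_left sum_distrib_right by (simp only: mult_ac)
  also have "\<dots> = (\<Sum>\<beta>\<in>UNIV. \<Sum>\<nu>\<in>UNIV. \<Sum>\<mu>\<in>UNIV. (x \<mu> * y \<beta>) * (raise2 G (S i) \<mu> \<nu> * G \<nu> \<beta>))"
    by (rule sum.swap)
  also have "\<dots> = (\<Sum>\<beta>\<in>UNIV. \<Sum>\<mu>\<in>UNIV. \<Sum>\<nu>\<in>UNIV. (x \<mu> * y \<beta>) * (raise2 G (S i) \<mu> \<nu> * G \<nu> \<beta>))"
    by (rule sum.cong[OF refl], rule sum.swap)
  also have "\<dots> = (\<Sum>\<beta>\<in>UNIV. \<Sum>\<mu>\<in>UNIV. S i \<mu> \<beta> * x \<mu> * y \<beta>)"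
    by (simp only: sum_distrib_left[symmetric] raise2_lower) (simp only: mult_ac)
  also have "\<dots> = S_form i x y" unfolding S_form_def by (rule sum.swap)
  finally show ?thesis .
qed

lemma rot_rot: "rot i (rot j x) \<nu> = - kdelta i j * x \<nu> - (\<Sum>k\<in>UNIV. eps3 i j k * rot k x \<nu>)"
proof -
  have "rot i (rot j x) \<nu> = (\<Sum>\<alpha>\<in>UNIV. \<Sum>\<mu>\<in>UNIV. x \<mu> * (raise2 G (S j) \<mu> \<alpha> * raise2 G (S i) \<alpha> \<nu>))"
    unfolding rot_def sum_distrib_right by (simp only: mult_ac)
  also have "\<dots> = (\<Sum>\<mu>\<in>UNIV. x \<mu> * (- kdelta j i * kdelta \<mu> \<nu> + (\<Sum>k\<in>UNIV. eps3 j i k * raise2 G (S k) \<mu> \<nu>)))"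
    by (subst sum.swap) (simp only: sum_distrib_left[symmetric] quaternion)
  also have "\<dots> = (\<Sum>\<mu>\<in>UNIV. (- kdelta j i * x \<mu>) * kdelta \<mu> \<nu>) + (\<Sum>\<mu>\<in>UNIV. \<Sum>k\<in>UNIV. eps3 j i k * (x \<mu> * raise2 G (S k) \<mu> \<nu>))"
    by (simp only: distrib_left sum.distrib sum_distrib_left mult_ac)
  also have "(\<Sum>\<mu>\<in>UNIV. \<Sum>k\<in>UNIV. eps3 j i k * (x \<mu> * raise2 G (S k) \<mu> \<nu>)) = (\<Sum>k\<in>UNIV. eps3 j i k * rot k x \<nu>)"
    unfolding rot_def sum_distrib_left by (rule sum.swap)
  also have "(\<Sum>\<mu>\<in>UNIV. (- kdelta j i * x \<mu>) * kdelta \<mu> \<nu>) = - kdelta i j * x \<nu>"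
    by (simp only: sum_kdelta kdelta_commute[of j i])
  also have "(\<Sum>k\<in>UNIV. eps3 j i k * rot k x \<nu>) = - (\<Sum>k\<in>UNIV. eps3 i j k * rot k x \<nu>)"
  proof -
    have "eps3 j i k = - eps3 i j k" for k by (auto simp: eps3_def)
    then show ?thesis by (simp only: sum_negf mult_minus_left)
  qed
  finally show ?thesis by (simp only: diff_conv_add_uminus)
qed

lemma S_form_rot: "S_form i (rot j x) y = - kdelta i j * G_form x y - (\<Sum>k\<in>UNIV. eps3 i j k * S_form k x y)"
proof -
  have lin: "G_form (\<lambda>\<nu>. a * x \<nu> - (\<Sum>k\<in>UNIV. c k * z k \<nu>)) y = a * G_form x y - (\<Sum>k\<in>UNIV. c k * G_form (z k) y)"
    for a and c :: "3 \<Rightarrow> real" and z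
    unfolding G_form_def sum_3
    by (simp add: algebra_simps sum.distrib sum_subtractf sum_distrib_left)
  have "S_form i (rot j x) y = G_form (rot i (rot j x)) y" by (rule G_form_rot[symmetric])
  also have "rot i (rot j x) = (\<lambda>\<nu>. - kdelta i j * x \<nu> - (\<Sum>k\<in>UNIV. eps3 i j k * rot k x \<nu>))"
    by (intro ext rot_rot)
  finally show ?thesis unfolding lin G_form_rot .
qed

text \<open>
  A \<open>G\<close>-unit vector \<open>e\<close> together with its images under the three complex structures is an orthonormal
  frame; the quaternion relations alone then fix the components of the triple.
\<close>

lemma quaternionic_frame_exists:
  obtains P :: "4 \<Rightarrow> 4 \<Rightarrow> real" where "pull2 P G = kdelta" "\<And>i. pull2 P (S i) = std i"
proof -
  let ?a = "($) (axis 1 1 :: real^4)"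
  have "G_form ?a ?a > 0" unfolding G_form_def using G_pos[of "axis 1 1"] by (simp add: axis_eq_0_iff)
  define e where "e \<mu> = (1 / sqrt (G_form ?a ?a)) * ?a \<mu>" for \<mu>
  have "G_form e e = (1 / sqrt (G_form ?a ?a))^2 * G_form ?a ?a"
    unfolding G_form_def e_def sum_distrib_left power2_eq_square by (simp only: mult_ac)
  then have e: "G_form e e = 1" using \<open>G_form ?a ?a > 0\<close> by (simp add: power_divide)
  have s0: "S_form k e e = 0" for k using S_form_antisym[of k e e] by simp
  define f where "f \<mu> = (if \<mu> = 1 then e else if \<mu> = 2 then rot 1 e else if \<mu> = 3 then rot 2 e else rot 3 e)"
    for \<mu> :: 4
  have f: "f 1 = e" "f 2 = rot 1 e" "f 3 = rot 2 e" "f 4 = rot 3 e" by (simp_all add: f_def)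
  define P where "P \<alpha> \<mu> = f \<mu> \<alpha>" for \<alpha> \<mu>
  have s1: "S_form k e (rot j e) = kdelta k j" for k j
    unfolding S_form_antisym[of k e "rot j e"] S_form_rot by (simp add: e s0)
  have g1: "G_form e (rot j e) = 0" for j unfolding G_form_sym[of e] G_form_rot by (rule s0)
  have "\<forall>\<mu> \<nu>. G_form (f \<mu>) (f \<nu>) = kdelta \<mu> \<nu>"
    unfolding forall_4 f G_form_rot e s0 s1 g1 by simp
  moreover have "pull2 P G \<mu> \<nu> = G_form (f \<mu>) (f \<nu>)" for \<mu> \<nu>
    unfolding pull2_def G_form_def P_def ..
  ultimately have "pull2 P G = kdelta" by (intro ext) simp
  moreover have "\<forall>i \<mu> \<nu>. S_form i (f \<mu>) (f \<nu>) = std i \<mu> \<nu>"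
    unfolding forall_4 forall_3 f S_form_rot e s0 s1 g1 sum_3 by simp
  moreover have "pull2 P (S i) \<mu> \<nu> = S_form i (f \<mu>) (f \<nu>)" for i \<mu> \<nu>
    unfolding pull2_def S_form_def P_def ..
  ultimately show thesis using that[of P] by (simp add: fun_eq_iff)
qed

end


section \<open>The fibre of \<open>S\<close> in a quaternionic frame\<close>

lemma pull2_contract_right:
  assumes "\<And>b \<kappa>. (\<Sum>\<beta>\<in>UNIV. Q b \<beta> * P \<beta> \<kappa>) = kdelta b \<kappa>"
  shows "(\<Sum>\<beta>\<in>UNIV. pull2 Q H \<mu> \<beta> * P \<beta> \<kappa>) = (\<Sum>a\<in>UNIV. H a \<kappa> * Q a \<mu>)"
proof -
  have "(\<Sum>\<beta>\<in>UNIV. pull2 Q H \<mu> \<beta> * P \<beta> \<kappa>)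
      = (\<Sum>\<beta>\<in>UNIV. \<Sum>a\<in>UNIV. \<Sum>b\<in>UNIV. (H a b * Q a \<mu>) * (Q b \<beta> * P \<beta> \<kappa>))"
    unfolding pull2_def sum_distrib_right by (simp only: mult_ac)
  also have "\<dots> = (\<Sum>a\<in>UNIV. \<Sum>\<beta>\<in>UNIV. \<Sum>b\<in>UNIV. (H a b * Q a \<mu>) * (Q b \<beta> * P \<beta> \<kappa>))"
    by (rule sum.swap)
  also have "\<dots> = (\<Sum>a\<in>UNIV. \<Sum>b\<in>UNIV. \<Sum>\<beta>\<in>UNIV. (H a b * Q a \<mu>) * (Q b \<beta> * P \<beta> \<kappa>))"
    by (rule sum.cong[OF refl], rule sum.swap)
  also have "\<dots> = (\<Sum>a\<in>UNIV. \<Sum>b\<in>UNIV. (H a b * Q a \<mu>) * kdelta b \<kappa>)"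
    by (simp only: sum_distrib_left[symmetric] assms)
  finally show ?thesis by simp
qed

lemma pull2_contract_left:
  assumes "\<And>b \<kappa>. (\<Sum>\<beta>\<in>UNIV. Q b \<beta> * P \<beta> \<kappa>) = kdelta b \<kappa>"
  shows "(\<Sum>\<beta>\<in>UNIV. P \<beta> \<kappa> * pull2 Q H \<beta> \<nu>) = (\<Sum>b\<in>UNIV. H \<kappa> b * Q b \<nu>)"
proof -
  have "(\<Sum>\<beta>\<in>UNIV. P \<beta> \<kappa> * pull2 Q H \<beta> \<nu>)
      = (\<Sum>\<beta>\<in>UNIV. \<Sum>a\<in>UNIV. \<Sum>b\<in>UNIV. (H a b * Q b \<nu>) * (Q a \<beta> * P \<beta> \<kappa>))"
    unfolding pull2_def sum_distrib_left by (simp only: mult_ac)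
  also have "\<dots> = (\<Sum>\<beta>\<in>UNIV. \<Sum>b\<in>UNIV. \<Sum>a\<in>UNIV. (H a b * Q b \<nu>) * (Q a \<beta> * P \<beta> \<kappa>))"
    by (rule sum.cong[OF refl], rule sum.swap)
  also have "\<dots> = (\<Sum>b\<in>UNIV. \<Sum>\<beta>\<in>UNIV. \<Sum>a\<in>UNIV. (H a b * Q b \<nu>) * (Q a \<beta> * P \<beta> \<kappa>))"
    by (rule sum.swap)
  also have "\<dots> = (\<Sum>b\<in>UNIV. \<Sum>a\<in>UNIV. \<Sum>\<beta>\<in>UNIV. (H a b * Q b \<nu>) * (Q a \<beta> * P \<beta> \<kappa>))"
    by (rule sum.cong[OF refl], rule sum.swap)
  also have "\<dots> = (\<Sum>b\<in>UNIV. \<Sum>a\<in>UNIV. (H a b * Q b \<nu>) * kdelta a \<kappa>)"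
    by (simp only: sum_distrib_left[symmetric] assms)
  finally show ?thesis by simp
qed

lemma pull2_linear:
  "pull2 Q (\<lambda>\<mu> \<nu>. X \<mu> \<nu> + Y \<mu> \<nu>) \<mu> \<nu> = pull2 Q X \<mu> \<nu> + pull2 Q Y \<mu> \<nu>"
  "pull2 Q (\<lambda>\<mu> \<nu>. X \<mu> \<nu> - Y \<mu> \<nu>) \<mu> \<nu> = pull2 Q X \<mu> \<nu> - pull2 Q Y \<mu> \<nu>"
  "pull2 Q (\<lambda>\<mu> \<nu>. c * X \<mu> \<nu>) \<mu> \<nu> = c * pull2 Q X \<mu> \<nu>"
  "pull2 Q (\<lambda>\<mu> \<nu>. - X \<mu> \<nu>) \<mu> \<nu> = - pull2 Q X \<mu> \<nu>"
  unfolding pull2_def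
  by (simp_all add: algebra_simps sum.distrib sum_subtractf sum_distrib_left sum_negf)

lemma pull2_transpose: "pull2 Q (\<lambda>\<mu> \<nu>. X \<nu> \<mu>) \<mu> \<nu> = pull2 Q X \<nu> \<mu>"
  unfolding pull2_def by (subst sum.swap) (simp only: mult_ac)

lemma pull2_sum:
  fixes X :: "3 \<Rightarrow> 4 \<Rightarrow> 4 \<Rightarrow> real"
  shows "pull2 Q (\<lambda>\<mu> \<nu>. \<Sum>j\<in>UNIV. X j \<mu> \<nu>) \<mu> \<nu> = (\<Sum>j\<in>UNIV. pull2 Q (X j) \<mu> \<nu>)"
  unfolding sum_3 by (simp only: pull2_linear)

text \<open>
  \<^const>\<open>h_action\<close> in an orthonormal frame for the standard triple; \<open>sstd\<close> below plays the same
  role for \<^const>\<open>S_param\<close>.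
\<close>

definition hstd :: "(4 \<Rightarrow> 4 \<Rightarrow> real) \<Rightarrow> 3 \<Rightarrow> 4 \<Rightarrow> 4 \<Rightarrow> real" where
  "hstd H i \<mu> \<nu> = 1/2 * ((\<Sum>\<alpha>\<in>UNIV. H \<mu> \<alpha> * std i \<alpha> \<nu>) - (\<Sum>\<alpha>\<in>UNIV. H \<nu> \<alpha> * std i \<alpha> \<mu>))"

definition sstd :: "(3 \<Rightarrow> real) \<Rightarrow> (4 \<Rightarrow> 4 \<Rightarrow> real) \<Rightarrow> 3 \<Rightarrow> 4 \<Rightarrow> 4 \<Rightarrow> real" where
  "sstd u H i \<mu> \<nu> = 2 * (\<Sum>j\<in>UNIV. \<Sum>k\<in>UNIV. eps3 i j k * std j \<mu> \<nu> * u k) + 2 * hstd H i \<mu> \<nu>"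

lemma std_antisym: "std i \<mu> \<nu> = - std i \<nu> \<mu>"
proof -
  have "\<forall>i \<mu> \<nu>. std i \<mu> \<nu> = - std i \<nu> \<mu>" unfolding forall_3 forall_4 by simp
  then show ?thesis by blast
qed

lemma hstd_antisym: "hstd H i \<mu> \<nu> = - hstd H i \<nu> \<mu>"
  unfolding hstd_def by (simp add: field_simps)

lemma sstd_eq:
  "sstd u H i \<mu> \<nu> = 2 * (\<Sum>j\<in>UNIV. \<Sum>k\<in>UNIV. eps3 i j k * std j \<mu> \<nu> * u k)
    + ((\<Sum>\<alpha>\<in>UNIV. H \<mu> \<alpha> * std i \<alpha> \<nu>) - (\<Sum>\<alpha>\<in>UNIV. H \<nu> \<alpha> * std i \<alpha> \<mu>))"
  unfolding sstd_def hstd_def by simp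

lemma sstd_antisym: "sstd u H i \<mu> \<nu> = - sstd u H i \<nu> \<mu>"
  unfolding sstd_def using std_antisym[of _ \<mu> \<nu>] hstd_antisym[of H i \<mu> \<nu>]
  by (simp add: sum_3)

lemma wedge_sstd_std:
  assumes "\<And>\<mu> \<nu>. H \<mu> \<nu> = H \<nu> \<mu>"
  shows "wedge22 (sstd u H i) (std j) 1 2 3 4
    = - ((\<Sum>\<mu>\<in>UNIV. H \<mu> \<mu>) * kdelta i j + 4 * (\<Sum>k\<in>UNIV. eps3 i j k * u k))"
proof -
  have H: "H 2 1 = H 1 2" "H 3 1 = H 1 3" "H 4 1 = H 1 4" "H 3 2 = H 2 3" "H 4 2 = H 2 4" "H 4 3 = H 3 4"
    using assms by blast+
  have "\<forall>i j. wedge22 (sstd u H i) (std j) 1 2 3 4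
    = - ((\<Sum>\<mu>\<in>UNIV. H \<mu> \<mu>) * kdelta i j + 4 * (\<Sum>k\<in>UNIV. eps3 i j k * u k))"
    unfolding forall_3 wedge22_def sstd_eq sum_3 sum_4 by (simp add: H)
  then show ?thesis by blast
qed

lemma wedge_sstd_sstd:
  assumes "\<And>\<mu> \<nu>. H \<mu> \<nu> = H \<nu> \<mu>"
  shows "(\<Sum>i\<in>UNIV. wedge22 (sstd u H i) (sstd u H i) 1 2 3 4)
    = - (2 * (\<Sum>\<mu>\<in>UNIV. H \<mu> \<mu>)^2 + 16 * (\<Sum>k\<in>UNIV. (u k)^2) - 2 * (\<Sum>\<mu>\<in>UNIV. \<Sum>\<nu>\<in>UNIV. (H \<mu> \<nu>)^2))"
proof -
  have H: "H 2 1 = H 1 2" "H 3 1 = H 1 3" "H 4 1 = H 1 4" "H 3 2 = H 2 3" "H 4 2 = H 2 4" "H 4 3 = H 3 4"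
    using assms by blast+
  show ?thesis
    unfolding wedge22_def sstd_eq sum_3 sum_4
    by (simp add: H) (simp add: power2_eq_square algebra_simps)
qed

text \<open>
  The antisymmetric part of \<open>H\<close> acts on the triple by a commutator.  Its anti-self-dual part commutes
  with the triple and drops out; \<open>2 u\<close> is its self-dual part.
\<close>

lemma hstd_eq_sstd:
  obtains u where "hstd H = sstd u (\<lambda>\<mu> \<nu>. (H \<mu> \<nu> + H \<nu> \<mu>) / 4)"
proof -
  define u :: "3 \<Rightarrow> real" where "u k = (if k = 1 then (H 1 2 - H 2 1 - H 3 4 + H 4 3) / 8
     else if k = 2 then (H 1 3 - H 3 1 + H 2 4 - H 4 2) / 8 else (H 1 4 - H 4 1 - H 2 3 + H 3 2) / 8)" for k
  have u: "u 1 = (H 1 2 - H 2 1 - H 3 4 + H 4 3) / 8" "u 2 = (H 1 3 - H 3 1 + H 2 4 - H 4 2) / 8"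
    "u 3 = (H 1 4 - H 4 1 - H 2 3 + H 3 2) / 8" by (simp_all add: u_def)
  have "\<forall>i \<mu> \<nu>. hstd H i \<mu> \<nu> = sstd u (\<lambda>\<mu> \<nu>. (H \<mu> \<nu> + H \<nu> \<mu>) / 4) i \<mu> \<nu>"
    unfolding forall_3 forall_4 sstd_def hstd_def sum_3 sum_4 by (simp add: u field_simps)
  then show thesis by (intro that[of u] ext) blast
qed

text \<open>
  The coefficients of the self-dual part of \<open>f\<close> with respect to the standard triple; the sign is that of
  \<open>v\<^sub>\<Sigma> = - e\<^sup>1\<^sup>2\<^sup>3\<^sup>4\<close>.
\<close>

definition psi_std :: "(3 \<Rightarrow> 4 \<Rightarrow> 4 \<Rightarrow> real) \<Rightarrow> 3 \<Rightarrow> 3 \<Rightarrow> real" where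
  "psi_std f i j = - wedge22 (f i) (std j) 1 2 3 4 / 2"

text \<open>
  Split \<open>F\<^sup>i = \<psi>\<^sup>i\<^sup>j \<Sigma>\<^sup>j + N\<^sup>i\<close> with \<open>N\<^sup>i\<close> anti-self-dual.  The obstruction to \<open>F\<close> being a symmetric
  tracefree combination of the triple consists of \<open>N\<close>, the antisymmetric part and the trace part of \<open>\<psi>\<close>,
  and all three lie in \<open>E \<otimes> \<Lambda>\<^sup>2\<close> inside \<open>S\<close>.  The wedge pairing is negative on \<open>N\<close> and positive on the
  other two, so the test element is
  \<open>T = \<psi>\<^bsub>antisym\<^esub> \<Sigma> + \<psi>\<^bsub>trace\<^esub> \<Sigma> - N\<close>, that is, \<open>T = (\<psi> + \<psi>\<^bsub>antisym\<^esub> + \<psi>\<^bsub>trace\<^esub>) \<Sigma> - F\<close>; the function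
  below is this coefficient of \<open>\<Sigma>\<close>.
\<close>

definition test_coeff :: "(3 \<Rightarrow> 3 \<Rightarrow> real) \<Rightarrow> 3 \<Rightarrow> 3 \<Rightarrow> real" where
  "test_coeff \<psi> i j = \<psi> i j + (\<psi> i j - \<psi> j i) / 2 + kdelta i j * (\<Sum>k\<in>UNIV. \<psi> k k) / 3"

definition test_std :: "(3 \<Rightarrow> 4 \<Rightarrow> 4 \<Rightarrow> real) \<Rightarrow> 3 \<Rightarrow> 4 \<Rightarrow> 4 \<Rightarrow> real" where
  "test_std f i \<mu> \<nu> = (\<Sum>j\<in>UNIV. test_coeff (psi_std f) i j * std j \<mu> \<nu>) - f i \<mu> \<nu>"

lemma psi_std_table:
  assumes "\<And>i \<mu> \<nu>. f i \<mu> \<nu> = - f i \<nu> \<mu>"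
  shows "psi_std f i 1 = (f i 1 2 - f i 3 4) / 2" "psi_std f i 2 = (f i 1 3 + f i 2 4) / 2"
    "psi_std f i 3 = (f i 1 4 - f i 2 3) / 2"
  unfolding psi_std_def wedge22_def by simp_all

lemma
  assumes f: "\<And>i \<mu> \<nu>. f i \<mu> \<nu> = - f i \<nu> \<mu>"
  shows test_std_in_range: "\<exists>H. test_std f = hstd H"
    and test_std_pairing: "- (\<Sum>i\<in>UNIV. wedge22 (test_std f i) (f i) 1 2 3 4) =
       (\<Sum>i\<in>UNIV. ((f i 1 2 + f i 3 4)^2 + (f i 1 3 - f i 2 4)^2 + (f i 1 4 + f i 2 3)^2) / 2)
       + (\<Sum>i\<in>UNIV. \<Sum>j\<in>UNIV. (psi_std f i j - psi_std f j i)^2) / 2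
       + 2/3 * (\<Sum>k\<in>UNIV. psi_std f k k)^2"
proof -
  have F: "f i 2 1 = - f i 1 2" "f i 3 1 = - f i 1 3" "f i 4 1 = - f i 1 4" "f i 3 2 = - f i 2 3"
    "f i 4 2 = - f i 2 4" "f i 4 3 = - f i 3 4" for i using f by blast+
  have F0: "f i \<mu> \<mu> = 0" for i \<mu> using f[of i \<mu> \<mu>] by simp
  note psi = psi_std_table[OF f]
  define m where "m i \<mu> \<nu> = f i \<mu> \<nu> - (\<Sum>j\<in>UNIV. psi_std f i j * std j \<mu> \<nu>)" for i \<mu> \<nu>
  define x :: "3 \<Rightarrow> real" where "x k = (if k = 1 then (psi_std f 2 3 - psi_std f 3 2) / 2
     else if k = 2 then (psi_std f 3 1 - psi_std f 1 3) / 2 else (psi_std f 1 2 - psi_std f 2 1) / 2)" for k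
  have x: "x 1 = (psi_std f 2 3 - psi_std f 3 2) / 2" "x 2 = (psi_std f 3 1 - psi_std f 1 3) / 2"
    "x 3 = (psi_std f 1 2 - psi_std f 2 1) / 2" by (simp_all add: x_def)
  \<comment> \<open>The three summands produce the anti-self-dual, the trace and the antisymmetric part of the test element.\<close>
  define H where "H \<mu> \<nu> = (\<Sum>i\<in>UNIV. \<Sum>\<alpha>\<in>UNIV. m i \<mu> \<alpha> * std i \<alpha> \<nu>)
     + kdelta \<mu> \<nu> * (\<Sum>k\<in>UNIV. psi_std f k k) / 3 + (\<Sum>k\<in>UNIV. x k * std k \<mu> \<nu>)" for \<mu> \<nu>
  have elim: "f i 3 4 = f i 1 2 - 2 * psi_std f i 1" "f i 2 4 = 2 * psi_std f i 2 - f i 1 3"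
    "f i 2 3 = f i 1 4 - 2 * psi_std f i 3" for i
    unfolding psi by (simp_all add: field_simps)
  have "\<forall>i \<mu> \<nu>. test_std f i \<mu> \<nu> = hstd H i \<mu> \<nu>"
    unfolding forall_3 forall_4 test_std_def test_coeff_def hstd_def H_def m_def sum_3 sum_4
    by (simp add: x F F0 elim) (simp add: field_simps)
  then show "\<exists>H. test_std f = hstd H" by (intro exI[of _ H] ext) blast
  have 1: "wedge22 (std j) (f i) 1 2 3 4 = - 2 * psi_std f i j" for i j
    unfolding psi_std_def wedge22_def by simp
  have 2: "wedge22 (test_std f i) (f i) 1 2 3 4
      = - 2 * (\<Sum>j\<in>UNIV. test_coeff (psi_std f) i j * psi_std f i j) - wedge22 (f i) (f i) 1 2 3 4" for i
  proof -
    have "wedge22 (test_std f i) (f i) 1 2 3 4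
      = (\<Sum>j\<in>UNIV. test_coeff (psi_std f) i j * wedge22 (std j) (f i) 1 2 3 4) - wedge22 (f i) (f i) 1 2 3 4"
      unfolding test_std_def wedge22_def sum_3 by (simp add: algebra_simps)
    then show ?thesis unfolding 1 by (simp add: sum_3 algebra_simps)
  qed
  have 3: "wedge22 (f i) (f i) 1 2 3 4 =
    ((f i 1 2 + f i 3 4)^2 + (f i 1 3 - f i 2 4)^2 + (f i 1 4 + f i 2 3)^2) / 2 - 2 * (\<Sum>j\<in>UNIV. (psi_std f i j)^2)" for i
    unfolding wedge22_def elim sum_3 by (simp add: power2_eq_square algebra_simps)
  show "- (\<Sum>i\<in>UNIV. wedge22 (test_std f i) (f i) 1 2 3 4) =
       (\<Sum>i\<in>UNIV. ((f i 1 2 + f i 3 4)^2 + (f i 1 3 - f i 2 4)^2 + (f i 1 4 + f i 2 3)^2) / 2)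
       + (\<Sum>i\<in>UNIV. \<Sum>j\<in>UNIV. (psi_std f i j - psi_std f j i)^2) / 2
       + 2/3 * (\<Sum>k\<in>UNIV. psi_std f k k)^2"
    unfolding 2 3 test_coeff_def sum_3
    by (simp add: field_simps power2_eq_square)
qed


section \<open>The wedge pairing on the fibre of \<open>S\<close>\<close>

lemma wedge22_wedge11:
  assumes "\<And>\<mu> \<nu>. s \<mu> \<nu> = - s \<nu> \<mu>"
  shows "wedge22 s (wedge11 b a) 1 2 3 4 =
    wedge12 b s 1 2 3 * a 4 - wedge12 b s 1 2 4 * a 3 + wedge12 b s 1 3 4 * a 2 - wedge12 b s 2 3 4 * a 1"
proof -
  have s: "s 2 1 = - s 1 2" "s 3 1 = - s 1 3" "s 4 1 = - s 1 4" "s 3 2 = - s 2 3"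
    "s 4 2 = - s 2 4" "s 4 3 = - s 3 4" using assms by blast+
  show ?thesis unfolding wedge22_def wedge11_def wedge12_def by (simp add: s algebra_simps)
qed

lemma wedge22_sum_right:
  fixes X :: "3 \<Rightarrow> 4 \<Rightarrow> 4 \<Rightarrow> real"
  shows "wedge22 s (\<lambda>\<mu> \<nu>. \<Sum>j\<in>UNIV. c j * X j \<mu> \<nu>) \<mu> \<nu> \<rho> \<tau> = (\<Sum>j\<in>UNIV. c j * wedge22 s (X j) \<mu> \<nu> \<rho> \<tau>)"
  unfolding wedge22_def sum_3 by (simp add: algebra_simps)

text \<open>
  The function \<open>f\<close> with \<open>s \<and> t = f V\<close>.  Every scalar of the proof is built from such quotients, since they
  do not depend on the chart and are manifestly smooth.
\<close>

definition wedge_ratio ::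
  "(4 \<Rightarrow> 4 \<Rightarrow> 4 \<Rightarrow> 4 \<Rightarrow> real) \<Rightarrow> (4 \<Rightarrow> 4 \<Rightarrow> real) \<Rightarrow> (4 \<Rightarrow> 4 \<Rightarrow> real) \<Rightarrow> real" where
  "wedge_ratio V s t = wedge22 s t 1 2 3 4 / V 1 2 3 4"

text \<open>
  The square \<open>\<beta>\<^sub>1 h\<^sup>2 + \<beta>\<^sub>2 (h\<^sup>i)\<^sup>2 + \<beta>\<^sub>3 h~\<^sup>2\<close> of \<open>s \<in> S\<close> in terms of \<open>s\<^sup>i \<and> \<Sigma>\<^sup>j = m\<^sup>i\<^sup>j v\<^sub>\<Sigma>\<close> and
  \<open>s\<^sup>i \<and> s\<^sup>i = q v\<^sub>\<Sigma>\<close>: the pairings \<open>m\<^sup>i\<^sup>j = h \<delta>\<^sup>i\<^sup>j + 4 \<epsilon>\<^sup>i\<^sup>j\<^sup>k h\<^sup>k\<close> determine \<open>h\<close> and \<open>h\<^sup>i\<close>, and \<open>q\<close> then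
  determines \<open>h~\<^sup>2\<close>.  Written this way the square is visibly smooth and independent of charts.
\<close>

definition S_norm :: "real \<Rightarrow> real \<Rightarrow> real \<Rightarrow> (3 \<Rightarrow> 3 \<Rightarrow> real) \<Rightarrow> real \<Rightarrow> real" where
  "S_norm \<beta>1 \<beta>2 \<beta>3 m q = (let t = (m 1 1 + m 2 2 + m 3 3) / 3; uu = ((m 2 3)^2 + (m 3 1)^2 + (m 1 2)^2) / 16 in
     \<beta>1 * t^2 + \<beta>2 * uu + \<beta>3 * ((2 * t^2 + 16 * uu - q) / 2 - t^2 / 4))"

context perfect_fibre begin

abbreviation W :: "(4 \<Rightarrow> 4 \<Rightarrow> real) \<Rightarrow> (4 \<Rightarrow> 4 \<Rightarrow> real) \<Rightarrow> real" where
  "W \<equiv> wedge_ratio v"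

lemma frame_exists:
  obtains P Q :: "4 \<Rightarrow> 4 \<Rightarrow> real" where
    "\<And>b \<kappa>. (\<Sum>\<beta>\<in>UNIV. Q b \<beta> * P \<beta> \<kappa>) = kdelta b \<kappa>"
    "\<And>b \<kappa>. (\<Sum>\<beta>\<in>UNIV. P b \<beta> * Q \<beta> \<kappa>) = kdelta b \<kappa>"
    "G = pull2 Q kdelta" "\<And>i. S i = pull2 Q (std i)"
    "\<And>\<alpha> \<beta>. inv_metric G \<alpha> \<beta> = (\<Sum>\<kappa>\<in>UNIV. P \<alpha> \<kappa> * P \<beta> \<kappa>)"
proof -
  obtain P where P: "pull2 P G = kdelta" "\<And>i. pull2 P (S i) = std i"
    by (rule quaternionic_frame_exists) (rule that)
  define Q where "Q \<mu> \<alpha> = (\<Sum>\<beta>\<in>UNIV. P \<beta> \<mu> * G \<beta> \<alpha>)" for \<mu> \<alpha>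
  have QP: "(\<Sum>\<alpha>\<in>UNIV. Q \<mu> \<alpha> * P \<alpha> \<nu>) = kdelta \<mu> \<nu>" for \<mu> \<nu>
  proof -
    have "(\<Sum>\<alpha>\<in>UNIV. Q \<mu> \<alpha> * P \<alpha> \<nu>) = pull2 P G \<mu> \<nu>"
      unfolding Q_def pull2_def sum_distrib_right by (subst sum.swap) (simp only: mult_ac)
    then show ?thesis by (simp only: P)
  qed
  have PQ: "(\<Sum>\<beta>\<in>UNIV. P b \<beta> * Q \<beta> \<kappa>) = kdelta b \<kappa>" for b \<kappa>
    by (rule matrix_eq_kdelta[OF QP])
  have PQ_id: "pull2 Q (pull2 P T) = T" for T
    unfolding pull2_pull2 PQ by (rule pull2_kdelta)
  have I: "inv_metric G \<alpha> \<beta> = (\<Sum>\<kappa>\<in>UNIV. P \<alpha> \<kappa> * P \<beta> \<kappa>)" for \<alpha> \<beta>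
  proof -
    have 1: "kdelta \<alpha> \<gamma> = (\<Sum>\<delta>\<in>UNIV. (\<Sum>\<kappa>\<in>UNIV. P \<alpha> \<kappa> * P \<delta> \<kappa>) * G \<delta> \<gamma>)" for \<gamma>
      unfolding PQ[symmetric] Q_def sum_distrib_left sum_distrib_right
      by (subst sum.swap) (simp only: mult_ac)
    have "inv_metric G \<alpha> \<beta> = (\<Sum>\<gamma>\<in>UNIV. kdelta \<alpha> \<gamma> * inv_metric G \<gamma> \<beta>)" by simp
    also have "\<dots> = (\<Sum>\<gamma>\<in>UNIV. \<Sum>\<delta>\<in>UNIV. (\<Sum>\<kappa>\<in>UNIV. P \<alpha> \<kappa> * P \<delta> \<kappa>) * (G \<delta> \<gamma> * inv_metric G \<gamma> \<beta>))"
      unfolding 1 sum_distrib_right[of _ UNIV "inv_metric G _ _"] by (simp only: mult.assoc)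
    also have "\<dots> = (\<Sum>\<delta>\<in>UNIV. (\<Sum>\<kappa>\<in>UNIV. P \<alpha> \<kappa> * P \<delta> \<kappa>) * kdelta \<delta> \<beta>)"
      by (subst sum.swap) (simp only: sum_distrib_left[symmetric] G_inverse)
    finally show ?thesis by simp
  qed
  show thesis
    by (rule that[OF QP PQ _ _ I]) (simp_all only: P(1)[symmetric] P(2)[symmetric] PQ_id)
qed

lemma h_action_pull2:
  assumes QP: "\<And>b \<kappa>. (\<Sum>\<beta>\<in>UNIV. Q b \<beta> * P \<beta> \<kappa>) = kdelta b \<kappa>"
    and S: "\<And>i. S i = pull2 Q (std i)"
    and I: "\<And>\<alpha> \<beta>. inv_metric G \<alpha> \<beta> = (\<Sum>\<kappa>\<in>UNIV. P \<alpha> \<kappa> * P \<beta> \<kappa>)"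
  shows "h_action G S (pull2 Q H) i = pull2 Q (hstd H i)"
proof -
  define K where "K \<mu> \<nu> = (\<Sum>\<kappa>\<in>UNIV. H \<mu> \<kappa> * std i \<kappa> \<nu>)" for \<mu> \<nu>
  have K: "(\<Sum>\<alpha>\<in>UNIV. raise2 G (pull2 Q H) \<mu> \<alpha> * S i \<alpha> \<nu>) = pull2 Q K \<mu> \<nu>" for \<mu> \<nu>
  proof -
    have "raise2 G (pull2 Q H) \<mu> \<alpha> = (\<Sum>\<kappa>\<in>UNIV. (\<Sum>\<beta>\<in>UNIV. pull2 Q H \<mu> \<beta> * P \<beta> \<kappa>) * P \<alpha> \<kappa>)" for \<alpha>
      unfolding raise2_def I sum_distrib_left sum_distrib_right
      by (subst sum.swap) (simp only: mult_ac)
    then have "(\<Sum>\<alpha>\<in>UNIV. raise2 G (pull2 Q H) \<mu> \<alpha> * S i \<alpha> \<nu>)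
        = (\<Sum>\<alpha>\<in>UNIV. \<Sum>\<kappa>\<in>UNIV. (\<Sum>\<beta>\<in>UNIV. pull2 Q H \<mu> \<beta> * P \<beta> \<kappa>) * (P \<alpha> \<kappa> * S i \<alpha> \<nu>))"
      by (simp only: sum_distrib_right[of _ UNIV "S i _ _"] mult.assoc)
    also have "\<dots> = (\<Sum>\<kappa>\<in>UNIV. (\<Sum>\<beta>\<in>UNIV. pull2 Q H \<mu> \<beta> * P \<beta> \<kappa>) * (\<Sum>\<alpha>\<in>UNIV. P \<alpha> \<kappa> * S i \<alpha> \<nu>))"
      by (subst sum.swap) (simp only: sum_distrib_left)
    also have "\<dots> = (\<Sum>\<kappa>\<in>UNIV. (\<Sum>a\<in>UNIV. H a \<kappa> * Q a \<mu>) * (\<Sum>b\<in>UNIV. std i \<kappa> b * Q b \<nu>))"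
      unfolding S pull2_contract_right[OF QP] pull2_contract_left[OF QP] ..
    also have "\<dots> = (\<Sum>\<kappa>\<in>UNIV. \<Sum>a\<in>UNIV. \<Sum>b\<in>UNIV. H a \<kappa> * std i \<kappa> b * Q a \<mu> * Q b \<nu>)"
      unfolding sum_product by (simp only: mult_ac)
    also have "\<dots> = (\<Sum>a\<in>UNIV. \<Sum>\<kappa>\<in>UNIV. \<Sum>b\<in>UNIV. H a \<kappa> * std i \<kappa> b * Q a \<mu> * Q b \<nu>)"
      by (rule sum.swap)
    also have "\<dots> = (\<Sum>a\<in>UNIV. \<Sum>b\<in>UNIV. \<Sum>\<kappa>\<in>UNIV. H a \<kappa> * std i \<kappa> b * Q a \<mu> * Q b \<nu>)"
      by (rule sum.cong[OF refl], rule sum.swap)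
    finally show ?thesis unfolding pull2_def K_def sum_distrib_right .
  qed
  show ?thesis
  proof (intro ext)
    fix \<mu> \<nu>
    have "hstd H i = (\<lambda>\<mu> \<nu>. 1/2 * (K \<mu> \<nu> - K \<nu> \<mu>))"
      unfolding hstd_def K_def by (intro ext) simp
    moreover have "pull2 Q (\<lambda>\<mu> \<nu>. K \<nu> \<mu>) \<mu> \<nu> = pull2 Q K \<nu> \<mu>" by (rule pull2_transpose)
    ultimately show "h_action G S (pull2 Q H) i \<mu> \<nu> = pull2 Q (hstd H i) \<mu> \<nu>"
      unfolding h_action_def K by (simp only: pull2_linear)
  qed
qed

lemma W_pull2:
  assumes S: "\<And>i. S i = pull2 Q (std i)"
    and "\<And>\<mu> \<nu>. s \<mu> \<nu> = - s \<nu> \<mu>" "\<And>\<mu> \<nu>. t \<mu> \<nu> = - t \<nu> \<mu>"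
  shows "W (pull2 Q s) (pull2 Q t) = - wedge22 s t 1 2 3 4"
proof -
  let ?V = "wedge22 (std 1) (std 1)"
  have V: "pull4 Q ?V 1 2 3 4 = 2 * v 1 2 3 4"
    unfolding wedge22_pull2[symmetric] S[symmetric] S_wedge by simp
  have V1: "?V 1 2 3 4 = - 2" by (simp add: wedge22_def)
  have "pull4 Q (wedge22 s t) 1 2 3 4 / pull4 Q ?V 1 2 3 4 = wedge22 s t 1 2 3 4 / ?V 1 2 3 4"
    by (rule alt4_ratio_pull4[OF alt4_wedge22[OF assms(2,3)] alt4_wedge22[OF std_antisym std_antisym]])
       (simp_all add: V V1 v_nonzero)
  then show ?thesis unfolding wedge_ratio_def wedge22_pull2 V V1 by (simp add: field_simps)
qed

lemma S_param_pull2: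
  assumes QP: "\<And>b \<kappa>. (\<Sum>\<beta>\<in>UNIV. Q b \<beta> * P \<beta> \<kappa>) = kdelta b \<kappa>"
    and S: "\<And>i. S i = pull2 Q (std i)"
    and I: "\<And>\<alpha> \<beta>. inv_metric G \<alpha> \<beta> = (\<Sum>\<kappa>\<in>UNIV. P \<alpha> \<kappa> * P \<beta> \<kappa>)"
  shows "S_param G S u (pull2 Q H) i = pull2 Q (sstd u H i)"
proof (intro ext)
  fix \<mu> \<nu>
  have 1: "(\<Sum>j\<in>UNIV. \<Sum>k\<in>UNIV. eps3 i j k * T j * u k) = (\<Sum>j\<in>UNIV. (\<Sum>k\<in>UNIV. eps3 i j k * u k) * T j)"
    for T :: "3 \<Rightarrow> real"
    unfolding sum_distrib_right by (simp only: mult_ac)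
  have 2: "sstd u H i = (\<lambda>\<mu> \<nu>. 2 * (\<Sum>j\<in>UNIV. (\<Sum>k\<in>UNIV. eps3 i j k * u k) * std j \<mu> \<nu>) + 2 * hstd H i \<mu> \<nu>)"
    unfolding sstd_def 1 ..
  show "S_param G S u (pull2 Q H) i \<mu> \<nu> = pull2 Q (sstd u H i) \<mu> \<nu>"
    unfolding S_param_def h_action_pull2[OF QP S I] 1 2 pull2_linear pull2_sum S ..
qed

lemma metric_inner2_pull2:
  assumes I: "\<And>\<alpha> \<beta>. inv_metric G \<alpha> \<beta> = (\<Sum>\<kappa>\<in>UNIV. P \<alpha> \<kappa> * P \<beta> \<kappa>)"
  shows "metric_inner2 G h k = (\<Sum>\<kappa>\<in>UNIV. \<Sum>l\<in>UNIV. pull2 P h \<kappa> l * pull2 P k \<kappa> l)"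
proof -
  have 1: "(\<Sum>\<alpha>\<in>UNIV. \<Sum>\<beta>\<in>UNIV. inv_metric G \<mu> \<alpha> * inv_metric G \<nu> \<beta> * k \<alpha> \<beta>)
      = (\<Sum>\<kappa>\<in>UNIV. \<Sum>l\<in>UNIV. P \<mu> \<kappa> * P \<nu> l * pull2 P k \<kappa> l)" for \<mu> \<nu>
  proof -
    have "(\<Sum>\<alpha>\<in>UNIV. \<Sum>\<beta>\<in>UNIV. inv_metric G \<mu> \<alpha> * inv_metric G \<nu> \<beta> * k \<alpha> \<beta>)
      = (\<Sum>\<alpha>\<in>UNIV. \<Sum>\<beta>\<in>UNIV. \<Sum>\<kappa>\<in>UNIV. \<Sum>l\<in>UNIV. P \<mu> \<kappa> * P \<nu> l * (k \<alpha> \<beta> * P \<alpha> \<kappa> * P \<beta> l))"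
      by (simp only: I sum_product, simp only: sum_distrib_right) (simp only: mult_ac)
    also have "\<dots> = (\<Sum>\<kappa>\<in>UNIV. \<Sum>l\<in>UNIV. \<Sum>\<alpha>\<in>UNIV. \<Sum>\<beta>\<in>UNIV. P \<mu> \<kappa> * P \<nu> l * (k \<alpha> \<beta> * P \<alpha> \<kappa> * P \<beta> l))"
      by (rule sum_swap22)
    finally show ?thesis unfolding pull2_def sum_distrib_left .
  qed
  have "metric_inner2 G h k = (\<Sum>\<mu>\<in>UNIV. \<Sum>\<nu>\<in>UNIV. h \<mu> \<nu> * (\<Sum>\<alpha>\<in>UNIV. \<Sum>\<beta>\<in>UNIV. inv_metric G \<mu> \<alpha> * inv_metric G \<nu> \<beta> * k \<alpha> \<beta>))"
    unfolding metric_inner2_def sum_distrib_left by (simp only: mult_ac)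
  also have "\<dots> = (\<Sum>\<mu>\<in>UNIV. \<Sum>\<nu>\<in>UNIV. \<Sum>\<kappa>\<in>UNIV. \<Sum>l\<in>UNIV. (h \<mu> \<nu> * P \<mu> \<kappa> * P \<nu> l) * pull2 P k \<kappa> l)"
    unfolding 1 sum_distrib_left by (simp only: mult_ac)
  also have "\<dots> = (\<Sum>\<kappa>\<in>UNIV. \<Sum>l\<in>UNIV. \<Sum>\<mu>\<in>UNIV. \<Sum>\<nu>\<in>UNIV. (h \<mu> \<nu> * P \<mu> \<kappa> * P \<nu> l) * pull2 P k \<kappa> l)"
    by (rule sum_swap22)
  finally show ?thesis unfolding pull2_def[of P h] sum_distrib_right .
qed

lemma metric_trace_pull2:
  assumes I: "\<And>\<alpha> \<beta>. inv_metric G \<alpha> \<beta> = (\<Sum>\<kappa>\<in>UNIV. P \<alpha> \<kappa> * P \<beta> \<kappa>)"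
  shows "metric_trace G h = (\<Sum>\<kappa>\<in>UNIV. pull2 P h \<kappa> \<kappa>)"
proof -
  have "metric_trace G h = (\<Sum>\<mu>\<in>UNIV. \<Sum>\<nu>\<in>UNIV. \<Sum>\<kappa>\<in>UNIV. h \<mu> \<nu> * P \<mu> \<kappa> * P \<nu> \<kappa>)"
    unfolding metric_trace_def I sum_distrib_right by (simp only: mult_ac)
  also have "\<dots> = (\<Sum>\<mu>\<in>UNIV. \<Sum>\<kappa>\<in>UNIV. \<Sum>\<nu>\<in>UNIV. h \<mu> \<nu> * P \<mu> \<kappa> * P \<nu> \<kappa>)"
    by (rule sum.cong[OF refl], rule sum.swap)
  also have "\<dots> = (\<Sum>\<kappa>\<in>UNIV. \<Sum>\<mu>\<in>UNIV. \<Sum>\<nu>\<in>UNIV. h \<mu> \<nu> * P \<mu> \<kappa> * P \<nu> \<kappa>)"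
    by (rule sum.swap)
  finally show ?thesis unfolding pull2_def .
qed

subsection \<open>The parametrisation of \<open>S\<close>\<close>

text \<open>
  The trace \<open>h\<close> and \<open>h\<^sup>i\<close> enter through the self-dual part of \<open>S_param\<close> only, and \<open>h~\<close> through the
  anti-self-dual part only, where the wedge pairing is negative definite.  So the pairings with the
  triple and with itself recover the squares of all parameters.
\<close>

lemma
  assumes h: "\<And>\<mu> \<nu>. h \<mu> \<nu> = h \<nu> \<mu>"
  shows W_S_param: "W (S_param G S u h i) (S j) = metric_trace G h * kdelta i j + 4 * (\<Sum>k\<in>UNIV. eps3 i j k * u k)"
    and W_S_param_self: "(\<Sum>i\<in>UNIV. W (S_param G S u h i) (S_param G S u h i))
      = 2 * (metric_trace G h)^2 + 16 * (\<Sum>k\<in>UNIV. (u k)^2) - 2 * metric_inner2 G h h"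
    and metric_inner2_nonneg: "metric_inner2 G h h \<ge> 0"
    and metric_inner2_zero: "metric_inner2 G h h = 0 \<Longrightarrow> h = (\<lambda>\<mu> \<nu>. 0)"
    and metric_inner2_tracefree: "metric_inner2 G (tracefree_part G h) (tracefree_part G h)
      = metric_inner2 G h h - (metric_trace G h)^2 / 4"
proof -
  obtain P Q where QP: "\<And>b \<kappa>. (\<Sum>\<beta>\<in>UNIV. Q b \<beta> * P \<beta> \<kappa>) = kdelta b \<kappa>"
    and PQ: "\<And>b \<kappa>. (\<Sum>\<beta>\<in>UNIV. P b \<beta> * Q \<beta> \<kappa>) = kdelta b \<kappa>"
    and G: "G = pull2 Q kdelta" and S: "\<And>i. S i = pull2 Q (std i)"
    and I: "\<And>\<alpha> \<beta>. inv_metric G \<alpha> \<beta> = (\<Sum>\<kappa>\<in>UNIV. P \<alpha> \<kappa> * P \<beta> \<kappa>)"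
    by (rule frame_exists) (rule that)
  define H where "H = pull2 P h"
  have hH: "h = pull2 Q H" unfolding H_def pull2_pull2 PQ by (rule pull2_kdelta[symmetric])
  have HG: "pull2 P G = kdelta" unfolding G pull2_pull2 QP by (rule pull2_kdelta)
  have H: "H \<mu> \<nu> = H \<nu> \<mu>" for \<mu> \<nu>
    unfolding H_def using pull2_transpose[of P h \<mu> \<nu>] h by (simp add: fun_eq_iff)
  have tr: "metric_trace G h = (\<Sum>\<mu>\<in>UNIV. H \<mu> \<mu>)" unfolding metric_trace_pull2[OF I] H_def ..
  have in2: "metric_inner2 G h h = (\<Sum>\<mu>\<in>UNIV. \<Sum>\<nu>\<in>UNIV. (H \<mu> \<nu>)^2)"
    unfolding metric_inner2_pull2[OF I] H_def power2_eq_square ..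
  have sp: "S_param G S u h i = pull2 Q (sstd u H i)" for i
    unfolding hH by (rule S_param_pull2[OF QP S I])
  show "W (S_param G S u h i) (S j) = metric_trace G h * kdelta i j + 4 * (\<Sum>k\<in>UNIV. eps3 i j k * u k)"
    unfolding sp S W_pull2[OF S sstd_antisym std_antisym] wedge_sstd_std[where H = H, OF H] tr by simp
  show "(\<Sum>i\<in>UNIV. W (S_param G S u h i) (S_param G S u h i))
      = 2 * (metric_trace G h)^2 + 16 * (\<Sum>k\<in>UNIV. (u k)^2) - 2 * metric_inner2 G h h"
    unfolding sp W_pull2[OF S sstd_antisym sstd_antisym] sum_negf wedge_sstd_sstd[where H = H, OF H] tr in2 by simp
  show "metric_inner2 G h h \<ge> 0" unfolding in2 by (intro sum_nonneg) simp
  show "h = (\<lambda>\<mu> \<nu>. 0)" if "metric_inner2 G h h = 0"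
  proof -
    have "(\<Sum>\<nu>\<in>UNIV. (H \<mu> \<nu>)^2) = 0" for \<mu>
      using that unfolding in2 by (subst (asm) sum_nonneg_eq_0_iff) (auto intro: sum_nonneg)
    then have "H \<mu> \<nu> = 0" for \<mu> \<nu>
      by (simp add: sum_nonneg_eq_0_iff)
    then show ?thesis unfolding hH pull2_def by simp
  qed
  have tf: "pull2 P (tracefree_part G h) \<mu> \<nu> = H \<mu> \<nu> - 1/4 * metric_trace G h * kdelta \<mu> \<nu>" for \<mu> \<nu>
  proof -
    have "tracefree_part G h = (\<lambda>\<mu> \<nu>. h \<mu> \<nu> - (1/4 * metric_trace G h) * G \<mu> \<nu>)"
      unfolding tracefree_part_def by (intro ext) simp
    then show ?thesis by (simp only: pull2_linear HG H_def)
  qed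
  show "metric_inner2 G (tracefree_part G h) (tracefree_part G h)
      = metric_inner2 G h h - (metric_trace G h)^2 / 4"
    unfolding metric_inner2_pull2[OF I, of "tracefree_part G h"] tf in2 tr sum_4
    by (simp add: power2_eq_square field_simps)
qed

lemma S_fibre_param:
  assumes "s \<in> S_fibre G S"
  obtains u h where "\<And>\<mu> \<nu>. h \<mu> \<nu> = h \<nu> \<mu>" "s = S_param G S u h"
proof -
  obtain P Q where QP: "\<And>b \<kappa>. (\<Sum>\<beta>\<in>UNIV. Q b \<beta> * P \<beta> \<kappa>) = kdelta b \<kappa>"
    and PQ: "\<And>b \<kappa>. (\<Sum>\<beta>\<in>UNIV. P b \<beta> * Q \<beta> \<kappa>) = kdelta b \<kappa>"
    and S: "\<And>i. S i = pull2 Q (std i)"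
    and I: "\<And>\<alpha> \<beta>. inv_metric G \<alpha> \<beta> = (\<Sum>\<kappa>\<in>UNIV. P \<alpha> \<kappa> * P \<beta> \<kappa>)"
    by (rule frame_exists) (rule that)
  obtain k where k: "s = h_action G S k" using assms unfolding S_fibre_def by blast
  define K where "K = pull2 P k"
  have "k = pull2 Q K" unfolding K_def pull2_pull2 PQ by (rule pull2_kdelta[symmetric])
  then have s: "s i = pull2 Q (hstd K i)" for i unfolding k by (simp only: h_action_pull2[OF QP S I])
  obtain u where u: "hstd K = sstd u (\<lambda>\<mu> \<nu>. (K \<mu> \<nu> + K \<nu> \<mu>) / 4)" using hstd_eq_sstd .
  let ?H = "\<lambda>\<mu> \<nu>. (K \<mu> \<nu> + K \<nu> \<mu>) / 4"
  show thesis
  proof (rule that)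
    show "pull2 Q ?H \<mu> \<nu> = pull2 Q ?H \<nu> \<mu>" for \<mu> \<nu>
      unfolding pull2_transpose[of Q ?H \<mu> \<nu>, symmetric] by (simp add: add.commute)
    show "s = S_param G S u (pull2 Q ?H)"
      by (rule ext) (simp only: S_param_pull2[OF QP S I] s u)
  qed
qed

lemma S_param_linear:
  "S_param G S (\<lambda>k. u k - u' k) (\<lambda>\<mu> \<nu>. h \<mu> \<nu> - h' \<mu> \<nu>) i \<mu> \<nu> = S_param G S u h i \<mu> \<nu> - S_param G S u' h' i \<mu> \<nu>"
  "S_param G S (\<lambda>k. c * u k) (\<lambda>\<mu> \<nu>. c * h \<mu> \<nu>) i \<mu> \<nu> = c * S_param G S u h i \<mu> \<nu>"
proof -
  have r: "raise2 G (\<lambda>\<mu> \<nu>. h \<mu> \<nu> - h' \<mu> \<nu>) = (\<lambda>\<mu> \<alpha>. raise2 G h \<mu> \<alpha> - raise2 G h' \<mu> \<alpha>)"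
    "raise2 G (\<lambda>\<mu> \<nu>. c * h \<mu> \<nu>) = (\<lambda>\<mu> \<alpha>. c * raise2 G h \<mu> \<alpha>)"
    unfolding raise2_def by (intro ext; simp add: algebra_simps sum_subtractf sum_distrib_left)+
  show "S_param G S (\<lambda>k. u k - u' k) (\<lambda>\<mu> \<nu>. h \<mu> \<nu> - h' \<mu> \<nu>) i \<mu> \<nu> = S_param G S u h i \<mu> \<nu> - S_param G S u' h' i \<mu> \<nu>"
    unfolding S_param_def h_action_def r by (simp add: algebra_simps sum_subtractf)
  show "S_param G S (\<lambda>k. c * u k) (\<lambda>\<mu> \<nu>. c * h \<mu> \<nu>) i \<mu> \<nu> = c * S_param G S u h i \<mu> \<nu>"
    unfolding S_param_def h_action_def r by (simp add: algebra_simps sum_distrib_left)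
qed

text \<open>
  Consequently the parameters are unique, and \<^const>\<open>S_coords\<close> computes them.
\<close>

lemma S_param_eq_0:
  assumes h: "\<And>\<mu> \<nu>. h \<mu> \<nu> = h \<nu> \<mu>" and z: "S_param G S u h = (\<lambda>i \<mu> \<nu>. 0)"
  shows "u = (\<lambda>k. 0)" "h = (\<lambda>\<mu> \<nu>. 0)"
proof -
  have W0: "W (\<lambda>\<mu> \<nu>. 0) t = 0" for t unfolding wedge_ratio_def wedge22_def by simp
  have M: "metric_trace G h * kdelta i j + 4 * (\<Sum>k\<in>UNIV. eps3 i j k * u k) = 0" for i j
    using W_S_param[where h = h and u = u and i = i and j = j, OF h] unfolding z W0 by simp
  have u: "u 1 = 0" "u 2 = 0" "u 3 = 0" using M[of 2 3] M[of 3 1] M[of 1 2] by (simp_all add: sum_3)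
  then have "\<forall>k. u k = 0" unfolding forall_3 by simp
  then show "u = (\<lambda>k. 0)" by blast
  have t: "metric_trace G h = 0" using M[of 1 1] by (simp add: sum_3)
  have "metric_inner2 G h h = 0"
    using W_S_param_self[where h = h and u = u, OF h] unfolding z W0 t by (simp add: u sum_3)
  then show "h = (\<lambda>\<mu> \<nu>. 0)" by (rule metric_inner2_zero[where h = h, OF h])
qed

lemma S_coords_S_param:
  assumes h: "\<And>\<mu> \<nu>. h \<mu> \<nu> = h \<nu> \<mu>"
  shows "S_coords G S (S_param G S u h) = (u, h)"
  unfolding S_coords_def
proof (rule the_equality)
  show "(\<forall>\<mu> \<nu>. snd (u, h) \<mu> \<nu> = snd (u, h) \<nu> \<mu>) \<and> S_param G S u h = S_param G S (fst (u, h)) (snd (u, h))"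
    using h by auto
next
  fix uh assume a: "(\<forall>\<mu> \<nu>. snd uh \<mu> \<nu> = snd uh \<nu> \<mu>) \<and> S_param G S u h = S_param G S (fst uh) (snd uh)"
  obtain u' h' where uh: "uh = (u', h')" by fastforce
  have h': "\<And>\<mu> \<nu>. h' \<mu> \<nu> = h' \<nu> \<mu>" and e: "S_param G S u h = S_param G S u' h'" using a uh by auto
  have 1: "(h \<mu> \<nu> - h' \<mu> \<nu>) = (h \<nu> \<mu> - h' \<nu> \<mu>)" for \<mu> \<nu> using h[of \<mu> \<nu>] h'[of \<mu> \<nu>] by simp
  have 2: "S_param G S (\<lambda>k. u k - u' k) (\<lambda>\<mu> \<nu>. h \<mu> \<nu> - h' \<mu> \<nu>) = (\<lambda>i \<mu> \<nu>. 0)"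
    by (intro ext) (simp add: S_param_linear e)
  have "\<And>k. u k - u' k = 0" "\<And>\<mu> \<nu>. h \<mu> \<nu> - h' \<mu> \<nu> = 0"
    using fun_cong[OF S_param_eq_0(1)[where h = "\<lambda>\<mu> \<nu>. h \<mu> \<nu> - h' \<mu> \<nu>", OF 1 2]] fun_cong[OF fun_cong[OF S_param_eq_0(2)[where h = "\<lambda>\<mu> \<nu>. h \<mu> \<nu> - h' \<mu> \<nu>", OF 1 2]]] .
  then show "uh = (u, h)" unfolding uh by (simp add: fun_eq_iff)
qed

lemma
  assumes s: "s \<in> S_fibre G S" and b: "\<beta>1 > 0" "\<beta>2 > 0" "\<beta>3 > 0"
  defines "N \<equiv> S_norm \<beta>1 \<beta>2 \<beta>3 (\<lambda>i j. W (s i) (S j)) (\<Sum>i\<in>UNIV. W (s i) (s i))"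
  shows S_inner_pt_scaled: "S_inner_pt \<beta>1 \<beta>2 \<beta>3 G S (\<lambda>i \<mu> \<nu>. c * s i \<mu> \<nu>) s = c * N"
    and S_norm_nonneg: "N \<ge> 0"
    and S_norm_zero: "N = 0 \<Longrightarrow> s = (\<lambda>i \<mu> \<nu>. 0)"
proof -
  obtain u h where h: "\<And>\<mu> \<nu>. h \<mu> \<nu> = h \<nu> \<mu>" and sp: "s = S_param G S u h"
    by (rule S_fibre_param[OF s]) (rule that)
  let ?t = "metric_trace G h" and ?tf = "tracefree_part G h"
  have N: "N = \<beta>1 * ?t^2 + \<beta>2 * (\<Sum>k\<in>UNIV. (u k)^2) + \<beta>3 * metric_inner2 G ?tf ?tf"
    unfolding N_def S_norm_def sp W_S_param[where h = h, OF h] W_S_param_self[where h = h, OF h] metric_inner2_tracefree[where h = h, OF h] Let_def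
    by (simp add: sum_3 power2_eq_square field_simps)
  have tfs: "?tf \<mu> \<nu> = ?tf \<nu> \<mu>" for \<mu> \<nu> unfolding tracefree_part_def using h[of \<mu> \<nu>] G_sym[of \<mu> \<nu>] by simp
  have sc: "(\<lambda>i \<mu> \<nu>. c * s i \<mu> \<nu>) = S_param G S (\<lambda>k. c * u k) (\<lambda>\<mu> \<nu>. c * h \<mu> \<nu>)"
    unfolding sp by (intro ext) (simp only: S_param_linear)
  have ch: "c * h \<mu> \<nu> = c * h \<nu> \<mu>" for \<mu> \<nu> using h[of \<mu> \<nu>] by simp
  have tr: "metric_trace G (\<lambda>\<mu> \<nu>. c * h \<mu> \<nu>) = c * ?t"
    unfolding metric_trace_def by (simp add: sum_distrib_left mult_ac)
  have tf: "tracefree_part G (\<lambda>\<mu> \<nu>. c * h \<mu> \<nu>) = (\<lambda>\<mu> \<nu>. c * ?tf \<mu> \<nu>)"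
    unfolding tracefree_part_def tr by (intro ext) (simp add: algebra_simps)
  have mi: "metric_inner2 G (\<lambda>\<mu> \<nu>. c * ?tf \<mu> \<nu>) ?tf = c * metric_inner2 G ?tf ?tf"
    unfolding metric_inner2_def by (simp add: sum_distrib_left mult_ac)
  show "S_inner_pt \<beta>1 \<beta>2 \<beta>3 G S (\<lambda>i \<mu> \<nu>. c * s i \<mu> \<nu>) s = c * N"
    unfolding S_inner_pt_def sc S_coords_S_param[where h = "\<lambda>\<mu> \<nu>. c * h \<mu> \<nu>", OF ch] unfolding sp S_coords_S_param[where h = h, OF h] N Let_def
    by (simp add: tr tf mi sum_3 power2_eq_square algebra_simps)
  have nn: "\<beta>1 * ?t^2 \<ge> 0" "\<beta>2 * (\<Sum>k\<in>UNIV. (u k)^2) \<ge> 0" "\<beta>3 * metric_inner2 G ?tf ?tf \<ge> 0"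
    using b metric_inner2_nonneg[where h = "tracefree_part G h", OF tfs] by (auto intro!: mult_nonneg_nonneg sum_nonneg)
  then show "N \<ge> 0" unfolding N by linarith
  show "s = (\<lambda>i \<mu> \<nu>. 0)" if "N = 0"
  proof -
    have z: "\<beta>1 * ?t^2 = 0" "\<beta>2 * (\<Sum>k\<in>UNIV. (u k)^2) = 0" "\<beta>3 * metric_inner2 G ?tf ?tf = 0"
      using that nn unfolding N by linarith+
    have t: "?t = 0" using z(1) b by simp
    have "(\<Sum>k\<in>UNIV. (u k)^2) = 0" using z(2) b by simp
    then have u: "u k = 0" for k by (simp add: sum_nonneg_eq_0_iff)
    have "metric_inner2 G ?tf ?tf = 0" using z(3) b by simp
    then have "metric_inner2 G h h = 0" unfolding metric_inner2_tracefree[where h = h, OF h] t by simp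
    then have "h = (\<lambda>\<mu> \<nu>. 0)" by (rule metric_inner2_zero[where h = h, OF h])
    then show ?thesis unfolding sp S_param_def h_action_def raise2_def by (intro ext) (simp add: u)
  qed
qed

lemma S_inner_pt_zero_right: "S_inner_pt \<beta>1 \<beta>2 \<beta>3 G S s (\<lambda>i \<mu> \<nu>. 0) = 0"
proof -
  have "S_param G S (\<lambda>k. 0) (\<lambda>\<mu> \<nu>. 0) = (\<lambda>i \<mu> \<nu>. 0)"
    unfolding S_param_def h_action_def raise2_def by simp
  then have "S_coords G S (\<lambda>i \<mu> \<nu>. 0) = ((\<lambda>k. 0), (\<lambda>\<mu> \<nu>. 0))"
    using S_coords_S_param[of "\<lambda>\<mu> \<nu>. 0" "\<lambda>k. 0"] by simp
  then show ?thesis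
    unfolding S_inner_pt_def
    by (cases "S_coords G S s") (simp add: metric_trace_def metric_inner2_def tracefree_part_def)
qed

lemma S_fibre_scale: "s \<in> S_fibre G S \<Longrightarrow> (\<lambda>i \<mu> \<nu>. c * s i \<mu> \<nu>) \<in> S_fibre G S"
proof -
  assume "s \<in> S_fibre G S"
  then obtain h where h: "s = h_action G S h" unfolding S_fibre_def by blast
  have "(\<lambda>i \<mu> \<nu>. c * s i \<mu> \<nu>) = h_action G S (\<lambda>\<mu> \<nu>. c * h \<mu> \<nu>)"
    unfolding h h_action_def raise2_def
    by (intro ext) (simp add: algebra_simps sum_distrib_left)
  then show ?thesis unfolding S_fibre_def by blast
qed

text \<open>
  For \<open>s\<close> in \<open>S\<close> the matrix \<open>s\<^sup>i \<and> \<Sigma>\<^sup>j\<close> is the sum of a multiple of \<open>\<delta>\<^sup>i\<^sup>j\<close> and an antisymmetric matrix,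
  hence orthogonal to every symmetric tracefree \<open>\<psi>\<close>.
\<close>

lemma S_fibre_annihilates:
  assumes s: "s \<in> S_fibre G S" and \<psi>: "\<And>i j. \<psi> i j = \<psi> j i" "(\<Sum>i\<in>UNIV. \<psi> i i) = 0"
    and F: "\<And>i \<mu> \<nu>. F i \<mu> \<nu> = (\<Sum>j\<in>UNIV. \<psi> i j * S j \<mu> \<nu>)"
  shows "(\<Sum>i\<in>UNIV. W (s i) (F i)) = 0"
proof -
  obtain u h where h: "\<And>\<mu> \<nu>. h \<mu> \<nu> = h \<nu> \<mu>" and sp: "s = S_param G S u h"
    by (rule S_fibre_param[OF s]) (rule that)
  have "W (s i) (F i) = (\<Sum>j\<in>UNIV. \<psi> i j * W (s i) (S j))" for i
    unfolding wedge_ratio_def F[abs_def] wedge22_sum_right sum_divide_distrib by simp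
  then have "(\<Sum>i\<in>UNIV. W (s i) (F i)) = (\<Sum>i\<in>UNIV. \<Sum>j\<in>UNIV. \<psi> i j * W (s i) (S j))" by simp
  also have "\<dots> = metric_trace G h * (\<Sum>i\<in>UNIV. \<psi> i i)"
    unfolding sp W_S_param[where h = h, OF h] sum_3
    using \<psi>(1)[of 2 1] \<psi>(1)[of 3 1] \<psi>(1)[of 3 2] by (simp add: algebra_simps)
  finally show ?thesis using \<psi>(2) by simp
qed

text \<open>
  The converse: symmetric tracefree combinations of the triple are the only elements annihilated by
  \<open>S\<close>.  It is detected by a single element \<open>T\<close> of \<open>S\<close> depending linearly on \<open>F\<close>, for which the pairing
  is a sum of squares.
\<close>

lemma
  fixes F :: "3 \<Rightarrow> 4 \<Rightarrow> 4 \<Rightarrow> real"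
  assumes F: "\<And>i \<mu> \<nu>. F i \<mu> \<nu> = - F i \<nu> \<mu>"
  defines "\<psi> \<equiv> (\<lambda>i j. W (F i) (S j) / 2)"
  defines "T \<equiv> (\<lambda>i \<mu> \<nu>. (\<Sum>j\<in>UNIV. test_coeff \<psi> i j * S j \<mu> \<nu>) - F i \<mu> \<nu>)"
  shows test_in_S_fibre: "T \<in> S_fibre G S"
    and test_pairing_nonneg: "(\<Sum>i\<in>UNIV. W (T i) (F i)) \<ge> 0"
    and test_pairing_zero: "(\<Sum>i\<in>UNIV. W (T i) (F i)) = 0 \<Longrightarrow>
      (\<forall>i \<mu> \<nu>. F i \<mu> \<nu> = (\<Sum>j\<in>UNIV. \<psi> i j * S j \<mu> \<nu>)) \<and> (\<forall>i j. \<psi> i j = \<psi> j i) \<and> (\<Sum>i\<in>UNIV. \<psi> i i) = 0"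
proof -
  obtain P Q where QP: "\<And>b \<kappa>. (\<Sum>\<beta>\<in>UNIV. Q b \<beta> * P \<beta> \<kappa>) = kdelta b \<kappa>"
    and PQ: "\<And>b \<kappa>. (\<Sum>\<beta>\<in>UNIV. P b \<beta> * Q \<beta> \<kappa>) = kdelta b \<kappa>"
    and S: "\<And>i. S i = pull2 Q (std i)"
    and I: "\<And>\<alpha> \<beta>. inv_metric G \<alpha> \<beta> = (\<Sum>\<kappa>\<in>UNIV. P \<alpha> \<kappa> * P \<beta> \<kappa>)"
    by (rule frame_exists) (rule that)
  define f where "f i = pull2 P (F i)" for i
  have Ff: "F i = pull2 Q (f i)" for i unfolding f_def pull2_pull2 PQ by (rule pull2_kdelta[symmetric])
  have f: "f i \<mu> \<nu> = - f i \<nu> \<mu>" for i \<mu> \<nu>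
  proof -
    have "(\<lambda>\<mu> \<nu>. F i \<nu> \<mu>) = (\<lambda>\<mu> \<nu>. - F i \<mu> \<nu>)" by (intro ext, rule F)
    then show ?thesis unfolding f_def using pull2_transpose[of P "F i" \<nu> \<mu>] by (simp add: pull2_linear)
  qed
  have \<psi>: "\<psi> = psi_std f"
    unfolding \<psi>_def psi_std_def by (intro ext) (simp only: Ff S W_pull2[OF S f std_antisym])
  have T: "T i = pull2 Q (test_std f i)" for i
    unfolding T_def \<psi> test_std_def[abs_def] S
    by (intro ext) (simp only: pull2_linear pull2_sum Ff)
  obtain H where H: "test_std f = hstd H" using test_std_in_range[where f = f, OF f] by blast
  have "T = h_action G S (pull2 Q H)"
    by (rule ext) (simp only: T H h_action_pull2[OF QP S I])
  then show "T \<in> S_fibre G S" unfolding S_fibre_def by blast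
  have ta: "test_std f i \<mu> \<nu> = - test_std f i \<nu> \<mu>" for i \<mu> \<nu> unfolding H by (rule hstd_antisym)
  have pair: "(\<Sum>i\<in>UNIV. W (T i) (F i)) =
       (\<Sum>i\<in>UNIV. ((f i 1 2 + f i 3 4)^2 + (f i 1 3 - f i 2 4)^2 + (f i 1 4 + f i 2 3)^2) / 2)
       + (\<Sum>i\<in>UNIV. \<Sum>j\<in>UNIV. (psi_std f i j - psi_std f j i)^2) / 2
       + 2/3 * (\<Sum>k\<in>UNIV. psi_std f k k)^2"
    unfolding T Ff W_pull2[OF S ta f] sum_negf by (rule test_std_pairing[where f = f, OF f])
  have nn: "(\<Sum>i\<in>UNIV. ((f i 1 2 + f i 3 4)^2 + (f i 1 3 - f i 2 4)^2 + (f i 1 4 + f i 2 3)^2) / 2) \<ge> 0"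
    "(\<Sum>i\<in>UNIV. \<Sum>j\<in>UNIV. (psi_std f i j - psi_std f j i)^2) / 2 \<ge> 0"
    "2/3 * (\<Sum>k\<in>UNIV. psi_std f k k)^2 \<ge> 0"
    by (auto intro!: sum_nonneg)
  then show "(\<Sum>i\<in>UNIV. W (T i) (F i)) \<ge> 0" unfolding pair by linarith
  assume "(\<Sum>i\<in>UNIV. W (T i) (F i)) = 0"
  then have z: "(\<Sum>i\<in>UNIV. ((f i 1 2 + f i 3 4)^2 + (f i 1 3 - f i 2 4)^2 + (f i 1 4 + f i 2 3)^2) / 2) = 0"
    "(\<Sum>i\<in>UNIV. \<Sum>j\<in>UNIV. (psi_std f i j - psi_std f j i)^2) / 2 = 0"
    "2/3 * (\<Sum>k\<in>UNIV. psi_std f k k)^2 = 0"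
    using nn unfolding pair by linarith+
  have z1: "((f i 1 2 + f i 3 4)^2 + (f i 1 3 - f i 2 4)^2 + (f i 1 4 + f i 2 3)^2) / 2 = 0" for i
    using z(1) by (subst (asm) sum_nonneg_eq_0_iff) auto
  have asd: "f i 3 4 = - f i 1 2" "f i 2 4 = f i 1 3" "f i 2 3 = - f i 1 4" for i
    using z1[of i] by (simp_all add: add_nonneg_eq_0_iff)
  have sym: "psi_std f i j = psi_std f j i" for i j
  proof -
    have "(\<Sum>i\<in>UNIV. \<Sum>j\<in>UNIV. (psi_std f i j - psi_std f j i)^2) = 0" using z(2) by simp
    then have "(\<Sum>j\<in>UNIV. (psi_std f i j - psi_std f j i)^2) = 0"
      by (subst (asm) sum_nonneg_eq_0_iff) (auto intro: sum_nonneg)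
    then show ?thesis by (subst (asm) sum_nonneg_eq_0_iff) auto
  qed
  have fe: "f i \<mu> \<nu> = (\<Sum>j\<in>UNIV. psi_std f i j * std j \<mu> \<nu>)" for i \<mu> \<nu>
  proof -
    have F0: "f i \<mu> \<mu> = 0" for \<mu> using f[of i \<mu> \<mu>] by simp
    have Fa: "f i 2 1 = - f i 1 2" "f i 3 1 = - f i 1 3" "f i 4 1 = - f i 1 4" "f i 3 2 = - f i 2 3"
      "f i 4 2 = - f i 2 4" "f i 4 3 = - f i 3 4" using f by blast+
    have "\<forall>\<mu> \<nu>. f i \<mu> \<nu> = (\<Sum>j\<in>UNIV. psi_std f i j * std j \<mu> \<nu>)"
      unfolding forall_4 sum_3 psi_std_table[where f = f, OF f] by (simp add: Fa F0 asd)
    then show ?thesis by blast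
  qed
  have "F i \<mu> \<nu> = (\<Sum>j\<in>UNIV. \<psi> i j * S j \<mu> \<nu>)" for i \<mu> \<nu>
  proof -
    have "f i = (\<lambda>\<mu> \<nu>. \<Sum>j\<in>UNIV. psi_std f i j * std j \<mu> \<nu>)" by (intro ext, rule fe)
    then have "F i \<mu> \<nu> = pull2 Q (\<lambda>\<mu> \<nu>. \<Sum>j\<in>UNIV. psi_std f i j * std j \<mu> \<nu>) \<mu> \<nu>"
      unfolding Ff[of i] by (rule arg_cong)
    then show ?thesis by (simp only: pull2_sum pull2_linear S \<psi>)
  qed
  then show "(\<forall>i \<mu> \<nu>. F i \<mu> \<nu> = (\<Sum>j\<in>UNIV. \<psi> i j * S j \<mu> \<nu>)) \<and> (\<forall>i j. \<psi> i j = \<psi> j i) \<and> (\<Sum>i\<in>UNIV. \<psi> i i) = 0"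
    using sym z(3) unfolding \<psi> by auto
qed

text \<open>
  With \<open>b = d\<^sub>2 \<sigma>\<close> and \<open>\<omega> = d\<sigma>\<close> this is \<open>\<epsilon>\<^sup>i\<^sup>j\<^sup>k \<Sigma>\<^sup>i \<and> b\<^sup>j \<and> a\<^sup>k = d\<sigma>\<^sup>k \<and> a\<^sup>k\<close>: the inner product on
  \<open>E \<otimes> \<Lambda>\<^sup>1\<close> is the one for which the algebraic inverse in \<open>d\<^sub>2\<close> cancels.
\<close>

lemma pairing_eps_wedge:
  assumes "eps_wedge b = (\<lambda>i \<mu> \<nu> \<rho>. - \<omega> i \<mu> \<nu> \<rho>)"
  shows "(\<Sum>i\<in>UNIV. \<Sum>j\<in>UNIV. \<Sum>k\<in>UNIV. eps3 i j k * wedge22 (S i) (wedge11 (b j) (a k)) 1 2 3 4) =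
    (\<Sum>k\<in>UNIV. \<omega> k 1 2 3 * a k 4 - \<omega> k 1 2 4 * a k 3 + \<omega> k 1 3 4 * a k 2 - \<omega> k 2 3 4 * a k 1)"
proof -
  have \<omega>: "\<omega> i \<mu> \<nu> \<rho> = - eps_wedge b i \<mu> \<nu> \<rho>" for i \<mu> \<nu> \<rho> by (simp add: assms)
  show ?thesis
    unfolding wedge22_wedge11[OF S_antisym] \<omega> sum_3 eps_wedge_components
    by (simp add: algebra_simps)
qed

end


section \<open>Charts\<close>

locale atlas =
  fixes \<A> :: "'m::{t2_space, second_countable_topology} chart set"
  assumes smooth_atlas: "smooth_atlas \<A>"
begin

abbreviation img :: "'m chart \<Rightarrow> (real^4) set" where
  "img c \<equiv> chart_map c ` chart_dom c"

lemma open_dom: "c \<in> \<A> \<Longrightarrow> open (chart_dom c)"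
  and open_img: "c \<in> \<A> \<Longrightarrow> open (img c)"
  and chart_homeomorphism: "c \<in> \<A> \<Longrightarrow> homeomorphism (chart_dom c) (img c) (chart_map c) (chart_inv c)"
  using smooth_atlas unfolding smooth_atlas_def by blast+

lemma transition_smooth:
  "c \<in> \<A> \<Longrightarrow> c' \<in> \<A> \<Longrightarrow> smooth_on (chart_map c' \<circ> chart_inv c) (chart_map c ` (chart_dom c \<inter> chart_dom c'))"
  using smooth_atlas unfolding smooth_atlas_def by blast

lemma chart_cover: obtains c where "c \<in> \<A>" "p \<in> chart_dom c"
  using smooth_atlas unfolding smooth_atlas_def by blast

lemma chart_at: "chart_at \<A> p \<in> \<A>" "p \<in> chart_dom (chart_at \<A> p)"
  unfolding chart_at_def using someI_ex[of "\<lambda>c. c \<in> \<A> \<and> p \<in> chart_dom c"] chart_cover[of p] by metis+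

lemma inv_chart: "c \<in> \<A> \<Longrightarrow> p \<in> chart_dom c \<Longrightarrow> chart_inv c (chart_map c p) = p"
  and chart_inv: "c \<in> \<A> \<Longrightarrow> x \<in> img c \<Longrightarrow> chart_map c (chart_inv c x) = x"
  and chart_inv_in: "c \<in> \<A> \<Longrightarrow> x \<in> img c \<Longrightarrow> chart_inv c x \<in> chart_dom c"
  using chart_homeomorphism unfolding homeomorphism_def by blast+

lemma continuous_inv: "c \<in> \<A> \<Longrightarrow> continuous_on (img c) (chart_inv c)"
  and continuous_chart: "c \<in> \<A> \<Longrightarrow> continuous_on (chart_dom c) (chart_map c)"
  using chart_homeomorphism unfolding homeomorphism_def by blast+

lemma image_eq: "c \<in> \<A> \<Longrightarrow> B \<subseteq> chart_dom c \<Longrightarrow> chart_map c ` B = {x \<in> img c. chart_inv c x \<in> B}"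
proof (intro equalityI subsetI)
  fix x assume "c \<in> \<A>" "B \<subseteq> chart_dom c" "x \<in> chart_map c ` B"
  then show "x \<in> {x \<in> img c. chart_inv c x \<in> B}" using inv_chart[of c] by (auto simp: subset_iff)
next
  fix x assume "c \<in> \<A>" "x \<in> {x \<in> img c. chart_inv c x \<in> B}"
  then show "x \<in> chart_map c ` B" using chart_inv by (metis (mono_tags, lifting) imageI mem_Collect_eq)
qed

lemma open_image: "c \<in> \<A> \<Longrightarrow> open B \<Longrightarrow> B \<subseteq> chart_dom c \<Longrightarrow> open (chart_map c ` B)"
proof -
  assume c: "c \<in> \<A>" and B: "open B" "B \<subseteq> chart_dom c"
  have "open (chart_inv c -` B \<inter> img c)"
    by (rule continuous_open_preimage[OF continuous_inv[OF c] open_img[OF c] B(1), simplified Int_commute])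
  moreover have "chart_map c ` B = chart_inv c -` B \<inter> img c"
    unfolding image_eq[OF c B(2)] by blast
  ultimately show ?thesis by simp
qed

lemma transition_derivative:
  assumes c: "c \<in> \<A>" "c' \<in> \<A>" and p: "p \<in> chart_dom c" "p \<in> chart_dom c'"
  shows "((chart_map c' \<circ> chart_inv c) has_derivative
      frechet_derivative (chart_map c' \<circ> chart_inv c) (at (chart_map c p))) (at (chart_map c p))"
  using smooth_on_has_derivative[OF transition_smooth[OF c]] p by auto

lemma jac_eq:
  assumes c: "c \<in> \<A>" "c' \<in> \<A>" and p: "p \<in> chart_dom c" "p \<in> chart_dom c'"
  shows "jac c c' p \<mu> \<nu> = frechet_derivative (chart_map c' \<circ> chart_inv c) (at (chart_map c p)) (axis \<nu> 1) $ \<mu>"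
proof -
  let ?T = "chart_map c' \<circ> chart_inv c"
  have "((\<lambda>x. ?T x $ \<mu>) has_derivative (\<lambda>v. frechet_derivative ?T (at (chart_map c p)) v $ \<mu>)) (at (chart_map c p))"
    by (rule bounded_linear.has_derivative[OF bounded_linear_vec_nth transition_derivative[OF assms]])
  from frechet_derivative_at[OF this] show ?thesis
    unfolding jac_def pd_def o_def by metis
qed

section \<open>The volume measure\<close>

text \<open>
  The inverse chart, made constant off the image so that it is Borel measurable on all of \<open>\<real>\<^sup>4\<close>.
\<close>

definition chart_param :: "'m chart \<Rightarrow> real^4 \<Rightarrow> 'm" where
  "chart_param c x = (if x \<in> img c then chart_inv c x else undefined)"

lemma measurable_if_open:
  fixes f :: "'x::topological_space \<Rightarrow> 'y::topological_space"
  assumes "open U" "continuous_on U f"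
  shows "(\<lambda>x. if x \<in> U then f x else d) \<in> borel_measurable borel"
proof (rule borel_measurableI)
  fix V :: "'y set" assume V: "open V"
  have "(\<lambda>x. if x \<in> U then f x else d) -` V \<inter> space borel = (U \<inter> f -` V) \<union> (if d \<in> V then - U else {})"
    by (auto split: if_splits)
  moreover have "open (U \<inter> f -` V)" by (rule continuous_open_preimage[OF assms(2,1) V])
  ultimately show "(\<lambda>x. if x \<in> U then f x else d) -` V \<inter> space borel \<in> sets borel"
    using assms(1) by auto
qed

lemma chart_param_measurable: "c \<in> \<A> \<Longrightarrow> chart_param c \<in> borel_measurable borel"
  unfolding chart_param_def[abs_def] by (intro measurable_if_open open_img continuous_inv)

lemma image_borel:
  assumes c: "c \<in> \<A>" and B: "B \<in> sets borel" "B \<subseteq> chart_dom c"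
  shows "chart_map c ` B \<in> sets borel"
proof -
  have "chart_map c ` B = (chart_param c -` B \<inter> space borel) \<inter> img c"
    unfolding image_eq[OF c B(2)] chart_param_def by auto
  moreover have "chart_param c -` B \<inter> space borel \<in> sets borel"
    by (rule measurable_sets[OF chart_param_measurable[OF c] B(1)])
  ultimately show ?thesis using open_img[OF c] by auto
qed

end

lemma nn_integral_eq_iff_absolutely_integrable:
  fixes g :: "real^'n \<Rightarrow> real"
  assumes S: "S \<in> sets borel" and g: "(\<lambda>x. indicator S x * g x) \<in> borel_measurable borel"
    and nn: "\<And>x. x \<in> S \<Longrightarrow> g x \<ge> 0" and r: "r \<ge> 0"
  shows "(\<integral>\<^sup>+x\<in>S. ennreal (g x) \<partial>lborel) = ennreal r \<longleftrightarrow> g absolutely_integrable_on S \<and> integral S g = r"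
proof -
  let ?h = "\<lambda>x. indicator S x * g x"
  have 1: "(\<integral>\<^sup>+x\<in>S. ennreal (g x) \<partial>lborel) = (\<integral>\<^sup>+x. ennreal (?h x) \<partial>lborel)"
    by (intro nn_integral_cong) (auto simp: indicator_def)
  have h0: "?h x \<ge> 0" for x using nn by (auto simp: indicator_def)
  have gl: "?h \<in> borel_measurable lborel" using g by simp
  have ai: "g absolutely_integrable_on S \<longleftrightarrow> integrable lborel ?h"
    unfolding set_integrable_def using integrable_completion[OF gl] by simp
  have int: "integral S g = (LINT x|lborel. ?h x)" if "g absolutely_integrable_on S"
  proof -
    have "integral S g = (LINT x|lebesgue. ?h x)"
      using set_lebesgue_integral_eq_integral(2)[OF that] by (simp add: set_lebesgue_integral_def)
    also have "\<dots> = (LINT x|lborel. ?h x)" by (rule integral_completion[OF gl])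
    finally show ?thesis .
  qed
  show ?thesis
  proof
    assume e: "(\<integral>\<^sup>+x\<in>S. ennreal (g x) \<partial>lborel) = ennreal r"
    have i: "integrable lborel ?h"
      by (rule integrableI_nonneg[OF gl]) (use h0 e 1 in auto)
    have "ennreal (LINT x|lborel. ?h x) = ennreal r"
      using nn_integral_eq_integral[OF i] h0 e 1 by simp
    moreover have "(LINT x|lborel. ?h x) \<ge> 0" by (intro integral_nonneg_AE) (use h0 in auto)
    ultimately have "(LINT x|lborel. ?h x) = r" using r by simp
    then show "g absolutely_integrable_on S \<and> integral S g = r" using ai i int by auto
  next
    assume a: "g absolutely_integrable_on S \<and> integral S g = r"
    then have i: "integrable lborel ?h" using ai by blast
    show "(\<integral>\<^sup>+x\<in>S. ennreal (g x) \<partial>lborel) = ennreal r"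
      unfolding 1 using nn_integral_eq_integral[OF i] h0 int a by simp
  qed
qed

text \<open>
  The change of variables formula for the Henstock-Kurzweil integral, as an equivalence between
  statements about finite values, determines the nonnegative integrals also when they are infinite.
\<close>

lemma nn_integral_change_of_variables:
  fixes T :: "real^4 \<Rightarrow> real^4" and f :: "real^4 \<Rightarrow> real"
  assumes S: "S \<in> sets borel" "T ` S \<in> sets borel"
    and T: "\<And>x. x \<in> S \<Longrightarrow> (T has_derivative T' x) (at x within S)" "inj_on T S"
    and f: "(\<lambda>y. indicator (T ` S) y * f y) \<in> borel_measurable borel"
    and g: "(\<lambda>x. indicator S x * g x) \<in> borel_measurable borel"
    and fg: "\<And>x. x \<in> S \<Longrightarrow> g x = \<bar>det (matrix (T' x))\<bar> * f (T x)"
    and f0: "\<And>y. y \<in> T ` S \<Longrightarrow> f y \<ge> 0"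
  shows "(\<integral>\<^sup>+x\<in>S. ennreal (g x) \<partial>lborel) = (\<integral>\<^sup>+y\<in>T ` S. ennreal (f y) \<partial>lborel)"
proof -
  have SL: "S \<in> sets lebesgue" using S(1) sets_completionI_sets[of S lborel] by simp
  have cov: "(\<lambda>x. \<bar>det (matrix (T' x))\<bar> * f (T x)) absolutely_integrable_on S
        \<and> integral S (\<lambda>x. \<bar>det (matrix (T' x))\<bar> * f (T x)) = r
     \<longleftrightarrow> f absolutely_integrable_on (T ` S) \<and> integral (T ` S) f = r" for r
    using has_absolute_integral_change_of_variables[OF SL T, of "\<lambda>y. (\<chi> i. f y) :: real^1" "\<chi> i. r"]
    unfolding absolutely_integrable_on_1_iff integral_on_1_eq by (simp add: vec_eq_iff)
  have gai: "g absolutely_integrable_on S \<longleftrightarrow> (\<lambda>x. \<bar>det (matrix (T' x))\<bar> * f (T x)) absolutely_integrable_on S"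
    by (rule set_integrable_cong) (use fg in auto)
  have gint: "integral S g = integral S (\<lambda>x. \<bar>det (matrix (T' x))\<bar> * f (T x))"
    by (rule integral_cong) (use fg in auto)
  have g0: "\<And>x. x \<in> S \<Longrightarrow> g x \<ge> 0" using fg f0 by auto
  have eq: "(\<integral>\<^sup>+x\<in>S. ennreal (g x) \<partial>lborel) = ennreal r \<longleftrightarrow> (\<integral>\<^sup>+y\<in>T ` S. ennreal (f y) \<partial>lborel) = ennreal r"
    if "r \<ge> 0" for r
    using nn_integral_eq_iff_absolutely_integrable[where g = g, OF S(1) g g0 that]
      nn_integral_eq_iff_absolutely_integrable[where g = f, OF S(2) f f0 that] cov[of r]
    unfolding gai gint by blast
  show ?thesis
  proof (cases "(\<integral>\<^sup>+x\<in>S. ennreal (g x) \<partial>lborel)")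
    case (real r)
    then show ?thesis using eq[of r] by metis
  next
    case top
    show ?thesis
    proof (cases "(\<integral>\<^sup>+y\<in>T ` S. ennreal (f y) \<partial>lborel)")
      case (real r)
      then show ?thesis using eq[of r] by metis
    next
      case top': top
      show ?thesis unfolding top top' ..
    qed
  qed
qed

text \<open>
  The densities \<open>\<bar>v\<bar>\<close> of a 4-form, which transform by the absolute value of the Jacobian under coordinate changes.
\<close>

locale atlas_density = atlas \<A> for \<A> :: "'m::{t2_space, second_countable_topology} chart set" +
  fixes v :: "'m field4"
  assumes v_continuous: "c \<in> \<A> \<Longrightarrow> continuous_on (img c) (\<lambda>x. v c (chart_inv c x) 1 2 3 4)"
    and v_transform: "c \<in> \<A> \<Longrightarrow> c' \<in> \<A> \<Longrightarrow> p \<in> chart_dom c \<Longrightarrow> p \<in> chart_dom c' \<Longrightarrow>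
      \<bar>v c p 1 2 3 4\<bar> = \<bar>det (\<chi> \<mu> \<nu>. jac c c' p \<mu> \<nu>)\<bar> * \<bar>v c' p 1 2 3 4\<bar>"
begin

definition dens :: "'m chart \<Rightarrow> real^4 \<Rightarrow> real" where
  "dens c x = (if x \<in> img c then \<bar>v c (chart_inv c x) 1 2 3 4\<bar> else 0)"

text \<open>
  The measure with density \<open>\<bar>v\<bar>\<close> on one chart.  It is extended by zero except that \<^const>\<open>chart_param\<close>
  sends the complement of the image, which has measure zero here, to an arbitrary point.
\<close>

definition chart_measure :: "'m chart \<Rightarrow> 'm measure" where
  "chart_measure c = distr (density lborel (\<lambda>x. ennreal (dens c x))) borel (chart_param c)"

lemma dens_measurable: "c \<in> \<A> \<Longrightarrow> dens c \<in> borel_measurable borel"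
  unfolding dens_def[abs_def] by (intro measurable_if_open open_img continuous_intros v_continuous)

lemma dens_nonneg: "dens c x \<ge> 0"
  by (simp add: dens_def)

lemma sets_chart_measure [simp]: "sets (chart_measure c) = sets borel"
  by (simp add: chart_measure_def)

lemma emeasure_chart_measure:
  assumes c: "c \<in> \<A>" and B: "B \<in> sets borel" "B \<subseteq> chart_dom c"
  shows "emeasure (chart_measure c) B = (\<integral>\<^sup>+x\<in>chart_map c ` B. ennreal (dens c x) \<partial>lborel)"
proof -
  have k: "chart_param c \<in> measurable (density lborel (\<lambda>x. ennreal (dens c x))) borel"
    using chart_param_measurable[OF c] by simp
  have s: "chart_param c -` B \<inter> space lborel \<in> sets lborel"
    using measurable_sets[OF chart_param_measurable[OF c] B(1)] by simp
  have "emeasure (chart_measure c) B = (\<integral>\<^sup>+x\<in>chart_param c -` B \<inter> space lborel. ennreal (dens c x) \<partial>lborel)"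
    unfolding chart_measure_def using dens_measurable[OF c] s
    by (simp add: emeasure_distr[OF k B(1)] emeasure_density)
  also have "\<dots> = (\<integral>\<^sup>+x\<in>chart_map c ` B. ennreal (dens c x) \<partial>lborel)"
    unfolding image_eq[OF c B(2)]
    by (intro nn_integral_cong) (auto simp: indicator_def dens_def chart_param_def)
  finally show ?thesis .
qed

lemma chart_measure_compatible:
  assumes c: "c \<in> \<A>" "c' \<in> \<A>" and B: "B \<in> sets borel" "B \<subseteq> chart_dom c" "B \<subseteq> chart_dom c'"
  shows "emeasure (chart_measure c) B = emeasure (chart_measure c') B"
proof -
  let ?T = "chart_map c' \<circ> chart_inv c" and ?S = "chart_map c ` B"
  let ?T' = "\<lambda>x. frechet_derivative ?T (at x)"
  have TS: "?T ` ?S = chart_map c' ` B"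
    using inv_chart[OF c(1)] B(2) by (force simp: image_image)
  have "(\<integral>\<^sup>+x\<in>?S. ennreal (dens c x) \<partial>lborel) = (\<integral>\<^sup>+y\<in>?T ` ?S. ennreal (dens c' y) \<partial>lborel)"
  proof (rule nn_integral_change_of_variables[where T' = ?T'])
    show S: "?S \<in> sets borel" by (rule image_borel[OF c(1) B(1,2)])
    show TSb: "?T ` ?S \<in> sets borel" unfolding TS by (rule image_borel[OF c(2) B(1,3)])
    show "(?T has_derivative ?T' x) (at x within ?S)" if "x \<in> ?S" for x
      using transition_derivative[OF c] that B by (auto intro: has_derivative_at_withinI)
    show "inj_on ?T ?S"
    proof (rule inj_onI)
      fix x y assume "x \<in> ?S" "y \<in> ?S" and e: "?T x = ?T y"
      then obtain p q where p: "p \<in> B" "x = chart_map c p" and q: "q \<in> B" "y = chart_map c q" by blast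
      then have "chart_map c' p = chart_map c' q" using e inv_chart[OF c(1)] B by (metis comp_apply subsetD)
      then have "p = q" using inv_chart[OF c(2)] p q B by (metis subsetD)
      then show "x = y" using p q by simp
    qed
    show "(\<lambda>y. indicator (?T ` ?S) y * dens c' y) \<in> borel_measurable borel"
      using TSb dens_measurable[OF c(2)] by (intro borel_measurable_times borel_measurable_indicator)
    show "(\<lambda>x. indicator ?S x * dens c x) \<in> borel_measurable borel"
      using S dens_measurable[OF c(1)] by (intro borel_measurable_times borel_measurable_indicator)
    show "dens c' y \<ge> 0" for y by (rule dens_nonneg)
    show "dens c x = \<bar>det (matrix (?T' x))\<bar> * dens c' (?T x)" if x: "x \<in> ?S" for x
    proof -
      obtain p where p: "p \<in> B" "x = chart_map c p" using x by (rule imageE)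
      then have pd: "p \<in> chart_dom c" "p \<in> chart_dom c'" using B by auto
      have m: "matrix (?T' x) = (\<chi> \<mu> \<nu>. jac c c' p \<mu> \<nu>)"
        unfolding matrix_def p by (simp add: jac_eq[OF c pd])
      show ?thesis
        unfolding m using v_transform[OF c pd] pd inv_chart[OF c(1)] inv_chart[OF c(2)]
        by (simp add: dens_def p)
    qed
  qed
  then show ?thesis
    unfolding emeasure_chart_measure[OF c(1) B(1,2)] emeasure_chart_measure[OF c(2) B(1,3)] TS .
qed

text \<open>
  The manifold is covered by countably many charts; cut it into disjoint Borel pieces, one in each of
  them, and add up the chart measures of the pieces.  On the overlaps the chart measures agree.
\<close>

lemma volume_measure_exists:
  "\<exists>M. sets M = sets borel \<and> (\<forall>c\<in>\<A>. \<forall>B\<in>sets borel. B \<subseteq> chart_dom c \<longrightarrow> emeasure M B = emeasure (chart_measure c) B)"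
proof -
  obtain \<F> where F: "\<F> \<subseteq> chart_dom ` \<A>" "countable \<F>" "\<Union>\<F> = \<Union>(chart_dom ` \<A>)"
    by (rule Lindelof[of "chart_dom ` \<A>"]) (auto intro: open_dom)
  have U: "\<Union>\<F> = UNIV" unfolding F(3) using smooth_atlas unfolding smooth_atlas_def by blast
  then have "\<F> \<noteq> {}" by auto
  define D where "D = from_nat_into \<F>"
  have D: "range D = \<F>" unfolding D_def by (rule range_from_nat_into[OF \<open>\<F> \<noteq> {}\<close> F(2)])
  have "\<exists>c\<in>\<A>. chart_dom c = D n" for n
  proof -
    have "D n \<in> chart_dom ` \<A>" using D F(1) by blast
    then show ?thesis by auto
  qed
  then obtain cc where cc: "\<And>n. cc n \<in> \<A>" "\<And>n. chart_dom (cc n) = D n" by metis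
  define A where "A = disjointed D"
  have A: "disjoint_family A" "\<And>n. A n \<subseteq> chart_dom (cc n)" "(\<Union>n. A n) = UNIV"
    unfolding A_def cc using D U by (simp_all add: disjoint_family_disjointed disjointed_subset UN_disjointed_eq)
  have Ab: "A n \<in> sets borel" for n
  proof -
    have "D m \<in> sets borel" for m using open_dom[OF cc(1)[of m]] unfolding cc(2) by simp
    then show ?thesis unfolding A_def disjointed_def by auto
  qed
  define \<mu> where "\<mu> B = (\<Sum>n. emeasure (chart_measure (cc n)) (B \<inter> A n))" for B
  define M where "M = measure_of UNIV (sets borel) \<mu>"
  have "emeasure M B = \<mu> B" if "B \<in> sets borel" for B
    unfolding M_def
  proof (rule emeasure_measure_of_sigma)
    show "sigma_algebra UNIV (sets borel :: 'm set set)" using sets.sigma_algebra_axioms[of "borel :: 'm measure"] by simp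
    show "positive (sets borel) \<mu>" by (simp add: positive_def \<mu>_def)
    show "countably_additive (sets borel) \<mu>"
      unfolding countably_additive_def
    proof (intro allI impI)
      fix X :: "nat \<Rightarrow> 'm set" assume X: "range X \<subseteq> sets borel" "disjoint_family X"
      have "(\<Sum>i. \<mu> (X i)) = (\<Sum>i. \<integral>\<^sup>+n. emeasure (chart_measure (cc n)) (X i \<inter> A n) \<partial>count_space UNIV)"
        unfolding \<mu>_def by (simp add: nn_integral_count_space_nat)
      \<comment> \<open>The two summations are exchanged by viewing one of them as an integral over the counting measure.\<close>
      also have "\<dots> = (\<integral>\<^sup>+n. (\<Sum>i. emeasure (chart_measure (cc n)) (X i \<inter> A n)) \<partial>count_space UNIV)"
        by (rule nn_integral_suminf[symmetric]) simp
      also have "\<dots> = (\<Sum>n. \<Sum>i. emeasure (chart_measure (cc n)) (X i \<inter> A n))"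
        by (simp add: nn_integral_count_space_nat)
      also have "\<dots> = (\<Sum>n. emeasure (chart_measure (cc n)) ((\<Union>i. X i) \<inter> A n))"
      proof (rule suminf_cong)
        fix n
        have "(\<Sum>i. emeasure (chart_measure (cc n)) (X i \<inter> A n)) = emeasure (chart_measure (cc n)) (\<Union>i. X i \<inter> A n)"
          using X Ab by (intro suminf_emeasure) (auto simp: disjoint_family_on_def)
        then show "(\<Sum>i. emeasure (chart_measure (cc n)) (X i \<inter> A n)) = emeasure (chart_measure (cc n)) ((\<Union>i. X i) \<inter> A n)"
          by (simp add: Int_UN_distrib2)
      qed
      finally show "(\<Sum>i. \<mu> (X i)) = \<mu> (\<Union>i. X i)" unfolding \<mu>_def .
    qed
    show "B \<in> sets borel" by fact
  qed
  moreover have "sets M = sets borel"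
    unfolding M_def using sets.sigma_sets_eq[of "borel :: 'm measure"] by (simp add: sets_measure_of_conv)
  moreover have "\<mu> B = emeasure (chart_measure c) B" if c: "c \<in> \<A>" and B: "B \<in> sets borel" "B \<subseteq> chart_dom c" for c B
  proof -
    have "emeasure (chart_measure (cc n)) (B \<inter> A n) = emeasure (chart_measure c) (B \<inter> A n)" for n
      using A(2)[of n] B Ab[of n] by (intro chart_measure_compatible cc c) auto
    then have "\<mu> B = (\<Sum>n. emeasure (chart_measure c) (B \<inter> A n))" unfolding \<mu>_def by simp
    also have "\<dots> = emeasure (chart_measure c) (\<Union>n. B \<inter> A n)"
      using A(1) B Ab by (intro suminf_emeasure) (auto simp: disjoint_family_on_def)
    also have "(\<Union>n. B \<inter> A n) = B" using A(3) by blast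
    finally show ?thesis .
  qed
  ultimately show ?thesis by metis
qed

lemma volume_measure:
  "sets (volume_measure \<A> v) = sets borel"
  "c \<in> \<A> \<Longrightarrow> B \<in> sets borel \<Longrightarrow> B \<subseteq> chart_dom c \<Longrightarrow> emeasure (volume_measure \<A> v) B = emeasure (chart_measure c) B"
proof -
  have e: "emeasure (chart_measure c) B = (\<integral>\<^sup>+x\<in>chart_map c ` B. ennreal \<bar>v c (chart_inv c x) 1 2 3 4\<bar> \<partial>lborel)"
    if "c \<in> \<A>" "B \<in> sets borel" "B \<subseteq> chart_dom c" for c B
    unfolding emeasure_chart_measure[OF that]
    by (intro nn_integral_cong) (use that in \<open>auto simp: indicator_def dens_def\<close>)
  have ex: "\<exists>M. sets M = sets borel \<and> (\<forall>c\<in>\<A>. \<forall>B\<in>sets borel. B \<subseteq> chart_dom c \<longrightarrow>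
        emeasure M B = (\<integral>\<^sup>+x\<in>chart_map c ` B. ennreal \<bar>v c (chart_inv c x) 1 2 3 4\<bar> \<partial>lborel))"
  proof -
    obtain M where M: "sets M = sets borel"
      "\<forall>c\<in>\<A>. \<forall>B\<in>sets borel. B \<subseteq> chart_dom c \<longrightarrow> emeasure M B = emeasure (chart_measure c) B"
      using volume_measure_exists by blast
    show ?thesis
    proof (intro exI[of _ M] conjI ballI impI M(1))
      fix c B assume "c \<in> \<A>" "B \<in> sets borel" "B \<subseteq> chart_dom c"
      then show "emeasure M B = (\<integral>\<^sup>+x\<in>chart_map c ` B. ennreal \<bar>v c (chart_inv c x) 1 2 3 4\<bar> \<partial>lborel)"
        using M(2) e[of c B] by (simp only:)
    qed
  qed
  have *: "sets (volume_measure \<A> v) = sets borel \<and> (\<forall>c\<in>\<A>. \<forall>B\<in>sets borel. B \<subseteq> chart_dom c \<longrightarrow>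
        emeasure (volume_measure \<A> v) B = (\<integral>\<^sup>+x\<in>chart_map c ` B. ennreal \<bar>v c (chart_inv c x) 1 2 3 4\<bar> \<partial>lborel))"
    unfolding volume_measure_def by (rule someI_ex[OF ex])
  then show "sets (volume_measure \<A> v) = sets borel" by blast
  show "c \<in> \<A> \<Longrightarrow> B \<in> sets borel \<Longrightarrow> B \<subseteq> chart_dom c \<Longrightarrow> emeasure (volume_measure \<A> v) B = emeasure (chart_measure c) B"
    using * e by simp
qed

text \<open>
  The integral of a function against the volume measure, written in the coordinates of \<open>c\<close>.
\<close>

definition chart_lint :: "'m chart \<Rightarrow> ('m \<Rightarrow> real) \<Rightarrow> real" where
  "chart_lint c f = (LINT x|lborel. indicator (img c) x * (\<bar>v c (chart_inv c x) 1 2 3 4\<bar> * f (chart_inv c x)))"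

lemma integral_volume_measure_chart:
  fixes f :: "'m \<Rightarrow> real"
  assumes c: "c \<in> \<A>" and f: "f \<in> borel_measurable borel" and f0: "\<And>p. p \<notin> chart_dom c \<Longrightarrow> f p = 0"
  shows "(LINT p|volume_measure \<A> v. f p) = chart_lint c f"
proof -
  let ?M = "volume_measure \<A> v" and ?D = "chart_dom c"
  have Db: "?D \<in> sets borel" using open_dom[OF c] by simp
  have sp: "space ?M = UNIV" using sets_eq_imp_space_eq[OF volume_measure(1)] by simp
  have fM: "f \<in> borel_measurable ?M" using f measurable_cong_sets[OF volume_measure(1) refl] by blast
  have e: "density ?M (indicator ?D) = chart_measure c"
  proof (rule measure_eqI)
    show "sets (density ?M (indicator ?D)) = sets (chart_measure c)" by (simp add: volume_measure(1))
    fix B assume "B \<in> sets (density ?M (indicator ?D))"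
    then have B: "B \<in> sets borel" by (simp add: volume_measure(1))
    have "emeasure (density ?M (indicator ?D)) B = emeasure ?M (?D \<inter> B)"
    proof -
      have m: "(indicator ?D :: 'm \<Rightarrow> ennreal) \<in> borel_measurable ?M" and BM: "B \<in> sets ?M" and DB: "?D \<inter> B \<in> sets ?M"
        using B Db volume_measure(1) by auto
      have "emeasure (density ?M (indicator ?D)) B = (\<integral>\<^sup>+x. indicator ?D x * indicator B x \<partial>?M)"
        by (rule emeasure_density[OF m BM])
      also have "\<dots> = (\<integral>\<^sup>+x. indicator (?D \<inter> B) x \<partial>?M)"
        by (intro nn_integral_cong) (auto simp: indicator_def)
      finally show ?thesis using nn_integral_indicator[OF DB] by (simp only:)
    qed
    also have "\<dots> = emeasure (chart_measure c) (?D \<inter> B)" using B Db by (intro volume_measure(2)[OF c]) auto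
    also have "\<dots> = emeasure (chart_measure c) B"
    proof -
      have k: "chart_param c \<in> measurable (density lborel (\<lambda>x. ennreal (dens c x))) borel"
        using chart_param_measurable[OF c] by simp
      have m: "chart_param c -` B \<inter> space lborel \<in> sets lborel" if "B \<in> sets borel" for B
        using measurable_sets[OF chart_param_measurable[OF c] that] by simp
      have DB: "?D \<inter> B \<in> sets borel" using Db B by simp
      show ?thesis
        unfolding chart_measure_def emeasure_distr[OF k B] emeasure_distr[OF k DB]
        using m[OF B] m[OF DB] dens_measurable[OF c]
        by (simp add: emeasure_density)
           (intro nn_integral_cong, auto simp: indicator_def dens_def chart_param_def chart_inv_in[OF c])
    qed
    finally show "emeasure (density ?M (indicator ?D)) B = emeasure (chart_measure c) B" .
  qed
  have "(LINT p|?M. f p) = (LINT p|?M. indicator ?D p *\<^sub>R f p)"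
    by (intro Bochner_Integration.integral_cong refl) (auto simp: indicator_def f0)
  also have "\<dots> = (LINT p|density ?M (\<lambda>p. ennreal (indicator ?D p)). f p)"
    using fM Db volume_measure(1) by (intro integral_density[symmetric]) auto
  also have "(\<lambda>p. ennreal (indicator ?D p)) = indicator ?D" by (auto simp: indicator_def)
  also have "(LINT p|density ?M (indicator ?D). f p) = (LINT p|chart_measure c. f p)" unfolding e ..
  also have "\<dots> = (LINT x|density lborel (\<lambda>x. ennreal (dens c x)). f (chart_param c x))"
    unfolding chart_measure_def using chart_param_measurable[OF c] f by (intro integral_distr) auto
  also have "\<dots> = (LINT x|lborel. dens c x *\<^sub>R f (chart_param c x))"
    using dens_measurable[OF c] measurable_compose[OF chart_param_measurable[OF c] f] dens_nonneg
    by (intro integral_density) auto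
  also have "\<dots> = chart_lint c f"
    unfolding chart_lint_def
    by (intro Bochner_Integration.integral_cong refl) (auto simp: indicator_def dens_def chart_param_def)
  finally show ?thesis .
qed

end


section \<open>Pull-back of three-forms\<close>

lemma frechet_derivative_cong_open:
  assumes "open V" "x \<in> V" "\<And>y. y \<in> V \<Longrightarrow> f y = g y"
  shows "frechet_derivative f (at x) = frechet_derivative g (at x)"
proof -
  have "(f has_derivative f') (at x) \<longleftrightarrow> (g has_derivative f') (at x)" for f'
    using has_derivative_transform_within_open[OF _ assms(1,2), of f f' UNIV g]
      has_derivative_transform_within_open[OF _ assms(1,2), of g f' UNIV f] assms(3) by auto
  then show ?thesis unfolding frechet_derivative_def by simp
qed

definition pull3 :: "(4 \<Rightarrow> 4 \<Rightarrow> real) \<Rightarrow> (4 \<Rightarrow> 4 \<Rightarrow> 4 \<Rightarrow> real) \<Rightarrow> 4 \<Rightarrow> 4 \<Rightarrow> 4 \<Rightarrow> real" where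
  "pull3 J T \<mu> \<nu> \<rho> = (\<Sum>\<alpha>\<in>UNIV. \<Sum>\<beta>\<in>UNIV. \<Sum>\<gamma>\<in>UNIV. T \<alpha> \<beta> \<gamma> * (J \<alpha> \<mu> * J \<beta> \<nu> * J \<gamma> \<rho>))"

lemma pull3_add: "pull3 J (\<lambda>\<mu> \<nu> \<rho>. X \<mu> \<nu> \<rho> + Y \<mu> \<nu> \<rho>) \<mu> \<nu> \<rho> = pull3 J X \<mu> \<nu> \<rho> + pull3 J Y \<mu> \<nu> \<rho>"
  unfolding pull3_def by (simp add: distrib_right sum.distrib)

lemma pull3_scale: "pull3 J (\<lambda>\<mu> \<nu> \<rho>. c * X \<mu> \<nu> \<rho>) \<mu> \<nu> \<rho> = c * pull3 J X \<mu> \<nu> \<rho>"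
  unfolding pull3_def by (simp add: sum_distrib_left mult_ac)

lemma pull3_cyclic: "pull3 J (\<lambda>\<mu> \<nu> \<rho>. X \<nu> \<rho> \<mu>) \<mu> \<nu> \<rho> = pull3 J X \<nu> \<rho> \<mu>"
  unfolding pull3_def by (subst sum_cyclic3) (simp only: mult_ac)

lemma pull1_pull2_product: "pull1 J a \<mu> * pull2 J s \<nu> \<rho> = pull3 J (\<lambda>\<alpha> \<beta> \<gamma>. a \<alpha> * s \<beta> \<gamma>) \<mu> \<nu> \<rho>"
  unfolding pull1_def pull2_def pull3_def
  by (simp only: sum_distrib_right, simp only: sum_distrib_left) (simp only: mult_ac)

lemma wedge12_pull: "wedge12 (pull1 J a) (pull2 J s) = pull3 J (wedge12 a s)"
proof (intro ext)
  fix \<mu> \<nu> \<rho>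
  let ?X = "\<lambda>\<alpha> \<beta> \<gamma>. a \<alpha> * s \<beta> \<gamma>"
  have 1: "pull3 J (\<lambda>\<mu> \<nu> \<rho>. ?X \<nu> \<rho> \<mu>) \<mu> \<nu> \<rho> = pull3 J ?X \<nu> \<rho> \<mu>" by (rule pull3_cyclic)
  have 2: "pull3 J (\<lambda>\<mu> \<nu> \<rho>. ?X \<rho> \<mu> \<nu>) \<mu> \<nu> \<rho> = pull3 J ?X \<rho> \<mu> \<nu>"
    using pull3_cyclic[of J "\<lambda>\<mu> \<nu> \<rho>. ?X \<nu> \<rho> \<mu>" \<mu> \<nu> \<rho>] pull3_cyclic[of J ?X \<nu> \<rho> \<mu>] by simp
  show "wedge12 (pull1 J a) (pull2 J s) \<mu> \<nu> \<rho> = pull3 J (wedge12 a s) \<mu> \<nu> \<rho>"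
    unfolding wedge12_def pull1_pull2_product pull3_add 1 2 ..
qed

context atlas begin

section \<open>Smooth functions and partial derivatives in a chart\<close>

lemma smooth_in_chart_cong:
  "c \<in> \<A> \<Longrightarrow> (\<And>p. p \<in> chart_dom c \<Longrightarrow> f p = g p) \<Longrightarrow> smooth_in_chart c f \<Longrightarrow> smooth_in_chart c g"
  unfolding smooth_in_chart_def
  by (rule smooth_on_cong[OF open_img]) (auto simp: inv_chart)

lemma
  assumes c: "c \<in> \<A>"
  shows smooth_in_chart_const: "smooth_in_chart c (\<lambda>p. k)"
    and smooth_in_chart_add: "smooth_in_chart c f \<Longrightarrow> smooth_in_chart c h \<Longrightarrow> smooth_in_chart c (\<lambda>p. f p + h p)"
    and smooth_in_chart_mult: "smooth_in_chart c f \<Longrightarrow> smooth_in_chart c h \<Longrightarrow> smooth_in_chart c (\<lambda>p. f p * h p)"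
    and smooth_in_chart_minus: "smooth_in_chart c f \<Longrightarrow> smooth_in_chart c (\<lambda>p. - f p)"
    and smooth_in_chart_diff: "smooth_in_chart c f \<Longrightarrow> smooth_in_chart c h \<Longrightarrow> smooth_in_chart c (\<lambda>p. f p - h p)"
    and smooth_in_chart_divide: "smooth_in_chart c f \<Longrightarrow> smooth_in_chart c h \<Longrightarrow>
      (\<And>p. p \<in> chart_dom c \<Longrightarrow> h p \<noteq> 0) \<Longrightarrow> smooth_in_chart c (\<lambda>p. f p / h p)"
    and smooth_in_chart_sum: "(\<And>i. i \<in> I \<Longrightarrow> smooth_in_chart c (F i)) \<Longrightarrow> smooth_in_chart c (\<lambda>p. \<Sum>i\<in>I. F i p)"
    and smooth_in_chart_prod: "(\<And>i. i \<in> I \<Longrightarrow> smooth_in_chart c (F i)) \<Longrightarrow> smooth_in_chart c (\<lambda>p. \<Prod>i\<in>I. F i p)"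
  unfolding smooth_in_chart_def o_def
  using open_img[OF c] chart_inv_in[OF c]
  by (auto intro: smooth_on_const smooth_on_add smooth_on_mult smooth_on_minus smooth_on_diff smooth_on_divide
      smooth_on_sum smooth_on_prod)

lemma smooth_in_chart_power2: "c \<in> \<A> \<Longrightarrow> smooth_in_chart c f \<Longrightarrow> smooth_in_chart c (\<lambda>p. (f p)^2)"
  unfolding power2_eq_square by (rule smooth_in_chart_mult)

lemmas smooth_chart_intros = smooth_in_chart_const smooth_in_chart_add smooth_in_chart_mult smooth_in_chart_minus
  smooth_in_chart_diff smooth_in_chart_divide smooth_in_chart_sum smooth_in_chart_prod smooth_in_chart_power2

definition diff_at :: "'m chart \<Rightarrow> 'm \<Rightarrow> ('m \<Rightarrow> real) \<Rightarrow> bool" where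
  "diff_at c p f \<longleftrightarrow> (f \<circ> chart_inv c) differentiable (at (chart_map c p))"

lemma smooth_in_chart_diff_at:
  "smooth_in_chart c f \<Longrightarrow> p \<in> chart_dom c \<Longrightarrow> diff_at c p f"
  unfolding smooth_in_chart_def diff_at_def using smooth_on_differentiable by blast

lemma diff_at_deriv:
  "diff_at c p f \<Longrightarrow> ((f \<circ> chart_inv c) has_derivative frechet_derivative (f \<circ> chart_inv c) (at (chart_map c p))) (at (chart_map c p))"
  unfolding diff_at_def using frechet_derivative_works by blast

lemma
  assumes f: "diff_at c p f" and h: "diff_at c p h"
    and cp: "chart_inv c (chart_map c p) = p"
  shows pd_add: "pd c \<mu> (\<lambda>q. f q + h q) p = pd c \<mu> f p + pd c \<mu> h p"
    and pd_mult: "pd c \<mu> (\<lambda>q. f q * h q) p = pd c \<mu> f p * h p + f p * pd c \<mu> h p"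
    and diff_at_add: "diff_at c p (\<lambda>q. f q + h q)"
    and diff_at_mult: "diff_at c p (\<lambda>q. f q * h q)"
proof -
  note d = has_derivative_add[OF diff_at_deriv[OF f] diff_at_deriv[OF h]]
    has_derivative_mult[OF diff_at_deriv[OF f] diff_at_deriv[OF h]]
  show "pd c \<mu> (\<lambda>q. f q + h q) p = pd c \<mu> f p + pd c \<mu> h p"
    using fun_cong[OF frechet_derivative_at[OF d(1)], of "axis \<mu> 1"] unfolding pd_def o_def by simp
  show "pd c \<mu> (\<lambda>q. f q * h q) p = pd c \<mu> f p * h p + f p * pd c \<mu> h p"
    using fun_cong[OF frechet_derivative_at[OF d(2)], of "axis \<mu> 1"] unfolding pd_def o_def by (simp add: cp)
  show "diff_at c p (\<lambda>q. f q + h q)" "diff_at c p (\<lambda>q. f q * h q)"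
    using d unfolding diff_at_def o_def differentiable_def by blast+
qed

lemma pd_const: "pd c \<mu> (\<lambda>q. k) p = 0"
  unfolding pd_def o_def by simp

lemma pd_minus: "diff_at c p f \<Longrightarrow> pd c \<mu> (\<lambda>q. - f q) p = - pd c \<mu> f p"
proof -
  assume f: "diff_at c p f"
  show ?thesis
    using fun_cong[OF frechet_derivative_at[OF has_derivative_minus[OF diff_at_deriv[OF f]]], of "axis \<mu> 1"]
    unfolding pd_def o_def by simp
qed

lemma
  fixes F :: "4 \<Rightarrow> 'm \<Rightarrow> real"
  assumes "\<And>i. diff_at c p (F i)" and "chart_inv c (chart_map c p) = p"
  shows pd_sum: "pd c \<mu> (\<lambda>q. \<Sum>i\<in>UNIV. F i q) p = (\<Sum>i\<in>UNIV. pd c \<mu> (F i) p)"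
    and diff_at_sum: "diff_at c p (\<lambda>q. \<Sum>i\<in>UNIV. F i q)"
  unfolding sum_4 by (simp_all add: pd_add diff_at_add assms)

lemma pd_cong:
  assumes c: "c \<in> \<A>" and V: "open V" "p \<in> V" "V \<subseteq> chart_dom c" and fg: "\<And>q. q \<in> V \<Longrightarrow> f q = h q"
  shows "pd c \<mu> f p = pd c \<mu> h p"
proof -
  have "open (chart_map c ` V)" by (rule open_image[OF c V(1,3)])
  then show ?thesis
    unfolding pd_def using V inv_chart[OF c]
    by (subst frechet_derivative_cong_open[of "chart_map c ` V" _ _ "h \<circ> chart_inv c"]) (auto simp: fg subset_iff)
qed

lemma pd_cong_dom: "c \<in> \<A> \<Longrightarrow> p \<in> chart_dom c \<Longrightarrow> (\<And>q. q \<in> chart_dom c \<Longrightarrow> f q = h q) \<Longrightarrow> pd c \<mu> f p = pd c \<mu> h p"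
  by (rule pd_cong[OF _ open_dom]) auto

lemma smooth_in_chart_pd:
  assumes c: "c \<in> \<A>" and f: "smooth_in_chart c f"
  shows "smooth_in_chart c (\<lambda>p. pd c \<mu> f p)"
  unfolding smooth_in_chart_def
proof (rule smooth_on_cong[OF open_img[OF c]])
  show "smooth_on (\<lambda>x. frechet_derivative (f \<circ> chart_inv c) (at x) (axis \<mu> 1)) (img c)"
    using f unfolding smooth_in_chart_def by (rule smooth_on_frechet)
qed (auto simp: pd_def inv_chart[OF c])

lemma pd_commute:
  assumes c: "c \<in> \<A>" and V: "open V" "p \<in> V" "V \<subseteq> chart_dom c"
    and F: "smooth_on (F \<circ> chart_inv c) (chart_map c ` V)"
  shows "pd c \<mu> (\<lambda>q. pd c \<nu> F q) p = pd c \<nu> (\<lambda>q. pd c \<mu> F q) p"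
proof -
  let ?V = "chart_map c ` V" and ?F = "F \<circ> chart_inv c"
  have o: "open ?V" by (rule open_image[OF c V(1,3)])
  have x: "chart_map c p \<in> ?V" using V by blast
  have e: "pd c \<mu> (\<lambda>q. pd c \<nu> F q) p = frechet_derivative (\<lambda>y. frechet_derivative ?F (at y) (axis \<nu> 1)) (at (chart_map c p)) (axis \<mu> 1)" for \<mu> \<nu>
    unfolding pd_def using V inv_chart[OF c]
    by (subst frechet_derivative_cong_open[OF o x, of _ "\<lambda>y. frechet_derivative ?F (at y) (axis \<nu> 1)"]) (auto simp: subset_iff)
  show ?thesis unfolding e using F by (intro frechet_derivative_commute[OF _ o x]) (simp only: smooth_on_def)
qed

lemma transition_component_smooth:
  assumes c: "c \<in> \<A>" "c' \<in> \<A>"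
  shows "smooth_on ((\<lambda>q. chart_map c' q $ \<mu>) \<circ> chart_inv c) (chart_map c ` (chart_dom c \<inter> chart_dom c'))"
  using smooth_on_vec_nth[OF open_image[OF c(1)] transition_smooth[OF c], of \<mu>] open_dom c
  by (simp add: o_def open_Int)

lemma jac_diff_at:
  assumes c: "c \<in> \<A>" "c' \<in> \<A>" and p: "p \<in> chart_dom c" "p \<in> chart_dom c'"
  shows "diff_at c p (\<lambda>q. jac c c' q \<mu> \<nu>)"
proof -
  let ?F = "(\<lambda>q. chart_map c' q $ \<mu>) \<circ> chart_inv c" and ?V = "chart_dom c \<inter> chart_dom c'"
  have o: "open (chart_map c ` ?V)" by (rule open_image[OF c(1)]) (auto intro: open_dom c)
  have s: "smooth_on (\<lambda>x. frechet_derivative ?F (at x) (axis \<nu> 1)) (chart_map c ` ?V)"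
    by (rule smooth_on_frechet[OF transition_component_smooth[OF c]])
  have "smooth_on ((\<lambda>q. jac c c' q \<mu> \<nu>) \<circ> chart_inv c) (chart_map c ` ?V)"
    by (rule smooth_on_cong[OF o _ s]) (auto simp: jac_def pd_def inv_chart[OF c(1)])
  then show ?thesis unfolding diff_at_def by (rule smooth_on_differentiable) (use p in auto)
qed

text \<open>
  Second derivatives of the coordinate change; their symmetry makes the exterior derivative a tensor.
\<close>

lemma jac_symmetric:
  assumes c: "c \<in> \<A>" "c' \<in> \<A>" and p: "p \<in> chart_dom c" "p \<in> chart_dom c'"
  shows "pd c \<rho> (\<lambda>q. jac c c' q \<alpha> \<mu>) p = pd c \<mu> (\<lambda>q. jac c c' q \<alpha> \<rho>) p"
  unfolding jac_def
  by (rule pd_commute[OF c(1), of "chart_dom c \<inter> chart_dom c'"])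
     (auto intro: open_dom c p transition_component_smooth)

lemma pd_chain:
  assumes c: "c \<in> \<A>" "c' \<in> \<A>" and p: "p \<in> chart_dom c" "p \<in> chart_dom c'" and f: "diff_at c' p f"
  shows "pd c \<rho> f p = (\<Sum>\<gamma>\<in>UNIV. pd c' \<gamma> f p * jac c c' p \<gamma> \<rho>)" and "diff_at c p f"
proof -
  let ?T = "chart_map c' \<circ> chart_inv c" and ?V = "chart_dom c \<inter> chart_dom c'"
  let ?x = "chart_map c p"
  have o: "open (chart_map c ` ?V)" by (rule open_image[OF c(1)]) (auto intro: open_dom c)
  have Tx: "?T ?x = chart_map c' p" using inv_chart[OF c(1) p(1)] by simp
  note dT = transition_derivative[OF c p]
  let ?f' = "frechet_derivative (f \<circ> chart_inv c') (at (chart_map c' p))"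
  have df: "((f \<circ> chart_inv c') has_derivative ?f') (at (?T ?x))"
    unfolding Tx by (rule diff_at_deriv[OF f])
  have "((\<lambda>x. (f \<circ> chart_inv c') (?T x)) has_derivative (\<lambda>v. ?f' (frechet_derivative ?T (at ?x) v))) (at ?x)"
    by (rule has_derivative_compose[OF dT df])
  then have d: "((f \<circ> chart_inv c) has_derivative (\<lambda>v. ?f' (frechet_derivative ?T (at ?x) v))) (at ?x)"
    by (rule has_derivative_transform_within_open[OF _ o]) (use p inv_chart[OF c(1)] inv_chart[OF c(2)] in auto)
  then show "diff_at c p f" unfolding diff_at_def differentiable_def by blast
  have lin: "linear ?f'" using df has_derivative_linear by blast
  have expand: "?f' v = (\<Sum>\<gamma>\<in>UNIV. ?f' (axis \<gamma> 1) * v $ \<gamma>)" for v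
  proof -
    have "?f' v = ?f' (\<Sum>i\<in>UNIV. (v $ i) *\<^sub>R axis i 1)"
      using basis_expansion[of v] by (simp add: scalar_mult_eq_scaleR)
    then show ?thesis using lin by (simp add: linear_sum linear_cmul mult.commute)
  qed
  have "pd c \<rho> f p = ?f' (frechet_derivative ?T (at ?x) (axis \<rho> 1))"
    using fun_cong[OF frechet_derivative_at[OF d], of "axis \<rho> 1"] unfolding pd_def by simp
  then show "pd c \<rho> f p = (\<Sum>\<gamma>\<in>UNIV. pd c' \<gamma> f p * jac c c' p \<gamma> \<rho>)"
    unfolding jac_eq[OF c p] expand[of "frechet_derivative ?T (at ?x) (axis \<rho> 1)"] unfolding pd_def .
qed

section \<open>The exterior derivative is a tensor\<close>

lemma one_form_pull:
  "one_form \<A> \<omega> \<Longrightarrow> c \<in> \<A> \<Longrightarrow> c' \<in> \<A> \<Longrightarrow> p \<in> chart_dom c \<Longrightarrow> p \<in> chart_dom c' \<Longrightarrow>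
    \<omega> c p = pull1 (jac c c' p) (\<omega> c' p)"
  unfolding one_form_def pull1_def by (intro ext) blast

lemma tensor2_pull:
  "tensor2 \<A> T \<Longrightarrow> c \<in> \<A> \<Longrightarrow> c' \<in> \<A> \<Longrightarrow> p \<in> chart_dom c \<Longrightarrow> p \<in> chart_dom c' \<Longrightarrow>
    T c p = pull2 (jac c c' p) (T c' p)"
  unfolding tensor2_def pull2_def by (intro ext) blast

lemma ext_d1_pull:
  assumes w: "one_form \<A> \<omega>" and c: "c \<in> \<A>" "c' \<in> \<A>" and p: "p \<in> chart_dom c" "p \<in> chart_dom c'"
  shows "ext_d1 \<omega> c p = pull2 (jac c c' p) (ext_d1 \<omega> c' p)"
proof (intro ext)
  fix \<mu> \<nu>
  let ?J = "jac c c'"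
  note cp = inv_chart[OF c(1) p(1)]
  have dw: "diff_at c' p (\<lambda>q. \<omega> c' q \<alpha>)" for \<alpha>
    using w c p unfolding one_form_def by (intro smooth_in_chart_diff_at) auto
  have D: "pd c \<rho> (\<lambda>q. \<omega> c q \<kappa>) p
      = (\<Sum>\<alpha>\<in>UNIV. \<Sum>\<gamma>\<in>UNIV. pd c' \<gamma> (\<lambda>q. \<omega> c' q \<alpha>) p * ?J p \<gamma> \<rho> * ?J p \<alpha> \<kappa>)
        + (\<Sum>\<alpha>\<in>UNIV. \<omega> c' p \<alpha> * pd c \<rho> (\<lambda>q. ?J q \<alpha> \<kappa>) p)" for \<rho> \<kappa>
  proof -
    have "pd c \<rho> (\<lambda>q. \<omega> c q \<kappa>) p = pd c \<rho> (\<lambda>q. \<Sum>\<alpha>\<in>UNIV. \<omega> c' q \<alpha> * ?J q \<alpha> \<kappa>) p"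
    proof (rule pd_cong[OF c(1), of "chart_dom c \<inter> chart_dom c'"])
      show "\<omega> c q \<kappa> = (\<Sum>\<alpha>\<in>UNIV. \<omega> c' q \<alpha> * ?J q \<alpha> \<kappa>)" if "q \<in> chart_dom c \<inter> chart_dom c'" for q
        using one_form_pull[OF w c, of q] that by (simp add: pull1_def)
    qed (use c p in \<open>auto intro: open_dom\<close>)
    also have "\<dots> = (\<Sum>\<alpha>\<in>UNIV. pd c \<rho> (\<lambda>q. \<omega> c' q \<alpha>) p * ?J p \<alpha> \<kappa> + \<omega> c' p \<alpha> * pd c \<rho> (\<lambda>q. ?J q \<alpha> \<kappa>) p)"
      by (subst pd_sum) (auto intro!: diff_at_mult pd_chain(2)[OF c p dw] jac_diff_at[OF c p] cp
          sum.cong pd_mult[OF pd_chain(2)[OF c p dw] jac_diff_at[OF c p] cp])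
    finally show ?thesis
      unfolding pd_chain(1)[OF c p dw] by (simp add: sum.distrib sum_distrib_right)
  qed
  have sym: "pd c \<mu> (\<lambda>q. ?J q \<alpha> \<nu>) p = pd c \<nu> (\<lambda>q. ?J q \<alpha> \<mu>) p" for \<alpha>
    by (rule jac_symmetric[OF c p])
  have "ext_d1 \<omega> c p \<mu> \<nu> = (\<Sum>\<alpha>\<in>UNIV. \<Sum>\<gamma>\<in>UNIV. pd c' \<gamma> (\<lambda>q. \<omega> c' q \<alpha>) p * ?J p \<gamma> \<mu> * ?J p \<alpha> \<nu>)
     - (\<Sum>\<alpha>\<in>UNIV. \<Sum>\<gamma>\<in>UNIV. pd c' \<gamma> (\<lambda>q. \<omega> c' q \<alpha>) p * ?J p \<gamma> \<nu> * ?J p \<alpha> \<mu>)"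
    unfolding ext_d1_def D[of \<mu> \<nu>] D[of \<nu> \<mu>] sym by simp
  also have "\<dots> = (\<Sum>\<gamma>\<in>UNIV. \<Sum>\<alpha>\<in>UNIV. pd c' \<gamma> (\<lambda>q. \<omega> c' q \<alpha>) p * ?J p \<gamma> \<mu> * ?J p \<alpha> \<nu>)
     - (\<Sum>\<alpha>\<in>UNIV. \<Sum>\<gamma>\<in>UNIV. pd c' \<gamma> (\<lambda>q. \<omega> c' q \<alpha>) p * ?J p \<gamma> \<nu> * ?J p \<alpha> \<mu>)"
    by (subst sum.swap) (rule refl)
  also have "\<dots> = pull2 (?J p) (ext_d1 \<omega> c' p) \<mu> \<nu>"
    unfolding pull2_def ext_d1_def by (simp add: sum_subtractf[symmetric] algebra_simps)
  finally show "ext_d1 \<omega> c p \<mu> \<nu> = pull2 (?J p) (ext_d1 \<omega> c' p) \<mu> \<nu>" .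
qed

lemma ext_d1_two_form: "one_form \<A> \<omega> \<Longrightarrow> two_form \<A> (ext_d1 \<omega>)"
proof -
  assume w: "one_form \<A> \<omega>"
  have sm: "smooth_in_chart c (\<lambda>p. ext_d1 \<omega> c p \<mu> \<nu>)" if "c \<in> \<A>" for c \<mu> \<nu>
    unfolding ext_d1_def using that w unfolding one_form_def
    by (intro smooth_in_chart_diff smooth_in_chart_pd) auto
  have tr: "ext_d1 \<omega> c p \<mu> \<nu> = (\<Sum>\<alpha>\<in>UNIV. \<Sum>\<beta>\<in>UNIV. ext_d1 \<omega> c' p \<alpha> \<beta> * jac c c' p \<alpha> \<mu> * jac c c' p \<beta> \<nu>)"
    if "c \<in> \<A>" "c' \<in> \<A>" "p \<in> chart_dom c" "p \<in> chart_dom c'" for c c' p \<mu> \<nu>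
    using ext_d1_pull[OF w that] unfolding pull2_def by simp
  have as: "ext_d1 \<omega> c p \<mu> \<nu> = - ext_d1 \<omega> c p \<nu> \<mu>" for c p \<mu> \<nu> unfolding ext_d1_def by simp
  show ?thesis
    unfolding two_form_def tensor2_def using sm tr as by blast
qed

text \<open>
  Differentiating the transformation law of \<open>\<sigma>\<close> produces, besides the expected term, the terms \<open>K\<close> and
  \<open>L\<close> with second derivatives of the coordinate change.  In the cyclic sum they cancel in pairs.
\<close>

lemma ext_d2_pull:
  assumes s: "two_form \<A> \<sigma>" and c: "c \<in> \<A>" "c' \<in> \<A>" and p: "p \<in> chart_dom c" "p \<in> chart_dom c'"
  shows "ext_d2 \<sigma> c p = pull3 (jac c c' p) (ext_d2 \<sigma> c' p)"
proof (intro ext)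
  fix \<mu> \<nu> \<rho>
  let ?J = "jac c c'"
  note cp = inv_chart[OF c(1) p(1)]
  have t: "tensor2 \<A> \<sigma>" and as: "\<And>\<alpha> \<beta>. \<sigma> c' p \<alpha> \<beta> = - \<sigma> c' p \<beta> \<alpha>"
    using s c p unfolding two_form_def by blast+
  have ds: "diff_at c' p (\<lambda>q. \<sigma> c' q \<alpha> \<beta>)" for \<alpha> \<beta>
    using t c p unfolding tensor2_def by (intro smooth_in_chart_diff_at) auto
  note ds' = pd_chain(2)[OF c p ds] and dj = jac_diff_at[OF c p]
  let ?D' = "\<lambda>\<gamma> \<alpha> \<beta>. pd c' \<gamma> (\<lambda>q. \<sigma> c' q \<alpha> \<beta>) p"
  let ?H = "\<lambda>\<rho> \<alpha> \<mu>. pd c \<rho> (\<lambda>q. ?J q \<alpha> \<mu>) p"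
  define K where "K \<rho> \<mu> \<nu> = (\<Sum>\<alpha>\<in>UNIV. \<Sum>\<beta>\<in>UNIV. \<sigma> c' p \<alpha> \<beta> * ?H \<rho> \<alpha> \<mu> * ?J p \<beta> \<nu>)" for \<rho> \<mu> \<nu>
  define L where "L \<rho> \<mu> \<nu> = (\<Sum>\<alpha>\<in>UNIV. \<Sum>\<beta>\<in>UNIV. \<sigma> c' p \<alpha> \<beta> * ?J p \<alpha> \<mu> * ?H \<rho> \<beta> \<nu>)" for \<rho> \<mu> \<nu>
  have D: "pd c \<rho> (\<lambda>q. \<sigma> c q \<mu> \<nu>) p = pull3 (?J p) ?D' \<rho> \<mu> \<nu> + K \<rho> \<mu> \<nu> + L \<rho> \<mu> \<nu>" for \<rho> \<mu> \<nu>
  proof -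
    have "pd c \<rho> (\<lambda>q. \<sigma> c q \<mu> \<nu>) p = pd c \<rho> (\<lambda>q. \<Sum>\<alpha>\<in>UNIV. \<Sum>\<beta>\<in>UNIV. \<sigma> c' q \<alpha> \<beta> * ?J q \<alpha> \<mu> * ?J q \<beta> \<nu>) p"
    proof (rule pd_cong[OF c(1), of "chart_dom c \<inter> chart_dom c'"])
      show "\<sigma> c q \<mu> \<nu> = (\<Sum>\<alpha>\<in>UNIV. \<Sum>\<beta>\<in>UNIV. \<sigma> c' q \<alpha> \<beta> * ?J q \<alpha> \<mu> * ?J q \<beta> \<nu>)"
        if "q \<in> chart_dom c \<inter> chart_dom c'" for q
        using tensor2_pull[OF t c, of q] that by (simp add: pull2_def)
    qed (use c p in \<open>auto intro: open_dom\<close>)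
    also have "\<dots> = (\<Sum>\<alpha>\<in>UNIV. \<Sum>\<beta>\<in>UNIV. pd c \<rho> (\<lambda>q. \<sigma> c' q \<alpha> \<beta> * ?J q \<alpha> \<mu> * ?J q \<beta> \<nu>) p)"
      by (simp only: pd_sum[OF diff_at_sum[OF diff_at_mult[OF diff_at_mult[OF ds' dj cp] dj cp] cp] cp]
          pd_sum[OF diff_at_mult[OF diff_at_mult[OF ds' dj cp] dj cp] cp])
    also have "\<dots> = (\<Sum>\<alpha>\<in>UNIV. \<Sum>\<beta>\<in>UNIV. (pd c \<rho> (\<lambda>q. \<sigma> c' q \<alpha> \<beta>) p * ?J p \<alpha> \<mu> + \<sigma> c' p \<alpha> \<beta> * ?H \<rho> \<alpha> \<mu>) * ?J p \<beta> \<nu>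
          + \<sigma> c' p \<alpha> \<beta> * ?J p \<alpha> \<mu> * ?H \<rho> \<beta> \<nu>)"
      by (simp only: pd_mult[OF diff_at_mult[OF ds' dj cp] dj cp] pd_mult[OF ds' dj cp])
    also have "\<dots> = (\<Sum>\<alpha>\<in>UNIV. \<Sum>\<beta>\<in>UNIV. pd c \<rho> (\<lambda>q. \<sigma> c' q \<alpha> \<beta>) p * ?J p \<alpha> \<mu> * ?J p \<beta> \<nu>) + K \<rho> \<mu> \<nu> + L \<rho> \<mu> \<nu>"
      unfolding K_def L_def by (simp only: distrib_right sum.distrib)
    also have "(\<Sum>\<alpha>\<in>UNIV. \<Sum>\<beta>\<in>UNIV. pd c \<rho> (\<lambda>q. \<sigma> c' q \<alpha> \<beta>) p * ?J p \<alpha> \<mu> * ?J p \<beta> \<nu>)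
        = (\<Sum>\<alpha>\<in>UNIV. \<Sum>\<beta>\<in>UNIV. \<Sum>\<gamma>\<in>UNIV. ?D' \<gamma> \<alpha> \<beta> * (?J p \<gamma> \<rho> * ?J p \<alpha> \<mu> * ?J p \<beta> \<nu>))"
      unfolding pd_chain(1)[OF c p ds] sum_distrib_right by (simp only: mult_ac)
    also have "\<dots> = pull3 (?J p) ?D' \<rho> \<mu> \<nu>"
      unfolding pull3_def by (rule sum_cyclic3[symmetric])
    finally show ?thesis .
  qed
  have KL: "K \<rho> \<mu> \<nu> + L \<mu> \<nu> \<rho> = 0" for \<rho> \<mu> \<nu>
  proof -
    have "L \<mu> \<nu> \<rho> = (\<Sum>\<alpha>\<in>UNIV. \<Sum>\<beta>\<in>UNIV. \<sigma> c' p \<beta> \<alpha> * ?J p \<beta> \<nu> * ?H \<mu> \<alpha> \<rho>)"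
      unfolding L_def by (rule sum.swap)
    also have "\<dots> = (\<Sum>\<alpha>\<in>UNIV. \<Sum>\<beta>\<in>UNIV. - (\<sigma> c' p \<alpha> \<beta> * ?H \<rho> \<alpha> \<mu> * ?J p \<beta> \<nu>))"
    proof (intro sum.cong refl)
      fix \<alpha> \<beta>
      show "\<sigma> c' p \<beta> \<alpha> * ?J p \<beta> \<nu> * ?H \<mu> \<alpha> \<rho> = - (\<sigma> c' p \<alpha> \<beta> * ?H \<rho> \<alpha> \<mu> * ?J p \<beta> \<nu>)"
        using as[of \<beta> \<alpha>] jac_symmetric[OF c p, of \<mu> \<alpha> \<rho>] by simp
    qed
    finally show ?thesis unfolding K_def by (simp add: sum_negf)
  qed
  have cyc1: "pull3 (?J p) (\<lambda>\<mu> \<nu> \<rho>. ?D' \<nu> \<rho> \<mu>) \<mu> \<nu> \<rho> = pull3 (?J p) ?D' \<nu> \<rho> \<mu>"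
    by (rule pull3_cyclic)
  have cyc2: "pull3 (?J p) (\<lambda>\<mu> \<nu> \<rho>. ?D' \<rho> \<mu> \<nu>) \<mu> \<nu> \<rho> = pull3 (?J p) ?D' \<rho> \<mu> \<nu>"
    using pull3_cyclic[of "?J p" "\<lambda>\<mu> \<nu> \<rho>. ?D' \<nu> \<rho> \<mu>" \<mu> \<nu> \<rho>] pull3_cyclic[of "?J p" ?D' \<nu> \<rho> \<mu>] by simp
  have "ext_d2 \<sigma> c p \<mu> \<nu> \<rho> = pull3 (?J p) ?D' \<mu> \<nu> \<rho> + pull3 (?J p) ?D' \<nu> \<rho> \<mu> + pull3 (?J p) ?D' \<rho> \<mu> \<nu>"
    unfolding ext_d2_def D using KL[of \<mu> \<nu> \<rho>] KL[of \<nu> \<rho> \<mu>] KL[of \<rho> \<mu> \<nu>] by simp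
  also have "\<dots> = pull3 (?J p) (ext_d2 \<sigma> c' p) \<mu> \<nu> \<rho>"
    unfolding ext_d2_def[abs_def] pull3_add cyc1 cyc2 ..
  finally show "ext_d2 \<sigma> c p \<mu> \<nu> \<rho> = pull3 (?J p) (ext_d2 \<sigma> c' p) \<mu> \<nu> \<rho>" .
qed

end


section \<open>Perfect triples on a manifold\<close>

locale plebanski = atlas \<A> for \<A> :: "'m::{t2_space, second_countable_topology} chart set" +
  fixes \<Sigma> :: "'m triple2" and g :: "'m field2"
  assumes perfect: "perfect_triple \<A> \<Sigma>" and metric: "metric_of_triple \<A> \<Sigma> g"
begin

abbreviation vol :: "'m field4" where "vol \<equiv> v_form \<Sigma>"

lemma fibre:
  assumes c: "c \<in> \<A>" and p: "p \<in> chart_dom c"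
  shows "perfect_fibre (g c p) (\<lambda>i. \<Sigma> i c p) (vol c p)"
proof
  show "\<Sigma> i c p \<mu> \<nu> = - \<Sigma> i c p \<nu> \<mu>" for i \<mu> \<nu>
    using perfect c p unfolding perfect_triple_def two_form_def by blast
  show "g c p \<mu> \<nu> = g c p \<nu> \<mu>" for \<mu> \<nu>
    using metric c p unfolding metric_of_triple_def riemannian_metric_def by blast
  show "(\<Sum>\<mu>\<in>UNIV. \<Sum>\<nu>\<in>UNIV. g c p \<mu> \<nu> * x $ \<mu> * x $ \<nu>) > 0" if "x \<noteq> 0" for x :: "real^4"
    using metric c p that unfolding metric_of_triple_def riemannian_metric_def by blast
  show "wedge22 (\<Sigma> i c p) (\<Sigma> j c p) \<mu> \<nu> \<rho> \<tau> = 2 * kdelta i j * vol c p \<mu> \<nu> \<rho> \<tau>" for i j \<mu> \<nu> \<rho> \<tau>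
    using perfect c p unfolding perfect_triple_def by blast
  show "vol c p 1 2 3 4 \<noteq> 0" using perfect c p unfolding perfect_triple_def by blast
  show "1/2 * (\<Sum>\<rho>\<in>UNIV. \<Sum>\<tau>\<in>UNIV. \<Sum>\<alpha>\<in>UNIV. \<Sum>\<beta>\<in>UNIV.
            vol c p \<mu> \<nu> \<rho> \<tau> * inv_metric (g c p) \<rho> \<alpha> * inv_metric (g c p) \<tau> \<beta> * \<Sigma> i c p \<alpha> \<beta>)
          = \<Sigma> i c p \<mu> \<nu>" for i \<mu> \<nu>
    using metric c p unfolding metric_of_triple_def by blast
  show "(\<Sum>\<alpha>\<in>UNIV. raise2 (g c p) (\<Sigma> i c p) \<mu> \<alpha> * raise2 (g c p) (\<Sigma> j c p) \<alpha> \<nu>)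
          = - kdelta i j * kdelta \<mu> \<nu> + (\<Sum>k\<in>UNIV. eps3 i j k * raise2 (g c p) (\<Sigma> k c p) \<mu> \<nu>)" for i j \<mu> \<nu>
    using metric c p unfolding metric_of_triple_def by blast
qed

lemma Sigma_two_form: "two_form \<A> (\<Sigma> i)"
  using perfect unfolding perfect_triple_def by blast

lemma two_form_smooth: "two_form \<A> s \<Longrightarrow> c \<in> \<A> \<Longrightarrow> smooth_in_chart c (\<lambda>p. s c p \<mu> \<nu>)"
  and two_form_antisym: "two_form \<A> s \<Longrightarrow> c \<in> \<A> \<Longrightarrow> p \<in> chart_dom c \<Longrightarrow> s c p \<mu> \<nu> = - s c p \<nu> \<mu>"
  and two_form_tensor2: "two_form \<A> s \<Longrightarrow> tensor2 \<A> s"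
  unfolding two_form_def tensor2_def by blast+

lemma two_formI:
  assumes "\<And>c \<mu> \<nu>. c \<in> \<A> \<Longrightarrow> smooth_in_chart c (\<lambda>p. s c p \<mu> \<nu>)"
    and "\<And>c c' p. c \<in> \<A> \<Longrightarrow> c' \<in> \<A> \<Longrightarrow> p \<in> chart_dom c \<Longrightarrow> p \<in> chart_dom c' \<Longrightarrow> s c p = pull2 (jac c c' p) (s c' p)"
    and "\<And>c p \<mu> \<nu>. c \<in> \<A> \<Longrightarrow> p \<in> chart_dom c \<Longrightarrow> s c p \<mu> \<nu> = - s c p \<nu> \<mu>"
  shows "two_form \<A> s"
proof -
  have "s c p \<mu> \<nu> = (\<Sum>\<alpha>\<in>UNIV. \<Sum>\<beta>\<in>UNIV. s c' p \<alpha> \<beta> * jac c c' p \<alpha> \<mu> * jac c c' p \<beta> \<nu>)"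
    if "c \<in> \<A>" "c' \<in> \<A>" "p \<in> chart_dom c" "p \<in> chart_dom c'" for c c' p \<mu> \<nu>
    using fun_cong[OF fun_cong[OF assms(2)[OF that]], of \<mu> \<nu>] unfolding pull2_def .
  then show ?thesis unfolding two_form_def tensor2_def using assms(1,3) by blast
qed

lemma wedge22_smooth:
  assumes "c \<in> \<A>" "\<And>\<mu> \<nu>. smooth_in_chart c (\<lambda>p. s p \<mu> \<nu>)" "\<And>\<mu> \<nu>. smooth_in_chart c (\<lambda>p. t p \<mu> \<nu>)"
  shows "smooth_in_chart c (\<lambda>p. wedge22 (s p) (t p) \<mu> \<nu> \<rho> \<tau>)"
  unfolding wedge22_def using assms by (intro smooth_chart_intros)

lemma vol_smooth: "c \<in> \<A> \<Longrightarrow> smooth_in_chart c (\<lambda>p. vol c p \<mu> \<nu> \<rho> \<tau>)"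
  unfolding v_form_def by (intro smooth_chart_intros wedge22_smooth two_form_smooth Sigma_two_form)

lemma vol_nonzero: "c \<in> \<A> \<Longrightarrow> p \<in> chart_dom c \<Longrightarrow> vol c p 1 2 3 4 \<noteq> 0"
  by (rule perfect_fibre.v_nonzero[OF fibre])

abbreviation Wr :: "'m chart \<Rightarrow> 'm \<Rightarrow> (4 \<Rightarrow> 4 \<Rightarrow> real) \<Rightarrow> (4 \<Rightarrow> 4 \<Rightarrow> real) \<Rightarrow> real" where
  "Wr c p \<equiv> wedge_ratio (vol c p)"

lemma Wr_smooth:
  assumes "c \<in> \<A>" "\<And>\<mu> \<nu>. smooth_in_chart c (\<lambda>p. s p \<mu> \<nu>)" "\<And>\<mu> \<nu>. smooth_in_chart c (\<lambda>p. t p \<mu> \<nu>)"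
  shows "smooth_in_chart c (\<lambda>p. Wr c p (s p) (t p))"
  unfolding wedge_ratio_def using assms by (intro smooth_chart_intros wedge22_smooth vol_smooth vol_nonzero)

lemma vol_eq_wedge: "c \<in> \<A> \<Longrightarrow> p \<in> chart_dom c \<Longrightarrow> wedge22 (\<Sigma> 1 c p) (\<Sigma> 1 c p) 1 2 3 4 = 2 * vol c p 1 2 3 4"
  using perfect_fibre.S_wedge[OF fibre, of c p 1 1] by simp

text \<open>
  Both 4-forms are multiplied by the same factor; for the denominator this is seen by writing
  \<open>2 v\<^sub>\<Sigma> = \<Sigma>\<^sup>1 \<and> \<Sigma>\<^sup>1\<close>.
\<close>

lemma Wr_invariant:
  assumes c: "c \<in> \<A>" "c' \<in> \<A>" and p: "p \<in> chart_dom c" "p \<in> chart_dom c'"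
    and s: "\<And>\<mu> \<nu>. s \<mu> \<nu> = - s \<nu> \<mu>" and t: "\<And>\<mu> \<nu>. t \<mu> \<nu> = - t \<nu> \<mu>"
  shows "Wr c p (pull2 (jac c c' p) s) (pull2 (jac c c' p) t) = Wr c' p s t"
proof -
  let ?J = "jac c c' p" and ?V = "wedge22 (\<Sigma> 1 c' p) (\<Sigma> 1 c' p)"
  have "pull4 ?J ?V 1 2 3 4 = wedge22 (\<Sigma> 1 c p) (\<Sigma> 1 c p) 1 2 3 4"
    unfolding wedge22_pull2[symmetric] tensor2_pull[OF two_form_tensor2[OF Sigma_two_form] c p, symmetric] ..
  then have V: "pull4 ?J ?V 1 2 3 4 = 2 * vol c p 1 2 3 4" by (simp only: vol_eq_wedge c p)
  have V': "?V 1 2 3 4 = 2 * vol c' p 1 2 3 4" by (rule vol_eq_wedge[OF c(2) p(2)])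
  have aV: "alt4 ?V"
    by (rule alt4_wedge22; rule two_form_antisym[OF Sigma_two_form c(2) p(2)])
  have "pull4 ?J (wedge22 s t) 1 2 3 4 / pull4 ?J ?V 1 2 3 4 = wedge22 s t 1 2 3 4 / ?V 1 2 3 4"
    by (rule alt4_ratio_pull4[OF alt4_wedge22[OF s t] aV]) (simp_all add: V V' vol_nonzero c p)
  then show ?thesis unfolding wedge_ratio_def wedge22_pull2 V V' by (simp add: field_simps)
qed

lemma Wr_two_forms_invariant:
  assumes s: "two_form \<A> s" "two_form \<A> t" and c: "c \<in> \<A>" "c' \<in> \<A>" and p: "p \<in> chart_dom c" "p \<in> chart_dom c'"
  shows "Wr c p (s c p) (t c p) = Wr c' p (s c' p) (t c' p)"
  unfolding tensor2_pull[OF two_form_tensor2[OF s(1)] c p] tensor2_pull[OF two_form_tensor2[OF s(2)] c p]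
  by (rule Wr_invariant[OF c p two_form_antisym[OF s(1) c(2) p(2)] two_form_antisym[OF s(2) c(2) p(2)]])

section \<open>Smoothness of the inverse metric\<close>

lemma g_tensor2: "tensor2 \<A> g"
  using metric unfolding metric_of_triple_def riemannian_metric_def by blast

lemma det_smooth:
  fixes f :: "4 \<Rightarrow> 4 \<Rightarrow> 'm \<Rightarrow> real"
  assumes "c \<in> \<A>" "\<And>i j. smooth_in_chart c (f i j)"
  shows "smooth_in_chart c (\<lambda>p. det (\<chi> i j. f i j p))"
  unfolding det_def using assms by (simp add: smooth_chart_intros)

lemma det_g_nonzero:
  assumes c: "c \<in> \<A>" and p: "p \<in> chart_dom c"
  shows "det (\<chi> \<mu> \<nu>. g c p \<mu> \<nu>) \<noteq> 0"
proof
  assume "det (\<chi> \<mu> \<nu>. g c p \<mu> \<nu>) = 0"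
  then have "\<bar>vol c p 1 2 3 4\<bar> = 0" using metric c p unfolding metric_of_triple_def by simp
  then show False using vol_nonzero[OF c p] by simp
qed

text \<open>
  The inverse metric is smooth because Cramer's rule writes it as a quotient of determinants.
\<close>

lemma inv_metric_cramer:
  assumes c: "c \<in> \<A>" and p: "p \<in> chart_dom c"
  shows "inv_metric (g c p) \<mu> \<nu> = det (\<chi> i j. if j = \<mu> then kdelta i \<nu> else g c p i j) / det (\<chi> i j. g c p i j)"
proof -
  let ?A = "\<chi> i j. g c p i j" and ?x = "\<chi> \<mu>. inv_metric (g c p) \<mu> \<nu>"
  have "?A *v ?x = (\<chi> i. kdelta i \<nu>)"
    unfolding matrix_vector_mult_def vec_eq_iff
    using perfect_fibre.G_inverse(2)[OF fibre[OF c p]] by simp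
  then have "?x = (\<chi> k. det (\<chi> i j. if j = k then (\<chi> i. kdelta i \<nu>) $ i else ?A $ i $ j) / det ?A)"
    using cramer[OF det_g_nonzero[OF c p]] by blast
  then have "?x $ \<mu> = (\<chi> k. det (\<chi> i j. if j = k then (\<chi> i. kdelta i \<nu>) $ i else ?A $ i $ j) / det ?A) $ \<mu>"
    by (rule arg_cong)
  then show ?thesis by (simp cong: if_cong)
qed

lemma g_smooth: "c \<in> \<A> \<Longrightarrow> smooth_in_chart c (\<lambda>p. g c p \<mu> \<nu>)"
  using g_tensor2 unfolding tensor2_def by blast

lemma inv_metric_smooth:
  assumes c: "c \<in> \<A>"
  shows "smooth_in_chart c (\<lambda>p. inv_metric (g c p) \<mu> \<nu>)"
proof (rule smooth_in_chart_cong[OF c inv_metric_cramer[OF c, symmetric]])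
  have "smooth_in_chart c (\<lambda>p. if j = \<mu> then kdelta i \<nu> else g c p i j)" for i j
    by (cases "j = \<mu>") (simp_all add: smooth_in_chart_const[OF c] g_smooth[OF c])
  then show "smooth_in_chart c (\<lambda>p. det (\<chi> i j. if j = \<mu> then kdelta i \<nu> else g c p i j) / det (\<chi> i j. g c p i j))"
    by (intro smooth_in_chart_divide c det_smooth g_smooth det_g_nonzero)
qed

section \<open>The operator \<open>d\<^sub>2\<close>\<close>

lemma star_d_eq:
  assumes c: "c \<in> \<A>" and p: "p \<in> chart_dom c"
  shows "star_d g \<Sigma> \<sigma> i c p \<mu> = 1/3 * contract3 (perfect_fibre.vol_up (g c p) (vol c p) \<mu>) (ext_d2 (\<sigma> i) c p)"
proof -
  interpret F: perfect_fibre "g c p" "\<lambda>i. \<Sigma> i c p" "vol c p" by (rule fibre[OF c p])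
  let ?V = "F.vol_up \<mu>" and ?D = "\<lambda>\<alpha> \<beta> \<gamma>. pd c \<alpha> (\<lambda>q. \<sigma> i c q \<beta> \<gamma>) p"
  have 1: "star_d g \<Sigma> \<sigma> i c p \<mu> = contract3 ?V (nabla2 g (\<sigma> i) c p)"
    unfolding star_d_def contract3_def F.vol_up_def sum_distrib_right ..
  have Gs: "christoffel g c p \<kappa> \<alpha> \<beta> = christoffel g c p \<kappa> \<beta> \<alpha>" for \<kappa> \<alpha> \<beta>
  proof -
    have "pd c \<tau> (\<lambda>q. g c q \<alpha> \<beta>) p = pd c \<tau> (\<lambda>q. g c q \<beta> \<alpha>) p" for \<tau>
      by (rule pd_cong_dom[OF c p]) (rule perfect_fibre.G_sym[OF fibre[OF c]])
    then show ?thesis unfolding christoffel_def by (simp add: add.commute)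
  qed
  have z1: "contract3 ?V (\<lambda>\<alpha> \<beta> \<gamma>. \<Sum>\<kappa>\<in>UNIV. christoffel g c p \<kappa> \<alpha> \<beta> * \<sigma> i c p \<kappa> \<gamma>) = 0"
    by (rule contract3_symmetric12[OF F.alt3_vol_up]) (simp only: Gs)
  have z2: "contract3 ?V (\<lambda>\<alpha> \<beta> \<gamma>. \<Sum>\<kappa>\<in>UNIV. christoffel g c p \<kappa> \<alpha> \<gamma> * \<sigma> i c p \<beta> \<kappa>) = 0"
    by (rule contract3_symmetric13[OF F.alt3_vol_up]) (simp only: Gs)
  have 2: "contract3 ?V (nabla2 g (\<sigma> i) c p) = contract3 ?V ?D"
    unfolding nabla2_def[abs_def] contract3_diff z1 z2 by simp
  have 3: "contract3 ?V (ext_d2 (\<sigma> i) c p) = 3 * contract3 ?V ?D"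
    unfolding ext_d2_def[abs_def] contract3_add
    using contract3_cyclic[OF F.alt3_vol_up, of \<mu> ?D] by simp
  show ?thesis unfolding 1 2 3 by simp
qed

lemma pd_two_form_antisym:
  assumes s: "two_form \<A> s" and c: "c \<in> \<A>" and p: "p \<in> chart_dom c"
  shows "pd c \<mu> (\<lambda>q. s c q \<nu> \<rho>) p = - pd c \<mu> (\<lambda>q. s c q \<rho> \<nu>) p"
proof -
  have "pd c \<mu> (\<lambda>q. s c q \<nu> \<rho>) p = pd c \<mu> (\<lambda>q. - s c q \<rho> \<nu>) p"
    by (rule pd_cong_dom[OF c p]) (rule two_form_antisym[OF s c])
  also have "\<dots> = - pd c \<mu> (\<lambda>q. s c q \<rho> \<nu>) p"
    by (rule pd_minus[OF smooth_in_chart_diff_at[OF two_form_smooth[OF s c] p]])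
  finally show ?thesis .
qed

lemma ext_d2_alt3:
  assumes s: "two_form \<A> s" and c: "c \<in> \<A>" and p: "p \<in> chart_dom c"
  shows "alt3 (ext_d2 s c p)"
proof -
  note n = pd_two_form_antisym[OF s c p]
  show ?thesis
    unfolding alt3_def ext_d2_def
  proof (intro allI conjI)
    fix \<mu> \<nu> \<rho>
    note e = n[of \<mu> \<nu> \<rho>] n[of \<nu> \<rho> \<mu>] n[of \<rho> \<mu> \<nu>]
    show "pd c \<nu> (\<lambda>q. s c q \<mu> \<rho>) p + pd c \<mu> (\<lambda>q. s c q \<rho> \<nu>) p + pd c \<rho> (\<lambda>q. s c q \<nu> \<mu>) p
      = - (pd c \<mu> (\<lambda>q. s c q \<nu> \<rho>) p + pd c \<nu> (\<lambda>q. s c q \<rho> \<mu>) p + pd c \<rho> (\<lambda>q. s c q \<mu> \<nu>) p)"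
      unfolding e by simp
    show "pd c \<mu> (\<lambda>q. s c q \<rho> \<nu>) p + pd c \<rho> (\<lambda>q. s c q \<nu> \<mu>) p + pd c \<nu> (\<lambda>q. s c q \<mu> \<rho>) p
      = - (pd c \<mu> (\<lambda>q. s c q \<nu> \<rho>) p + pd c \<nu> (\<lambda>q. s c q \<rho> \<mu>) p + pd c \<rho> (\<lambda>q. s c q \<mu> \<nu>) p)"
      unfolding e by simp
  qed
qed

text \<open>
  The defining property of \<open>d\<^sub>2 \<sigma>\<close>, pointwise.  All other facts about \<open>d\<^sub>2\<close> but its smoothness
  come from here.
\<close>

lemma d2_iff:
  assumes s: "\<And>i. two_form \<A> (\<sigma> i)" and c: "c \<in> \<A>" and p: "p \<in> chart_dom c"
  shows "(\<forall>i \<mu> \<nu> \<rho>. ext_d2 (\<sigma> i) c p \<mu> \<nu> \<rho>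
      + (\<Sum>j\<in>UNIV. \<Sum>k\<in>UNIV. eps3 i j k * wedge12 (b j) (\<Sigma> k c p) \<mu> \<nu> \<rho>) = 0)
    \<longleftrightarrow> b = (\<lambda>i. d2 g \<Sigma> \<sigma> i c p)"
proof -
  interpret F: perfect_fibre "g c p" "\<lambda>i. \<Sigma> i c p" "vol c p" by (rule fibre[OF c p])
  have d: "(\<lambda>i. d2 g \<Sigma> \<sigma> i c p) = (\<lambda>i \<mu>. 1/2 * inv (J1 (g c p) (\<lambda>i. \<Sigma> i c p))
      (\<lambda>j \<mu>. 1/3 * contract3 (F.vol_up \<mu>) (ext_d2 (\<sigma> j) c p)) i \<mu>)"
    unfolding d2_def star_d_eq[OF c p] ..
  have a: "alt3 (ext_d2 (\<sigma> i) c p)" for i by (rule ext_d2_alt3[OF s c p])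
  have e: "x + y = 0 \<longleftrightarrow> y = - x" for x y :: real by linarith
  show ?thesis
    unfolding d F.half_inv_J1_star[of "\<lambda>i. ext_d2 (\<sigma> i) c p", OF a, symmetric]
    unfolding fun_eq_iff F.eps_wedge_def e ..
qed

lemma d2_eps_wedge:
  assumes s: "\<And>i. two_form \<A> (\<sigma> i)" and c: "c \<in> \<A>" and p: "p \<in> chart_dom c"
  shows "perfect_fibre.eps_wedge (\<lambda>i. \<Sigma> i c p) (\<lambda>i. d2 g \<Sigma> \<sigma> i c p) = (\<lambda>i \<mu> \<nu> \<rho>. - ext_d2 (\<sigma> i) c p \<mu> \<nu> \<rho>)"
proof -
  interpret F: perfect_fibre "g c p" "\<lambda>i. \<Sigma> i c p" "vol c p" by (rule fibre[OF c p])
  have "\<forall>i \<mu> \<nu> \<rho>. ext_d2 (\<sigma> i) c p \<mu> \<nu> \<rho> + F.eps_wedge (\<lambda>i. d2 g \<Sigma> \<sigma> i c p) i \<mu> \<nu> \<rho> = 0"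
    using d2_iff[where \<sigma> = \<sigma> and b = "\<lambda>i. d2 g \<Sigma> \<sigma> i c p", OF s c p] unfolding F.eps_wedge_def by blast
  then show ?thesis by (intro ext) (simp add: eq_neg_iff_add_eq_0 add.commute)
qed

lemma d2_smooth:
  assumes s: "\<And>i. two_form \<A> (\<sigma> i)" and c: "c \<in> \<A>"
  shows "smooth_in_chart c (\<lambda>p. d2 g \<Sigma> \<sigma> i c p \<mu>)"
proof -
  have st: "smooth_in_chart c (\<lambda>p. star_d g \<Sigma> \<sigma> i c p \<mu>)" for i \<mu>
    unfolding star_d_def nabla2_def christoffel_def
    by (intro smooth_chart_intros c vol_smooth inv_metric_smooth smooth_in_chart_pd two_form_smooth[OF s] g_smooth)
  have "smooth_in_chart c (\<lambda>p. 1/2 * ((J1 (g c p) (\<lambda>j. \<Sigma> j c p) (\<lambda>j. star_d g \<Sigma> \<sigma> j c p) i \<mu> - star_d g \<Sigma> \<sigma> i c p \<mu>) * (1/2)))"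
    unfolding J1_def raise2_def
    by (intro smooth_chart_intros c st inv_metric_smooth two_form_smooth[OF Sigma_two_form])
  then show ?thesis
    by (rule smooth_in_chart_cong[OF c, rotated]) (simp add: d2_def perfect_fibre.inv_J1[OF fibre[OF c]])
qed

text \<open>
  The equation that characterises \<open>d\<^sub>2 \<sigma>\<close> is tensorial, and its solution is unique.
\<close>

lemma d2_pull:
  assumes s: "\<And>i. two_form \<A> (\<sigma> i)" and c: "c \<in> \<A>" "c' \<in> \<A>" and p: "p \<in> chart_dom c" "p \<in> chart_dom c'"
  shows "d2 g \<Sigma> \<sigma> i c p = pull1 (jac c c' p) (d2 g \<Sigma> \<sigma> i c' p)"
proof -
  let ?J = "jac c c' p" and ?a = "\<lambda>i. d2 g \<Sigma> \<sigma> i c' p"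
  have "\<forall>i \<mu> \<nu> \<rho>. ext_d2 (\<sigma> i) c' p \<mu> \<nu> \<rho>
      + (\<Sum>j\<in>UNIV. \<Sum>k\<in>UNIV. eps3 i j k * wedge12 (?a j) (\<Sigma> k c' p) \<mu> \<nu> \<rho>) = 0"
    using d2_iff[where \<sigma> = \<sigma> and b = ?a, OF s c(2) p(2)] by blast
  then have z: "(\<lambda>\<mu> \<nu> \<rho>. ext_d2 (\<sigma> i) c' p \<mu> \<nu> \<rho>
      + (\<Sum>j\<in>UNIV. \<Sum>k\<in>UNIV. eps3 i j k * wedge12 (?a j) (\<Sigma> k c' p) \<mu> \<nu> \<rho>)) = (\<lambda>\<mu> \<nu> \<rho>. 0)" for i
    by (intro ext) blast
  have "ext_d2 (\<sigma> i) c p \<mu> \<nu> \<rho>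
      + (\<Sum>j\<in>UNIV. \<Sum>k\<in>UNIV. eps3 i j k * wedge12 (pull1 ?J (?a j)) (\<Sigma> k c p) \<mu> \<nu> \<rho>) = 0" for i \<mu> \<nu> \<rho>
  proof -
    have "ext_d2 (\<sigma> i) c p \<mu> \<nu> \<rho>
      + (\<Sum>j\<in>UNIV. \<Sum>k\<in>UNIV. eps3 i j k * wedge12 (pull1 ?J (?a j)) (\<Sigma> k c p) \<mu> \<nu> \<rho>)
      = pull3 ?J (ext_d2 (\<sigma> i) c' p) \<mu> \<nu> \<rho>
        + (\<Sum>j\<in>UNIV. \<Sum>k\<in>UNIV. eps3 i j k * pull3 ?J (wedge12 (?a j) (\<Sigma> k c' p)) \<mu> \<nu> \<rho>)"
      unfolding ext_d2_pull[OF s c p] tensor2_pull[OF two_form_tensor2[OF Sigma_two_form] c p] wedge12_pull ..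
    also have "\<dots> = pull3 ?J (\<lambda>\<mu> \<nu> \<rho>. ext_d2 (\<sigma> i) c' p \<mu> \<nu> \<rho>
        + (\<Sum>j\<in>UNIV. \<Sum>k\<in>UNIV. eps3 i j k * wedge12 (?a j) (\<Sigma> k c' p) \<mu> \<nu> \<rho>)) \<mu> \<nu> \<rho>"
      unfolding sum_3 by (simp only: pull3_add pull3_scale)
    also have "\<dots> = 0" unfolding z by (simp add: pull3_def)
    finally show ?thesis .
  qed
  then have "(\<lambda>i. pull1 ?J (?a i)) = (\<lambda>i. d2 g \<Sigma> \<sigma> i c p)"
    using d2_iff[where \<sigma> = \<sigma> and b = "\<lambda>i. pull1 ?J (?a i)", OF s c(1) p(1)] by blast
  then show ?thesis by (rule fun_cong[symmetric])
qed

lemma d2_E1_section: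
  assumes s: "\<And>i. two_form \<A> (\<sigma> i)"
  shows "E1_section \<A> (d2 g \<Sigma> \<sigma>)"
  unfolding E1_section_def one_form_def
proof (intro allI conjI ballI)
  show "smooth_in_chart c (\<lambda>p. d2 g \<Sigma> \<sigma> i c p \<mu>)" if "c \<in> \<A>" for i c \<mu>
    by (rule d2_smooth[OF s that])
  show "d2 g \<Sigma> \<sigma> i c p \<mu> = (\<Sum>\<alpha>\<in>UNIV. d2 g \<Sigma> \<sigma> i c' p \<alpha> * jac c c' p \<alpha> \<mu>)"
    if "c \<in> \<A>" "c' \<in> \<A>" "p \<in> chart_dom c \<inter> chart_dom c'" for i c c' p \<mu>
    using fun_cong[OF d2_pull[where \<sigma> = \<sigma> and p = p and i = i, OF s that(1,2)], of \<mu>] that(3) by (simp add: pull1_def)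
qed

section \<open>The volume density\<close>

text \<open>
  The metric transforms with the square of the Jacobian determinant, and \<open>\<bar>v\<^sub>\<Sigma>\<bar>\<close> is the square root of
  the determinant of the metric.
\<close>

sublocale atlas_density \<A> vol
proof
  show "continuous_on (img c) (\<lambda>x. vol c (chart_inv c x) 1 2 3 4)" if "c \<in> \<A>" for c
    using smooth_on_continuous_on[OF vol_smooth[OF that, unfolded smooth_in_chart_def]] by (simp add: o_def)
next
  fix c c' p assume c: "c \<in> \<A>" "c' \<in> \<A>" and p: "p \<in> chart_dom c" "p \<in> chart_dom c'"
  let ?J = "\<chi> \<mu> \<nu>. jac c c' p \<mu> \<nu>" and ?G = "\<lambda>c. \<chi> \<mu> \<nu>. g c p \<mu> \<nu>"
  have v: "\<bar>vol c p 1 2 3 4\<bar> = sqrt (det (?G c))" if "c \<in> \<A>" "p \<in> chart_dom c" for c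
    using metric that unfolding metric_of_triple_def by blast
  have "?G c = transpose ?J ** ?G c' ** ?J"
    unfolding tensor2_pull[OF g_tensor2 c p] pull2_def matrix_matrix_mult_def transpose_def vec_eq_iff
  proof (intro allI)
    fix \<mu> \<nu>
    have "(\<Sum>\<alpha>\<in>UNIV. \<Sum>\<beta>\<in>UNIV. g c' p \<alpha> \<beta> * jac c c' p \<alpha> \<mu> * jac c c' p \<beta> \<nu>)
      = (\<Sum>\<beta>\<in>UNIV. (\<Sum>\<alpha>\<in>UNIV. jac c c' p \<alpha> \<mu> * g c' p \<alpha> \<beta>) * jac c c' p \<beta> \<nu>)"
      unfolding sum_distrib_right by (subst sum.swap) (simp only: mult_ac)
    then show "(\<chi> \<mu> \<nu>. \<Sum>\<alpha>\<in>UNIV. \<Sum>\<beta>\<in>UNIV. g c' p \<alpha> \<beta> * jac c c' p \<alpha> \<mu> * jac c c' p \<beta> \<nu>) $ \<mu> $ \<nu> =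
       (\<chi> i j. \<Sum>k\<in>UNIV. (\<chi> i j. \<Sum>k\<in>UNIV. (\<chi> i j. ?J $ j $ i) $ i $ k * ?G c' $ k $ j) $ i $ k * ?J $ k $ j) $ \<mu> $ \<nu>"
      by simp
  qed
  then have "det (?G c) = (det ?J)^2 * det (?G c')" by (simp add: det_mul det_transpose power2_eq_square)
  then show "\<bar>vol c p 1 2 3 4\<bar> = \<bar>det ?J\<bar> * \<bar>vol c' p 1 2 3 4\<bar>"
    unfolding v[OF c(1) p(1)] v[OF c(2) p(2)] by (simp add: real_sqrt_mult)
qed

end


context plebanski begin

section \<open>Test functions\<close>

lemma compact_inv_image: "c \<in> \<A> \<Longrightarrow> compact K \<Longrightarrow> K \<subseteq> img c \<Longrightarrow> compact (chart_inv c ` K)"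
  by (intro compact_continuous_image) (auto intro: continuous_on_subset continuous_inv)

lemma closed_inv_image: "c \<in> \<A> \<Longrightarrow> compact K \<Longrightarrow> K \<subseteq> img c \<Longrightarrow> closed (chart_inv c ` K)"
  by (rule compact_imp_closed[OF compact_inv_image])

lemma inv_notin:
  assumes c: "c \<in> \<A>" and K: "K \<subseteq> img c" and x: "x \<in> img c - K"
  shows "chart_inv c x \<notin> chart_inv c ` K"
proof
  assume "chart_inv c x \<in> chart_inv c ` K"
  then obtain y where y: "y \<in> K" "chart_inv c x = chart_inv c y" by blast
  have "chart_map c (chart_inv c x) = chart_map c (chart_inv c y)" unfolding y(2) ..
  then have "x = y" using chart_inv[OF c, of x] x chart_inv[OF c subsetD[OF K y(1)]] by simp
  then show False using y(1) x by simp
qed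

text \<open>
  A test function supported in one chart, so that integrals over the manifold become integrals over
  \<open>\<real>\<^sup>4\<close>.  On the support the volume form has a constant sign, which
  relates the density \<open>\<bar>v\<^sub>\<Sigma>\<bar>\<close> of the measure to the form \<open>v\<^sub>\<Sigma>\<close> in the integrands.
\<close>

definition bump :: "'m chart \<Rightarrow> (real^4) set \<Rightarrow> ('m \<Rightarrow> real) \<Rightarrow> bool" where
  "bump c K \<phi> \<longleftrightarrow> smooth_function \<A> \<phi> \<and> (\<forall>p. \<phi> p \<ge> 0) \<and> compact K \<and> K \<subseteq> img c \<and>
     (\<forall>p. p \<notin> chart_inv c ` K \<longrightarrow> \<phi> p = 0) \<and>
     (\<exists>sg. \<forall>x\<in>K. \<bar>vol c (chart_inv c x) 1 2 3 4\<bar> = sg * vol c (chart_inv c x) 1 2 3 4)"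

lemma bump_exists:
  assumes c: "c \<in> \<A>" and p0: "p0 \<in> chart_dom c"
  obtains K \<phi> where "bump c K \<phi>" "\<phi> p0 > 0"
proof -
  let ?x0 = "chart_map c p0" and ?v = "\<lambda>x. vol c (chart_inv c x) 1 2 3 4"
  have x0: "?x0 \<in> img c" using p0 by blast
  define sg where "sg = sgn (?v ?x0)"
  have "?v ?x0 \<noteq> 0" using vol_nonzero[OF c chart_inv_in[OF c x0]] .
  then have pos: "sg * ?v ?x0 > 0" unfolding sg_def by (simp add: sgn_mult_abs sgn_if)
  let ?U = "img c \<inter> (\<lambda>x. sg * ?v x) -` {0<..}"
  have "open ?U"
    by (intro continuous_open_preimage open_img c continuous_intros v_continuous)
  moreover have "?x0 \<in> ?U" using x0 pos by auto
  ultimately obtain r where r: "r > 0" "cball ?x0 r \<subseteq> ?U" using open_contains_cball by blast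
  let ?K = "cball ?x0 r"
  have K: "?K \<subseteq> img c" using r by blast
  have sgv: "\<bar>?v x\<bar> = sg * ?v x" if "x \<in> ?K" for x
  proof -
    have "sg * ?v x > 0" using r that by auto
    moreover have "\<bar>sg\<bar> = 1" using \<open>?v ?x0 \<noteq> 0\<close> by (simp add: sg_def abs_sgn_eq)
    ultimately show ?thesis by (metis abs_mult abs_of_pos mult_1)
  qed
  obtain b where b: "smooth_on b UNIV" "\<forall>x. b x \<ge> 0" "\<forall>x. b x \<noteq> (0::real) \<longleftrightarrow> x \<in> ball ?x0 r"
    using smooth_bump_exists[OF r(1), of ?x0] by blast
  define \<phi> where "\<phi> p = (if p \<in> chart_dom c then b (chart_map c p) else 0)" for p
  have off: "\<phi> p = 0" if "p \<notin> chart_inv c ` ?K" for p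
  proof (cases "p \<in> chart_dom c")
    case True
    then have "chart_map c p \<notin> ?K" using that inv_chart[OF c True] by (metis imageI)
    then have "chart_map c p \<notin> ball ?x0 r" using ball_subset_cball by blast
    then show ?thesis using b(3) True by (auto simp: \<phi>_def)
  qed (simp add: \<phi>_def)
  have "smooth_in_chart c' \<phi>" if c': "c' \<in> \<A>" for c'
  proof -
    let ?A = "chart_map c' ` (chart_dom c' \<inter> chart_dom c)"
      and ?B = "chart_map c' ` (chart_dom c' \<inter> - chart_inv c ` ?K)"
    have oA: "open ?A" by (rule open_image[OF c']) (auto intro: open_dom c c')
    have oB: "open ?B"
      by (rule open_image[OF c']) (use closed_inv_image[OF c compact_cball K] in \<open>auto intro: open_dom c' open_Int open_Compl\<close>)
    have AB: "?A \<union> ?B = img c'"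
      using chart_inv_in[OF c] K by blast
    have "smooth_on (\<lambda>x. b ((chart_map c \<circ> chart_inv c') x)) ?A"
      by (rule smooth_on_compose[OF oA open_UNIV _ b(1) transition_smooth[OF c' c]]) simp
    then have sA: "smooth_on (\<phi> \<circ> chart_inv c') ?A"
      by (rule smooth_on_cong[OF oA, rotated]) (auto simp: \<phi>_def inv_chart[OF c'])
    have sB: "smooth_on (\<phi> \<circ> chart_inv c') ?B"
      by (rule smooth_on_cong[OF oB _ smooth_on_const[OF oB]]) (use off in \<open>auto simp: inv_chart[OF c']\<close>)
    show ?thesis unfolding smooth_in_chart_def AB[symmetric] by (rule smooth_on_Un[OF oA oB sA sB])
  qed
  then have sm: "smooth_function \<A> \<phi>" unfolding smooth_function_def by blast
  have "\<phi> p0 \<noteq> 0" using p0 b(3) r(1) by (simp add: \<phi>_def)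
  moreover have "\<phi> p \<ge> 0" for p using b(2) by (simp add: \<phi>_def)
  ultimately have "\<phi> p0 > 0" by (simp add: order_less_le)
  moreover have "bump c ?K \<phi>"
    unfolding bump_def using sm \<open>\<And>p. \<phi> p \<ge> 0\<close> K off sgv by (intro conjI exI[of _ sg]) auto
  ultimately show thesis by (intro that)
qed

lemma chart_integral:
  assumes c: "c \<in> \<A>" and h: "smooth_in_chart c h" and f: "\<And>p. p \<in> chart_dom c \<Longrightarrow> f p = h p"
    "\<And>p. p \<notin> chart_dom c \<Longrightarrow> f p = 0"
  shows "(LINT p|volume_measure \<A> vol. f p) = chart_lint c h"
proof -
  have "continuous_on (chart_dom c) (\<lambda>p. (h \<circ> chart_inv c) (chart_map c p))"
    by (rule continuous_on_compose2[OF smooth_on_continuous_on[OF h[unfolded smooth_in_chart_def]] continuous_chart[OF c]]) auto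
  then have "(\<lambda>p. if p \<in> chart_dom c then (h \<circ> chart_inv c) (chart_map c p) else 0) \<in> borel_measurable borel"
    by (rule measurable_if_open[OF open_dom[OF c]])
  also have "(\<lambda>p. if p \<in> chart_dom c then (h \<circ> chart_inv c) (chart_map c p) else 0) = f"
    using f inv_chart[OF c] by (intro ext) simp
  finally have "f \<in> borel_measurable borel" .
  from integral_volume_measure_chart[OF c this f(2)]
  have "(LINT p|volume_measure \<A> vol. f p) = chart_lint c f" by simp
  also have "\<dots> = chart_lint c h"
    unfolding chart_lint_def
    by (intro Bochner_Integration.integral_cong refl) (use chart_inv_in[OF c] f in \<open>simp add: indicator_def\<close>)
  finally show ?thesis .
qed

section \<open>Integration by parts\<close>

text \<open>
  \<open>d (s \<and> a) = ds \<and> a + s \<and> da\<close> for a 2-form \<open>s\<close> and a 1-form \<open>a\<close>.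
\<close>

lemma divergence_wedge12:
  assumes s: "two_form \<A> s" and a: "one_form \<A> a" and c: "c \<in> \<A>" and p: "p \<in> chart_dom c"
  shows "pd c 1 (\<lambda>q. wedge12 (a c q) (s c q) 2 3 4) p - pd c 2 (\<lambda>q. wedge12 (a c q) (s c q) 1 3 4) p
      + pd c 3 (\<lambda>q. wedge12 (a c q) (s c q) 1 2 4) p - pd c 4 (\<lambda>q. wedge12 (a c q) (s c q) 1 2 3) p
    = (ext_d2 s c p 1 2 3 * a c p 4 - ext_d2 s c p 1 2 4 * a c p 3 + ext_d2 s c p 1 3 4 * a c p 2 - ext_d2 s c p 2 3 4 * a c p 1)
      + wedge22 (s c p) (ext_d1 a c p) 1 2 3 4"
proof -
  note cp = inv_chart[OF c p]
  have ds: "diff_at c p (\<lambda>q. s c q \<mu> \<nu>)" for \<mu> \<nu>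
    by (rule smooth_in_chart_diff_at[OF two_form_smooth[OF s c] p])
  have da: "diff_at c p (\<lambda>q. a c q \<mu>)" for \<mu>
    using a c p unfolding one_form_def by (intro smooth_in_chart_diff_at) auto
  note dm = diff_at_mult[OF da ds cp]
  have W: "pd c \<kappa> (\<lambda>q. wedge12 (a c q) (s c q) \<mu> \<nu> \<rho>) p =
      (pd c \<kappa> (\<lambda>q. a c q \<mu>) p * s c p \<nu> \<rho> + a c p \<mu> * pd c \<kappa> (\<lambda>q. s c q \<nu> \<rho>) p)
    + (pd c \<kappa> (\<lambda>q. a c q \<nu>) p * s c p \<rho> \<mu> + a c p \<nu> * pd c \<kappa> (\<lambda>q. s c q \<rho> \<mu>) p)
    + (pd c \<kappa> (\<lambda>q. a c q \<rho>) p * s c p \<mu> \<nu> + a c p \<rho> * pd c \<kappa> (\<lambda>q. s c q \<mu> \<nu>) p)" for \<kappa> \<mu> \<nu> \<rho>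
    unfolding wedge12_def pd_add[OF diff_at_add[OF dm dm cp] dm cp] pd_add[OF dm dm cp] pd_mult[OF da ds cp] ..
  note n = pd_two_form_antisym[OF s c p]
  note n' = n[of _ 3 1] n[of _ 4 1] n[of _ 4 2] n[of _ 2 1] n[of _ 3 2] n[of _ 4 3]
  note t = two_form_antisym[OF s c p]
  note t' = t[of 3 1] t[of 4 1] t[of 4 2] t[of 2 1] t[of 3 2] t[of 4 3]
  show ?thesis
    unfolding W ext_d2_def wedge22_def ext_d1_def n' t' by (simp add: algebra_simps)
qed

lemma ext_d2_vanishes:
  assumes c: "c \<in> \<A>" and p: "p \<in> chart_dom c" "p \<notin> C" and C: "closed C"
    and s: "\<And>p \<mu> \<nu>. p \<in> chart_dom c \<Longrightarrow> p \<notin> C \<Longrightarrow> s c p \<mu> \<nu> = 0"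
  shows "ext_d2 s c p \<mu> \<nu> \<rho> = 0"
proof -
  have "pd c \<mu> (\<lambda>q. s c q \<nu> \<rho>) p = pd c \<mu> (\<lambda>q. 0) p" for \<mu> \<nu> \<rho>
    by (rule pd_cong[OF c, of "chart_dom c \<inter> - C"]) (use p C s in \<open>auto intro: open_dom c open_Int\<close>)
  then show ?thesis unfolding ext_d2_def by (simp add: pd_const)
qed

text \<open>
  In the chart the integrand is \<open>ds\<^sup>k \<and> a\<^sup>k\<close>, which differs from \<open>- s\<^sup>k \<and> da\<^sup>k\<close> by a divergence.  Hence,
  up to the identification of \<open>S\<close> with its dual, \<open>d\<^sub>2\<^sup>* a\<close> is minus the projection of \<open>da\<close>.
\<close>

lemma E1_pairing_by_parts:
  assumes s: "\<And>i. two_form \<A> (s i)" and a: "E1_section \<A> a" and c: "c \<in> \<A>"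
    and K: "compact K" "K \<subseteq> img c"
    and off: "\<And>i c' p \<mu> \<nu>. c' \<in> \<A> \<Longrightarrow> p \<in> chart_dom c' \<Longrightarrow> p \<notin> chart_inv c ` K \<Longrightarrow> s i c' p \<mu> \<nu> = 0"
    and sg: "\<And>x. x \<in> K \<Longrightarrow> \<bar>vol c (chart_inv c x) 1 2 3 4\<bar> = sg * vol c (chart_inv c x) 1 2 3 4"
  shows "E1_inner \<A> \<Sigma> (d2 g \<Sigma> s) a = - chart_lint c (\<lambda>p. \<Sum>i\<in>UNIV. Wr c p (s i c p) (ext_d1 (a i) c p))"
proof -
  let ?C = "chart_inv c ` K" and ?d = "d2 g \<Sigma> s" and ?k = "chart_inv c"
  have C: "closed ?C" by (rule closed_inv_image[OF c K])
  have ao: "one_form \<A> (a i)" for i using a unfolding E1_section_def by blast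
  have do: "one_form \<A> (?d i)" for i using d2_E1_section[where \<sigma> = s, OF s] unfolding E1_section_def by blast
  have Kx: "?k x \<notin> ?C" if "x \<in> img c" "x \<notin> K" for x
    using inv_notin[OF c K(2)] that by blast
  \<comment> \<open>The integrand in an arbitrary chart; the form integral evaluates it in a chart that depends on the point.\<close>
  define H where "H c' p = (\<Sum>i\<in>UNIV. \<Sum>j\<in>UNIV. \<Sum>k\<in>UNIV. eps3 i j k * Wr c' p (\<Sigma> i c' p) (wedge11 (?d j c' p) (a k c' p)))" for c' p
  have inv: "H c p = H c' p" if "c' \<in> \<A>" "p \<in> chart_dom c" "p \<in> chart_dom c'" for c' p
    unfolding H_def one_form_pull[OF do c that] one_form_pull[OF ao c that] wedge11_pull1
      tensor2_pull[OF two_form_tensor2[OF Sigma_two_form] c that]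
    by (subst Wr_invariant[OF c that two_form_antisym[OF Sigma_two_form that(1,3)]]) (auto simp: wedge11_def)
  define N where "N p = (\<Sum>k\<in>UNIV. ext_d2 (s k) c p 1 2 3 * a k c p 4 - ext_d2 (s k) c p 1 2 4 * a k c p 3
     + ext_d2 (s k) c p 1 3 4 * a k c p 2 - ext_d2 (s k) c p 2 3 4 * a k c p 1)" for p
  have HN: "H c p = N p / vol c p 1 2 3 4" if p: "p \<in> chart_dom c" for p
  proof -
    interpret F: perfect_fibre "g c p" "\<lambda>i. \<Sigma> i c p" "vol c p" by (rule fibre[OF c p])
    have "(\<Sum>i\<in>UNIV. \<Sum>j\<in>UNIV. \<Sum>k\<in>UNIV. eps3 i j k * wedge22 (\<Sigma> i c p) (wedge11 (?d j c p) (a k c p)) 1 2 3 4) = N p"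
      unfolding N_def by (rule F.pairing_eps_wedge[OF d2_eps_wedge[OF s c p]])
    then show ?thesis unfolding H_def wedge_ratio_def by (simp add: sum_divide_distrib[symmetric])
  qed
  have H0: "H c' p = 0" if c': "c' \<in> \<A>" and p: "p \<in> chart_dom c'" "p \<notin> ?C" for c' p
  proof -
    have "ext_d2 (s i) c' p \<mu> \<nu> \<rho> = 0" for i \<mu> \<nu> \<rho>
      by (rule ext_d2_vanishes[OF c' p C]) (rule off[OF c'])
    then have "(\<lambda>i \<mu>. 0) = (\<lambda>i. ?d i c' p)"
      using d2_iff[where \<sigma> = s and b = "\<lambda>i \<mu>. 0", OF s c' p(1)] by (simp add: wedge12_def)
    then have "?d i c' p = (\<lambda>\<mu>. 0)" for i by (metis (no_types))
    then show ?thesis unfolding H_def by (simp add: wedge_ratio_def wedge22_def wedge11_def)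
  qed
  have smH: "smooth_in_chart c (H c)"
  proof -
    have "smooth_in_chart c (\<lambda>p. ?d j c p \<mu>)" "smooth_in_chart c (\<lambda>p. a j c p \<mu>)" for j \<mu>
      using do ao c unfolding one_form_def by blast+
    then show ?thesis
      unfolding H_def[abs_def] wedge11_def
      by (intro smooth_chart_intros c Wr_smooth two_form_smooth[OF Sigma_two_form])
  qed
  have "E1_inner \<A> \<Sigma> ?d a = (LINT p|volume_measure \<A> vol. H (chart_at \<A> p) p)"
    unfolding E1_inner_def form_integral_def Let_def H_def wedge_ratio_def by (simp add: sum_divide_distrib)
  also have "\<dots> = chart_lint c (H c)"
  proof (rule chart_integral[OF c smH])
    show "H (chart_at \<A> p) p = H c p" if "p \<in> chart_dom c" for p
      by (rule inv[OF chart_at(1) that chart_at(2), symmetric])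
    show "H (chart_at \<A> p) p = 0" if "p \<notin> chart_dom c" for p
      using that chart_inv_in[OF c] K(2) by (intro H0 chart_at) auto
  qed
  also have "\<dots> = (LINT x|lborel. sg * (indicator (img c) x * N (?k x)))"
    unfolding chart_lint_def
  proof (intro Bochner_Integration.integral_cong refl)
    fix x
    show "indicator (img c) x * (\<bar>vol c (?k x) 1 2 3 4\<bar> * H c (?k x)) = sg * (indicator (img c) x * N (?k x))"
    proof (cases "x \<in> img c")
      case True
      note p = chart_inv_in[OF c True]
      show ?thesis
      proof (cases "x \<in> K")
        case xK: True
        show ?thesis using True vol_nonzero[OF c p] by (simp add: sg[OF xK] HN[OF p])
      next
        case False
        have "H c (?k x) = 0" by (rule H0[OF c p Kx[OF True False]])
        then show ?thesis using HN[OF p] vol_nonzero[OF c p] by simp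
      qed
    qed simp
  qed
  also have "\<dots> = sg * (LINT x|lborel. indicator (img c) x * N (?k x))" by simp
  also have "(LINT x|lborel. indicator (img c) x * N (?k x))
    = - (LINT x|lborel. indicator (img c) x * (\<Sum>k\<in>UNIV. wedge22 (s k c (?k x)) (ext_d1 (a k) c (?k x)) 1 2 3 4))"
  proof -
    \<comment> \<open>The components of \<open>s\<^sup>k \<and> a\<^sup>k\<close>, whose divergence integrates to zero.\<close>
    define B where "B k \<mu> \<nu> \<rho> x = wedge12 (a k c (?k x)) (s k c (?k x)) \<mu> \<nu> \<rho>" for k \<mu> \<nu> \<rho> x
    define Y where "Y x = (\<Sum>k\<in>UNIV. wedge22 (s k c (?k x)) (ext_d1 (a k) c (?k x)) 1 2 3 4)" for x
    have smB: "smooth_on (B k \<mu> \<nu> \<rho>) (img c)" for k \<mu> \<nu> \<rho>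
    proof -
      have "smooth_in_chart c (\<lambda>p. a k c p \<mu>)" for \<mu> using ao c unfolding one_form_def by blast
      then have "smooth_in_chart c (\<lambda>p. wedge12 (a k c p) (s k c p) \<mu> \<nu> \<rho>)"
        unfolding wedge12_def by (intro smooth_chart_intros c two_form_smooth[OF s])
      then show ?thesis unfolding smooth_in_chart_def B_def[abs_def] o_def .
    qed
    have off': "s k c (?k x) \<mu> \<nu> = 0" if "x \<in> img c - K" for k x \<mu> \<nu>
      using that by (intro off[OF c] chart_inv_in[OF c] Kx) auto
    have B0: "B k \<mu> \<nu> \<rho> x = 0" if "x \<in> img c - K" for k \<mu> \<nu> \<rho> x
      unfolding B_def wedge12_def by (simp add: off'[OF that])
    let ?D = "\<lambda>k \<kappa> \<mu> \<nu> \<rho> x. indicator (img c) x * frechet_derivative (B k \<mu> \<nu> \<rho>) (at x) (axis \<kappa> 1)"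
    have iD: "integrable lborel (?D k \<kappa> \<mu> \<nu> \<rho>)" for k \<kappa> \<mu> \<nu> \<rho>
      by (rule integrable_derivative_supported_in_open[OF open_img[OF c] smB K]) (rule B0)
    have D0: "(LINT x|lborel. ?D k \<kappa> \<mu> \<nu> \<rho> x) = 0" for k \<kappa> \<mu> \<nu> \<rho>
      by (rule integral_derivative_supported_in_open[OF open_img[OF c] smB K]) (rule B0)
    have smY: "smooth_on Y (img c)"
    proof -
      have "smooth_in_chart c (\<lambda>p. \<Sum>k\<in>UNIV. wedge22 (s k c p) (ext_d1 (a k) c p) 1 2 3 4)"
        by (intro smooth_chart_intros c wedge22_smooth two_form_smooth[OF s] two_form_smooth[OF ext_d1_two_form[OF ao]])
      then show ?thesis unfolding smooth_in_chart_def Y_def[abs_def] o_def .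
    qed
    have Y0: "Y x = 0" if "x \<in> img c - K" for x
      unfolding Y_def wedge22_def by (simp add: off'[OF that])
    have iY: "integrable lborel (\<lambda>x. indicator (img c) x * Y x)"
      by (rule continuous_extension_by_zero(2)[OF open_img[OF c] smooth_on_continuous_on[OF smY] K]) (rule Y0)
    have e: "indicator (img c) x * N (?k x) = (\<Sum>k\<in>UNIV. ?D k 1 2 3 4 x - ?D k 2 1 3 4 x + ?D k 3 1 2 4 x - ?D k 4 1 2 3 x)
        - indicator (img c) x * Y x" for x
    proof (cases "x \<in> img c")
      case True
      have pdB: "pd c \<kappa> (\<lambda>q. wedge12 (a k c q) (s k c q) \<mu> \<nu> \<rho>) (?k x) = frechet_derivative (B k \<mu> \<nu> \<rho>) (at x) (axis \<kappa> 1)" for k \<kappa> \<mu> \<nu> \<rho>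
        unfolding pd_def B_def[abs_def] o_def chart_inv[OF c True] ..
      have i: "indicator (img c) x = (1::real)" using True by simp
      show ?thesis
        using divergence_wedge12[OF s[of 1] ao[of 1] c chart_inv_in[OF c True], unfolded pdB]
          divergence_wedge12[OF s[of 2] ao[of 2] c chart_inv_in[OF c True], unfolded pdB]
          divergence_wedge12[OF s[of 3] ao[of 3] c chart_inv_in[OF c True], unfolded pdB]
        unfolding N_def Y_def sum_3 i mult_1_left by linarith
    qed simp
    have "(LINT x|lborel. indicator (img c) x * N (?k x)) = 0 - (LINT x|lborel. indicator (img c) x * Y x)"
      unfolding e sum_3 using iD iY D0 by simp
    then show ?thesis unfolding Y_def by simp
  qed
  also have "sg * - (LINT x|lborel. indicator (img c) x * (\<Sum>k\<in>UNIV. wedge22 (s k c (?k x)) (ext_d1 (a k) c (?k x)) 1 2 3 4))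
    = - (LINT x|lborel. sg * (indicator (img c) x * (\<Sum>k\<in>UNIV. wedge22 (s k c (?k x)) (ext_d1 (a k) c (?k x)) 1 2 3 4)))"
    by simp
  also have "(LINT x|lborel. sg * (indicator (img c) x * (\<Sum>k\<in>UNIV. wedge22 (s k c (?k x)) (ext_d1 (a k) c (?k x)) 1 2 3 4)))
    = chart_lint c (\<lambda>p. \<Sum>i\<in>UNIV. Wr c p (s i c p) (ext_d1 (a i) c p))"
    unfolding chart_lint_def
  proof (intro Bochner_Integration.integral_cong refl)
    fix x
    show "sg * (indicator (img c) x * (\<Sum>k\<in>UNIV. wedge22 (s k c (?k x)) (ext_d1 (a k) c (?k x)) 1 2 3 4))
      = indicator (img c) x * (\<bar>vol c (?k x) 1 2 3 4\<bar> * (\<Sum>i\<in>UNIV. Wr c (?k x) (s i c (?k x)) (ext_d1 (a i) c (?k x))))"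
    proof (cases "x \<in> img c")
      case True
      note p = chart_inv_in[OF c True]
      show ?thesis
      proof (cases "x \<in> K")
        case xK: True
        show ?thesis using True vol_nonzero[OF c p]
          by (simp add: sg[OF xK] wedge_ratio_def sum_divide_distrib[symmetric])
      next
        case False
        have "s i c (?k x) \<mu> \<nu> = 0" for i \<mu> \<nu> by (rule off[OF c p Kx[OF True False]])
        then show ?thesis by (simp add: wedge_ratio_def wedge22_def)
      qed
    qed simp
  qed
  finally show ?thesis .
qed

section \<open>The inner product on \<open>S\<close>\<close>

definition S_density :: "real \<Rightarrow> real \<Rightarrow> real \<Rightarrow> 'm triple2 \<Rightarrow> 'm chart \<Rightarrow> 'm \<Rightarrow> real" where
  "S_density \<beta>1 \<beta>2 \<beta>3 s c p = S_norm \<beta>1 \<beta>2 \<beta>3 (\<lambda>i j. Wr c p (s i c p) (\<Sigma> j c p))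
     (\<Sum>i\<in>UNIV. Wr c p (s i c p) (s i c p))"

lemma S_section_two_form: "S_section \<A> g \<Sigma> s \<Longrightarrow> two_form \<A> (s i)"
  unfolding S_section_def by blast

lemma S_density_smooth:
  assumes s: "S_section \<A> g \<Sigma> s" and c: "c \<in> \<A>"
  shows "smooth_in_chart c (S_density \<beta>1 \<beta>2 \<beta>3 s c)"
proof -
  have W: "smooth_in_chart c (\<lambda>p. Wr c p (s i c p) (\<Sigma> j c p))" "smooth_in_chart c (\<lambda>p. Wr c p (s i c p) (s i c p))" for i j
    by (intro Wr_smooth c two_form_smooth S_section_two_form[OF s] Sigma_two_form)+
  show ?thesis
    unfolding S_density_def[abs_def] S_norm_def Let_def
    by (intro smooth_chart_intros c W) simp_all
qed

lemma S_density_invariant: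
  assumes s: "S_section \<A> g \<Sigma> s" and c: "c \<in> \<A>" "c' \<in> \<A>" and p: "p \<in> chart_dom c" "p \<in> chart_dom c'"
  shows "S_density \<beta>1 \<beta>2 \<beta>3 s c p = S_density \<beta>1 \<beta>2 \<beta>3 s c' p"
  unfolding S_density_def
  by (simp only: Wr_two_forms_invariant[OF S_section_two_form[OF s] Sigma_two_form c p]
    Wr_two_forms_invariant[OF S_section_two_form[OF s] S_section_two_form[OF s] c p])

lemma
  assumes s: "S_section \<A> g \<Sigma> s" and c: "c \<in> \<A>" and p: "p \<in> chart_dom c"
    and b: "\<beta>1 > 0" "\<beta>2 > 0" "\<beta>3 > 0"
  shows S_density_scaled: "S_inner_pt \<beta>1 \<beta>2 \<beta>3 (g c p) (\<lambda>i. \<Sigma> i c p) (\<lambda>i \<mu> \<nu>. k * s i c p \<mu> \<nu>) (\<lambda>i. s i c p)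
      = k * S_density \<beta>1 \<beta>2 \<beta>3 s c p"
    and S_density_nonneg: "S_density \<beta>1 \<beta>2 \<beta>3 s c p \<ge> 0"
    and S_density_zero: "S_density \<beta>1 \<beta>2 \<beta>3 s c p = 0 \<Longrightarrow> s i c p \<mu> \<nu> = 0"
proof -
  interpret F: perfect_fibre "g c p" "\<lambda>i. \<Sigma> i c p" "vol c p" by (rule fibre[OF c p])
  have f: "(\<lambda>i. s i c p) \<in> S_fibre (g c p) (\<lambda>i. \<Sigma> i c p)" using s c p unfolding S_section_def by blast
  note L = F.S_inner_pt_scaled[OF f b] F.S_norm_nonneg[OF f b] F.S_norm_zero[OF f b]
  show "S_inner_pt \<beta>1 \<beta>2 \<beta>3 (g c p) (\<lambda>i. \<Sigma> i c p) (\<lambda>i \<mu> \<nu>. k * s i c p \<mu> \<nu>) (\<lambda>i. s i c p)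
      = k * S_density \<beta>1 \<beta>2 \<beta>3 s c p"
    using L(1) unfolding S_density_def .
  show "S_density \<beta>1 \<beta>2 \<beta>3 s c p \<ge> 0"
    using L(2) unfolding S_density_def .
  assume "S_density \<beta>1 \<beta>2 \<beta>3 s c p = 0"
  then have "(\<lambda>i. s i c p) = (\<lambda>i \<mu> \<nu>. 0)"
    using L(3) unfolding S_density_def by blast
  then show "s i c p \<mu> \<nu> = 0" by (metis (no_types))
qed

lemma S_section_bump:
  assumes s: "S_section \<A> g \<Sigma> s" and \<phi>: "smooth_function \<A> \<phi>"
  shows "S_section \<A> g \<Sigma> (\<lambda>i c p \<mu> \<nu>. \<phi> p * s i c p \<mu> \<nu>)"
proof -
  have "two_form \<A> (\<lambda>c p \<mu> \<nu>. \<phi> p * s i c p \<mu> \<nu>)" for i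
  proof (rule two_formI)
    show "smooth_in_chart c (\<lambda>p. \<phi> p * s i c p \<mu> \<nu>)" if "c \<in> \<A>" for c \<mu> \<nu>
      by (rule smooth_in_chart_mult[OF that \<phi>[unfolded smooth_function_def, rule_format, OF that]
            two_form_smooth[OF S_section_two_form[OF s] that]])
    show "(\<lambda>\<mu> \<nu>. \<phi> p * s i c p \<mu> \<nu>) = pull2 (jac c c' p) (\<lambda>\<mu> \<nu>. \<phi> p * s i c' p \<mu> \<nu>)"
      if "c \<in> \<A>" "c' \<in> \<A>" "p \<in> chart_dom c" "p \<in> chart_dom c'" for c c' p
      by (intro ext) (simp only: pull2_linear tensor2_pull[OF two_form_tensor2[OF S_section_two_form[OF s]] that])
    show "\<phi> p * s i c p \<mu> \<nu> = - (\<phi> p * s i c p \<nu> \<mu>)" if "c \<in> \<A>" "p \<in> chart_dom c" for c p \<mu> \<nu>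
      by (subst two_form_antisym[OF S_section_two_form[OF s] that]) simp
  qed
  moreover have "(\<lambda>i \<mu> \<nu>. \<phi> p * s i c p \<mu> \<nu>) \<in> S_fibre (g c p) (\<lambda>i. \<Sigma> i c p)"
    if "c \<in> \<A>" "p \<in> chart_dom c" for c p
  proof -
    have "(\<lambda>i. s i c p) \<in> S_fibre (g c p) (\<lambda>i. \<Sigma> i c p)" using s that unfolding S_section_def by blast
    from perfect_fibre.S_fibre_scale[OF fibre[OF that] this] show ?thesis .
  qed
  ultimately show ?thesis unfolding S_section_def by blast
qed

end


section \<open>The linearised Einstein equations\<close>

context plebanski begin

text \<open>
  The coefficients of the self-dual part of \<open>da\<^sup>i\<close>.
\<close>

definition psi :: "'m triple1 \<Rightarrow> 'm chart \<Rightarrow> 'm \<Rightarrow> 3 \<Rightarrow> 3 \<Rightarrow> real" where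
  "psi a c p i j = Wr c p (ext_d1 (a i) c p) (\<Sigma> j c p) / 2"

definition test_section :: "'m triple1 \<Rightarrow> 'm triple2" where
  "test_section a i c p \<mu> \<nu> = (\<Sum>j\<in>UNIV. test_coeff (psi a c p) i j * \<Sigma> j c p \<mu> \<nu>) - ext_d1 (a i) c p \<mu> \<nu>"

definition test_density :: "'m triple1 \<Rightarrow> 'm chart \<Rightarrow> 'm \<Rightarrow> real" where
  "test_density a c p = (\<Sum>i\<in>UNIV. Wr c p (test_section a i c p) (ext_d1 (a i) c p))"

context
  fixes a :: "'m triple1"
  assumes a: "E1_section \<A> a"
begin

lemma da_two_form: "two_form \<A> (ext_d1 (a i))"
  using a unfolding E1_section_def by (intro ext_d1_two_form) blast

lemma psi_invariant:
  assumes "c \<in> \<A>" "c' \<in> \<A>" "p \<in> chart_dom c" "p \<in> chart_dom c'"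
  shows "psi a c p = psi a c' p"
  unfolding psi_def[abs_def] by (simp only: Wr_two_forms_invariant[OF da_two_form Sigma_two_form assms])

lemma psi_smooth: "c \<in> \<A> \<Longrightarrow> smooth_in_chart c (\<lambda>p. psi a c p i j)"
  unfolding psi_def by (intro smooth_chart_intros Wr_smooth two_form_smooth da_two_form Sigma_two_form) simp_all

lemma test_section_S: "S_section \<A> g \<Sigma> (test_section a)"
proof -
  have "two_form \<A> (test_section a i)" for i
  proof (rule two_formI)
    show "smooth_in_chart c (\<lambda>p. test_section a i c p \<mu> \<nu>)" if "c \<in> \<A>" for c \<mu> \<nu>
      unfolding test_section_def test_coeff_def
      by (intro smooth_chart_intros that psi_smooth two_form_smooth da_two_form Sigma_two_form) simp_all
    show "test_section a i c p = pull2 (jac c c' p) (test_section a i c' p)"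
      if "c \<in> \<A>" "c' \<in> \<A>" "p \<in> chart_dom c" "p \<in> chart_dom c'" for c c' p
      unfolding test_section_def[abs_def]
      by (intro ext) (simp only: pull2_linear pull2_sum psi_invariant[OF that]
          tensor2_pull[OF two_form_tensor2[OF Sigma_two_form] that] tensor2_pull[OF two_form_tensor2[OF da_two_form] that])
    show "test_section a i c p \<mu> \<nu> = - test_section a i c p \<nu> \<mu>" if "c \<in> \<A>" "p \<in> chart_dom c" for c p \<mu> \<nu>
      unfolding test_section_def sum_3
      using two_form_antisym[OF Sigma_two_form that, of _ \<mu> \<nu>] two_form_antisym[OF da_two_form that, of i \<mu> \<nu>]
      by simp
  qed
  moreover have "(\<lambda>i. test_section a i c p) \<in> S_fibre (g c p) (\<lambda>i. \<Sigma> i c p)"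
    if "c \<in> \<A>" "p \<in> chart_dom c" for c p
  proof -
    interpret F: perfect_fibre "g c p" "\<lambda>i. \<Sigma> i c p" "vol c p" by (rule fibre[OF that])
    show ?thesis
      using F.test_in_S_fibre[of "\<lambda>i. ext_d1 (a i) c p", OF two_form_antisym[OF da_two_form that]]
      unfolding test_section_def[abs_def] psi_def[abs_def] .
  qed
  ultimately show ?thesis unfolding S_section_def by blast
qed

lemma test_density_smooth: "c \<in> \<A> \<Longrightarrow> smooth_in_chart c (test_density a c)"
  unfolding test_density_def[abs_def]
  by (intro smooth_chart_intros Wr_smooth two_form_smooth S_section_two_form[OF test_section_S] da_two_form)

lemma
  assumes "c \<in> \<A>" "p \<in> chart_dom c"
  shows test_density_nonneg: "test_density a c p \<ge> 0"
    and test_density_zero: "test_density a c p = 0 \<Longrightarrow>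
      (\<forall>i \<mu> \<nu>. ext_d1 (a i) c p \<mu> \<nu> = (\<Sum>j\<in>UNIV. psi a c p i j * \<Sigma> j c p \<mu> \<nu>))
      \<and> (\<forall>i j. psi a c p i j = psi a c p j i) \<and> (\<Sum>i\<in>UNIV. psi a c p i i) = 0"
proof -
  interpret F: perfect_fibre "g c p" "\<lambda>i. \<Sigma> i c p" "vol c p" by (rule fibre[OF assms])
  have as: "\<And>i \<mu> \<nu>. ext_d1 (a i) c p \<mu> \<nu> = - ext_d1 (a i) c p \<nu> \<mu>" by (rule two_form_antisym[OF da_two_form assms])
  show "test_density a c p \<ge> 0"
    using F.test_pairing_nonneg[of "\<lambda>i. ext_d1 (a i) c p", OF as]
    unfolding test_density_def test_section_def[abs_def] psi_def[abs_def] .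
  show "test_density a c p = 0 \<Longrightarrow>
      (\<forall>i \<mu> \<nu>. ext_d1 (a i) c p \<mu> \<nu> = (\<Sum>j\<in>UNIV. psi a c p i j * \<Sigma> j c p \<mu> \<nu>))
      \<and> (\<forall>i j. psi a c p i j = psi a c p j i) \<and> (\<Sum>i\<in>UNIV. psi a c p i i) = 0"
    using F.test_pairing_zero[of "\<lambda>i. ext_d1 (a i) c p", OF as]
    unfolding test_density_def test_section_def[abs_def] psi_def[abs_def] .
qed

end

lemma Wr_scale_left: "Wr c p (\<lambda>\<mu> \<nu>. k * s \<mu> \<nu>) t = k * Wr c p s t"
  unfolding wedge_ratio_def wedge22_def by (simp add: algebra_simps)

text \<open>
  The fundamental lemma of the calculus of variations, for a nonnegative \<open>h\<close>.
\<close>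

lemma bump_density_zero:
  assumes c: "c \<in> \<A>" and p0: "p0 \<in> chart_dom c" and bump: "bump c K \<phi>" and pos: "\<phi> p0 > 0"
    and h: "smooth_in_chart c h" "\<forall>p\<in>chart_dom c. h p \<ge> 0"
    and int0: "chart_lint c (\<lambda>p. \<phi> p * h p) = 0"
  shows "h p0 = 0"
proof -
  let ?f = "\<lambda>x. \<bar>vol c (chart_inv c x) 1 2 3 4\<bar> * (\<phi> (chart_inv c x) * h (chart_inv c x))"
  have K: "compact K" "K \<subseteq> img c" and nonneg: "\<And>p. \<phi> p \<ge> 0" using bump unfolding bump_def by blast+
  have off: "\<And>p. p \<notin> chart_inv c ` K \<Longrightarrow> \<phi> p = 0" using bump unfolding bump_def by blast
  have sm: "smooth_in_chart c \<phi>" using bump c unfolding bump_def smooth_function_def by blast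
  have "?f (chart_map c p0) = 0"
  proof (rule nonneg_integral_zero_imp_zero[OF open_img[OF c] _ K _ _ int0[unfolded chart_lint_def]])
    show "continuous_on (img c) ?f"
      using smooth_on_continuous_on[OF sm[unfolded smooth_in_chart_def]]
        smooth_on_continuous_on[OF h(1)[unfolded smooth_in_chart_def]]
      by (intro continuous_intros v_continuous[OF c]) (simp_all add: o_def)
    show "?f x = 0" if "x \<in> img c - K" for x
      using off[OF inv_notin[OF c K(2)], of x] that by simp
    show "?f x \<ge> 0" if "x \<in> img c" for x
      using nonneg h(2) chart_inv_in[OF c that] by simp
    show "chart_map c p0 \<in> img c" using p0 by blast
  qed
  then show ?thesis using inv_chart[OF c p0] vol_nonzero[OF c p0] pos by simp
qed

text \<open>
  The defining property of the adjoint, tested on \<open>\<phi> t\<close> with \<open>t \<in> S\<close> not necessarily of compact support.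
\<close>

lemma weak_form:
  assumes adj: "formal_adjoint_d2 \<beta>1 \<beta>2 \<beta>3 \<A> g \<Sigma> D" and a: "E1_section \<A> a"
    and t: "S_section \<A> g \<Sigma> t" and c: "c \<in> \<A>" and bump: "bump c K \<phi>"
  shows "S_inner \<beta>1 \<beta>2 \<beta>3 \<A> g \<Sigma> (\<lambda>i c p \<mu> \<nu>. \<phi> p * t i c p \<mu> \<nu>) (D a)
    = - chart_lint c (\<lambda>p. \<phi> p * (\<Sum>i\<in>UNIV. Wr c p (t i c p) (ext_d1 (a i) c p)))"
proof -
  let ?s = "\<lambda>i c p \<mu> \<nu>. \<phi> p * t i c p \<mu> \<nu>"
  have K: "compact K" "K \<subseteq> img c" and \<phi>: "smooth_function \<A> \<phi>" using bump unfolding bump_def by blast+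
  have off: "\<And>p. p \<notin> chart_inv c ` K \<Longrightarrow> \<phi> p = 0" using bump unfolding bump_def by blast
  obtain sg where sg: "\<And>x. x \<in> K \<Longrightarrow> \<bar>vol c (chart_inv c x) 1 2 3 4\<bar> = sg * vol c (chart_inv c x) 1 2 3 4"
    using bump unfolding bump_def by blast
  have S: "S_section \<A> g \<Sigma> ?s" by (rule S_section_bump[OF t \<phi>])
  have "compactly_supported \<A> ?s"
    unfolding compactly_supported_def
    by (intro exI[of _ "chart_inv c ` K"]) (simp add: compact_inv_image[OF c K] off)
  then have "S_inner \<beta>1 \<beta>2 \<beta>3 \<A> g \<Sigma> ?s (D a) = E1_inner \<A> \<Sigma> (d2 g \<Sigma> ?s) a"
    using adj a S unfolding formal_adjoint_d2_def by simp
  also have "\<dots> = - chart_lint c (\<lambda>p. \<Sum>i\<in>UNIV. Wr c p (?s i c p) (ext_d1 (a i) c p))"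
    by (rule E1_pairing_by_parts[OF S_section_two_form[OF S] a c K _ sg]) (simp_all add: off)
  finally show ?thesis unfolding Wr_scale_left sum_distrib_left[symmetric] .
qed

lemma S_inner_bump:
  assumes s: "S_section \<A> g \<Sigma> s" and c: "c \<in> \<A>" and bump: "bump c K \<phi>"
    and b: "\<beta>1 > 0" "\<beta>2 > 0" "\<beta>3 > 0"
  shows "S_inner \<beta>1 \<beta>2 \<beta>3 \<A> g \<Sigma> (\<lambda>i c p \<mu> \<nu>. \<phi> p * s i c p \<mu> \<nu>) s
    = chart_lint c (\<lambda>p. \<phi> p * S_density \<beta>1 \<beta>2 \<beta>3 s c p)"
proof -
  have K: "K \<subseteq> img c" and \<phi>: "smooth_in_chart c \<phi>" using bump c unfolding bump_def smooth_function_def by blast+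
  have off: "\<And>p. p \<notin> chart_inv c ` K \<Longrightarrow> \<phi> p = 0" using bump unfolding bump_def by blast
  have "S_inner \<beta>1 \<beta>2 \<beta>3 \<A> g \<Sigma> (\<lambda>i c p \<mu> \<nu>. \<phi> p * s i c p \<mu> \<nu>) s
    = (LINT p|volume_measure \<A> vol. \<phi> p * S_density \<beta>1 \<beta>2 \<beta>3 s (chart_at \<A> p) p)"
    unfolding S_inner_def form_integral_def Let_def
    by (intro Bochner_Integration.integral_cong refl)
       (simp add: S_density_scaled[OF s chart_at b] vol_nonzero[OF chart_at])
  also have "\<dots> = chart_lint c (\<lambda>p. \<phi> p * S_density \<beta>1 \<beta>2 \<beta>3 s c p)"
  proof (rule chart_integral[OF c])
    show "smooth_in_chart c (\<lambda>p. \<phi> p * S_density \<beta>1 \<beta>2 \<beta>3 s c p)"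
      by (rule smooth_in_chart_mult[OF c \<phi> S_density_smooth[OF s c]])
    show "\<phi> p * S_density \<beta>1 \<beta>2 \<beta>3 s (chart_at \<A> p) p = \<phi> p * S_density \<beta>1 \<beta>2 \<beta>3 s c p"
      if "p \<in> chart_dom c" for p
      using S_density_invariant[OF s chart_at(1) c chart_at(2) that] by simp
    show "\<phi> p * S_density \<beta>1 \<beta>2 \<beta>3 s (chart_at \<A> p) p = 0" if "p \<notin> chart_dom c" for p
    proof -
      have "p \<notin> chart_inv c ` K" using that K chart_inv_in[OF c] by blast
      then show ?thesis by (simp add: off)
    qed
  qed
  finally show ?thesis .
qed

text \<open>
  If \<open>da = \<psi> \<Sigma>\<close> then \<open>S\<close> pairs to zero with \<open>da\<close>, so \<open>d\<^sub>2\<^sup>* a\<close> is orthogonal to \<open>\<phi> d\<^sub>2\<^sup>* a\<close>, and the inner product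
  on \<open>S\<close> is positive definite.
\<close>

theorem adjoint_zero_if_curvature:
  assumes b: "\<beta>1 > 0" "\<beta>2 > 0" "\<beta>3 > 0"
    and adj: "formal_adjoint_d2 \<beta>1 \<beta>2 \<beta>3 \<A> g \<Sigma> D" and a: "E1_section \<A> a"
    and \<psi>: "\<And>i j p. \<psi> i j p = \<psi> j i p" "\<And>p. (\<Sum>i\<in>UNIV. \<psi> i i p) = 0"
    and F: "\<And>c p i \<mu> \<nu>. c \<in> \<A> \<Longrightarrow> p \<in> chart_dom c \<Longrightarrow>
      ext_d1 (a i) c p \<mu> \<nu> = (\<Sum>j\<in>UNIV. \<psi> i j p * \<Sigma> j c p \<mu> \<nu>)"
    and c: "c \<in> \<A>" and p0: "p0 \<in> chart_dom c"
  shows "D a i c p0 \<mu> \<nu> = 0"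
proof -
  have D: "S_section \<A> g \<Sigma> (D a)" using adj a unfolding formal_adjoint_d2_def by blast
  obtain K \<phi> where bump: "bump c K \<phi>" and pos: "\<phi> p0 > 0" by (rule bump_exists[OF c p0])
  have "(\<Sum>i\<in>UNIV. Wr c p (D a i c p) (ext_d1 (a i) c p)) = 0" if p: "p \<in> chart_dom c" for p
  proof -
    interpret F: perfect_fibre "g c p" "\<lambda>i. \<Sigma> i c p" "vol c p" by (rule fibre[OF c p])
    have "(\<lambda>i. D a i c p) \<in> S_fibre (g c p) (\<lambda>i. \<Sigma> i c p)" using D c p unfolding S_section_def by blast
    from F.S_fibre_annihilates[OF this, of "\<lambda>i j. \<psi> i j p" "\<lambda>i. ext_d1 (a i) c p", OF \<psi> F[OF c p]]
    show ?thesis .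
  qed
  then have z: "indicator (img c) x * (\<bar>vol c (chart_inv c x) 1 2 3 4\<bar> * (\<phi> (chart_inv c x) *
      (\<Sum>i\<in>UNIV. Wr c (chart_inv c x) (D a i c (chart_inv c x)) (ext_d1 (a i) c (chart_inv c x))))) = 0" for x
    by (cases "x \<in> img c") (simp_all add: chart_inv_in[OF c])
  have "S_inner \<beta>1 \<beta>2 \<beta>3 \<A> g \<Sigma> (\<lambda>i c p \<mu> \<nu>. \<phi> p * D a i c p \<mu> \<nu>) (D a) = 0"
    unfolding weak_form[OF adj a D c bump] chart_lint_def z by simp
  then have int0: "chart_lint c (\<lambda>p. \<phi> p * S_density \<beta>1 \<beta>2 \<beta>3 (D a) c p) = 0"
    unfolding S_inner_bump[OF D c bump b] .
  have "\<forall>p\<in>chart_dom c. S_density \<beta>1 \<beta>2 \<beta>3 (D a) c p \<ge> 0"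
    using S_density_nonneg[OF D c _ b] by blast
  from bump_density_zero[OF c p0 bump pos S_density_smooth[OF D c] this int0]
  show ?thesis by (rule S_density_zero[OF D c p0 b])
qed

text \<open>
  If \<open>d\<^sub>2\<^sup>* a = 0\<close> then \<open>da\<close> pairs to zero with \<open>\<phi> T\<close> for the test section \<open>T \<in> S\<close> built from \<open>da\<close>.
\<close>

theorem curvature_if_adjoint_zero:
  assumes adj: "formal_adjoint_d2 \<beta>1 \<beta>2 \<beta>3 \<A> g \<Sigma> D" and a: "E1_section \<A> a"
    and z: "\<forall>i. \<forall>c\<in>\<A>. \<forall>p\<in>chart_dom c. \<forall>\<mu> \<nu>. D a i c p \<mu> \<nu> = 0"
    and c: "c \<in> \<A>" and p0: "p0 \<in> chart_dom c"
  shows "\<forall>i \<mu> \<nu>. ext_d1 (a i) c p0 \<mu> \<nu> = (\<Sum>j\<in>UNIV. psi a c p0 i j * \<Sigma> j c p0 \<mu> \<nu>)"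
    and "\<forall>i j. psi a c p0 i j = psi a c p0 j i" and "(\<Sum>i\<in>UNIV. psi a c p0 i i) = 0"
proof -
  obtain K \<phi> where bump: "bump c K \<phi>" and pos: "\<phi> p0 > 0" by (rule bump_exists[OF c p0])
  have "S_inner_pt \<beta>1 \<beta>2 \<beta>3 (g c p) (\<lambda>i. \<Sigma> i c p) t (\<lambda>i. D a i c p) = 0"
    if "c \<in> \<A>" "p \<in> chart_dom c" for c p t
  proof -
    have "(\<lambda>i. D a i c p) = (\<lambda>i \<mu> \<nu>. 0)" using z that by (intro ext) blast
    then show ?thesis using perfect_fibre.S_inner_pt_zero_right[OF fibre[OF that]] by simp
  qed
  then have "S_inner \<beta>1 \<beta>2 \<beta>3 \<A> g \<Sigma> (\<lambda>i c p \<mu> \<nu>. \<phi> p * test_section a i c p \<mu> \<nu>) (D a) = 0"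
    unfolding S_inner_def form_integral_def Let_def by (simp add: chart_at)
  then have int0: "chart_lint c (\<lambda>p. \<phi> p * test_density a c p) = 0"
    unfolding weak_form[OF adj a test_section_S[OF a] c bump] test_density_def by simp
  have "\<forall>p\<in>chart_dom c. test_density a c p \<ge> 0"
    using test_density_nonneg[OF a c] by blast
  from bump_density_zero[OF c p0 bump pos test_density_smooth[OF a c] this int0]
  have "test_density a c p0 = 0" .
  from test_density_zero[OF a c p0 this]
  show "\<forall>i \<mu> \<nu>. ext_d1 (a i) c p0 \<mu> \<nu> = (\<Sum>j\<in>UNIV. psi a c p0 i j * \<Sigma> j c p0 \<mu> \<nu>)"
    "\<forall>i j. psi a c p0 i j = psi a c p0 j i" "(\<Sum>i\<in>UNIV. psi a c p0 i i) = 0" by blast+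
qed

end

theorem theorem2:
  fixes \<A> :: "'m::{t2_space, second_countable_topology} chart set"
    and \<Sigma> \<sigma> :: "'m triple2" and g :: "'m field2"
    and d2_adj :: "'m triple1 \<Rightarrow> 'm triple2"
    and \<beta>\<^sub>1 \<beta>\<^sub>2 \<beta>\<^sub>3 :: real
  assumes "smooth_atlas \<A>"
    and "perfect_triple \<A> \<Sigma>"
    and "metric_of_triple \<A> \<Sigma> g"
    and closed: "\<forall>i. \<forall>c\<in>\<A>. \<forall>p\<in>chart_dom c. \<forall>\<mu> \<nu> \<rho>. ext_d2 (\<Sigma> i) c p \<mu> \<nu> \<rho> = 0"
    and "\<beta>\<^sub>1 > 0" "\<beta>\<^sub>2 > 0" "\<beta>\<^sub>3 > 0"
    and "formal_adjoint_d2 \<beta>\<^sub>1 \<beta>\<^sub>2 \<beta>\<^sub>3 \<A> g \<Sigma> d2_adj"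
    and "S_section \<A> g \<Sigma> \<sigma>"
  shows "(\<exists>(a :: 'm triple1) (\<psi> :: 3 \<Rightarrow> 3 \<Rightarrow> 'm \<Rightarrow> real).
            E1_section \<A> a \<and>
            (\<forall>i j. smooth_function \<A> (\<psi> i j)) \<and>
            (\<forall>i j p. \<psi> i j p = \<psi> j i p) \<and>
            (\<forall>p. (\<Sum>i\<in>UNIV. \<psi> i i p) = 0) \<and>
            (\<forall>c\<in>\<A>. \<forall>p\<in>chart_dom c.
               (\<forall>i \<mu> \<nu> \<rho>. ext_d2 (\<sigma> i) c p \<mu> \<nu> \<rho>
                  + (\<Sum>j\<in>UNIV. \<Sum>k\<in>UNIV. eps3 i j k * wedge12 (a j c p) (\<Sigma> k c p) \<mu> \<nu> \<rho>) = 0) \<and>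
               (\<forall>i \<mu> \<nu>. ext_d1 (a i) c p \<mu> \<nu> = (\<Sum>j\<in>UNIV. \<psi> i j p * \<Sigma> j c p \<mu> \<nu>))))
         \<longleftrightarrow> (\<forall>i. \<forall>c\<in>\<A>. \<forall>p\<in>chart_dom c. \<forall>\<mu> \<nu>. d2_adj (d2 g \<Sigma> \<sigma>) i c p \<mu> \<nu> = 0)"
proof -
  interpret plebanski \<A> \<Sigma> g
    using assms(1-3) by unfold_locales
  let ?a = "d2 g \<Sigma> \<sigma>"
  note \<sigma> = assms(9) and adj = assms(8)
  note s = S_section_two_form[OF \<sigma>]
  have a: "E1_section \<A> ?a" by (rule d2_E1_section[where \<sigma> = \<sigma>, OF s])
  show ?thesis (is "?Einstein \<longleftrightarrow> ?zero")
  proof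
    assume ?Einstein
    then obtain a' \<psi> where E: "\<forall>i j p. \<psi> i j p = \<psi> j i p" "\<forall>p. (\<Sum>i\<in>UNIV. \<psi> i i p) = 0"
      "\<forall>c\<in>\<A>. \<forall>p\<in>chart_dom c.
         (\<forall>i \<mu> \<nu> \<rho>. ext_d2 (\<sigma> i) c p \<mu> \<nu> \<rho>
            + (\<Sum>j\<in>UNIV. \<Sum>k\<in>UNIV. eps3 i j k * wedge12 (a' j c p) (\<Sigma> k c p) \<mu> \<nu> \<rho>) = 0) \<and>
         (\<forall>i \<mu> \<nu>. ext_d1 (a' i) c p \<mu> \<nu> = (\<Sum>j\<in>UNIV. \<psi> i j p * \<Sigma> j c p \<mu> \<nu>))"
      by (elim exE conjE) (rule that)
    have \<psi>: "\<And>i j p. \<psi> i j p = \<psi> j i p" "\<And>p. (\<Sum>i\<in>UNIV. \<psi> i i p) = 0"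
      using E(1,2) by blast+
    have eq: "(\<lambda>i. a' i c p) = (\<lambda>i. ?a i c p)" if "c \<in> \<A>" "p \<in> chart_dom c" for c p
      using d2_iff[where \<sigma> = \<sigma> and b = "\<lambda>i. a' i c p", OF s that] E(3) that by blast
    have F: "ext_d1 (?a i) c p \<mu> \<nu> = (\<Sum>j\<in>UNIV. \<psi> i j p * \<Sigma> j c p \<mu> \<nu>)"
      if "c \<in> \<A>" "p \<in> chart_dom c" for c p i \<mu> \<nu>
    proof -
      have e: "?a i c q \<kappa> = a' i c q \<kappa>" if q: "q \<in> chart_dom c" for q \<kappa>
        using fun_cong[OF fun_cong[OF eq[OF \<open>c \<in> \<A>\<close> q]], of i \<kappa>] by simp
      have "pd c \<kappa> (\<lambda>q. ?a i c q l) p = pd c \<kappa> (\<lambda>q. a' i c q l) p" for \<kappa> l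
        by (rule pd_cong_dom[OF that]) (rule e)
      moreover have "ext_d1 (a' i) c p \<mu> \<nu> = (\<Sum>j\<in>UNIV. \<psi> i j p * \<Sigma> j c p \<mu> \<nu>)"
        using E(3) that by blast
      ultimately show ?thesis unfolding ext_d1_def by simp
    qed
    show ?zero
      using adjoint_zero_if_curvature[where \<psi> = \<psi>, OF assms(5-7) adj a \<psi> F] by blast
  next
    assume z: ?zero
    note curvature = curvature_if_adjoint_zero[OF adj a z]
    define \<psi> where "\<psi> i j p = psi ?a (chart_at \<A> p) p i j" for i j p
    have \<psi>: "\<psi> i j p = psi ?a c p i j" if "c \<in> \<A>" "p \<in> chart_dom c" for c p i j
      unfolding \<psi>_def psi_invariant[OF a chart_at(1) that(1) chart_at(2) that(2)] ..
    show ?Einstein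
    proof (intro exI[of _ ?a] exI[of _ \<psi>] conjI allI ballI a)
      show "smooth_function \<A> (\<psi> i j)" for i j
        unfolding smooth_function_def
      proof
        fix c assume c: "c \<in> \<A>"
        show "smooth_in_chart c (\<psi> i j)"
          by (rule smooth_in_chart_cong[OF c _ psi_smooth[OF a c]]) (rule \<psi>[OF c, symmetric])
      qed
      show "\<psi> i j p = \<psi> j i p" for i j p
        unfolding \<psi>_def using curvature(2)[OF chart_at] by blast
      show "(\<Sum>i\<in>UNIV. \<psi> i i p) = 0" for p
        unfolding \<psi>_def by (rule curvature(3)[OF chart_at])
      fix c p assume cp: "c \<in> \<A>" "p \<in> chart_dom c"
      show "ext_d2 (\<sigma> i) c p \<mu> \<nu> \<rho>
          + (\<Sum>j\<in>UNIV. \<Sum>k\<in>UNIV. eps3 i j k * wedge12 (?a j c p) (\<Sigma> k c p) \<mu> \<nu> \<rho>) = 0" for i \<mu> \<nu> \<rho>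
        using d2_iff[where \<sigma> = \<sigma> and b = "\<lambda>i. ?a i c p", OF s cp] by blast
      show "ext_d1 (?a i) c p \<mu> \<nu> = (\<Sum>j\<in>UNIV. \<psi> i j p * \<Sigma> j c p \<mu> \<nu>)" for i \<mu> \<nu>
        using curvature(1)[OF cp] unfolding \<psi>[OF cp] by blast
    qed
  qed
qed

end
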